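(* Let $s\in(0,1)$, let $\Omega\subset\mathbb{R}^N$ be a bounded strictly convex domain of class $C^2$, and let $g\colon\mathbb{R}^N\setminus\Omega\to\mathbb{R}$ be continuous and bounded. Then there is a unique viscosity solution $u$ (in the sense described in the context) of \[ \begin{cases} \displaystyle \Lambda_1^s u(x)\coloneqq \inf\left\{\int_{\mathbb{R}}\frac{u(x+tz)-u(x)}{|t|^{1+2s}}\,dt\colon z\in\mathbb{S}^{N-1}\right\}=0, & x\in\Omega,\\[6pt] u(x)=g(x), & x\in\mathbb{R}^N\setminus\Omega. \end{cases} \] This solution is continuous in $\overline\Omega$ and the datum is taken with continuity, that is, $u|_{\partial\Omega}=g|_{\partial\Omega}$.
   Context: Integrals are principal value integrals; $\mathbb{S}^{N-1}$ is the unit sphere. For $u\colon\overline\Omega\to\mathbb{R}$ let the upper $g$-extension be $u^g=u$ in $\Omega$, $u^g=g$ in $\mathbb{R}^N\setminus\overline\Omega$, $u^g=\max\{u,g\}$ on $\partial\Omega$; the lower $g$-extension $u_g$ uses $\min$ instead. For $\delta>0$, $z\in\mathbb{S}^{N-1}$, a $C^2$ function $\phi$ and a function $w$, set $E_{z,\delta}(w,\phi,x)\coloneqq\int_{-\delta}^{\delta}\frac{\phi(x+tz)-\phi(x)}{|t|^{1+2s}}dt+\int_{\mathbb{R}\setminus(-\delta,\delta)}\frac{w(x+tz)-u(x)}{|t|^{1+2s}}dt$ and $E_\delta(w,\phi,x)\coloneqq-\inf_{z\in\mathbb{S}^{N-1}}E_{z,\delta}(w,\phi,x)$. A bounded upper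 semicontinuous $u\colon\mathbb{R}^N\to\mathbb{R}$ is a viscosity subsolution if $u\le g$ in $\mathbb{R}^N\setminus\overline\Omega$ and for every $\delta>0$ and $\phi\in C^2(\mathbb{R}^N)$ such that $x_0$ is a maximum point of $u-\phi$ in $B_\delta(x_0)$: $E_\delta(u^g,\phi,x_0)\le0$ if $x_0\in\Omega$, and $\min\{E_\delta(u^g,\phi,x_0),u(x_0)-g(x_0)\}\le 0$ if $x_0\in\partial\Omega$ (if $u$ is not upper semicontinuous, this is required of its upper semicontinuous envelope). Viscosity supersolutions are defined analogously, with lower semicontinuity, $u_g$, minimum points and reversed inequalities (with $\max$ instead of $\min$ on $\partial\Omega$). A viscosity solution is both a sub- and a supersolution. *)

theory Defs
  imports "HOL-Analysis.Analysis"
begin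

definition C2_fun :: "('a::euclidean_space \<Rightarrow> real) \<Rightarrow> bool" where
  "C2_fun \<phi> \<longleftrightarrow> (\<exists>G H. (\<forall>x. (\<phi> has_derivative (\<lambda>h. G x \<bullet> h)) (at x)) \<and>
                     (\<forall>x. (G has_derivative H x) (at x)) \<and>
                     (\<forall>i\<in>Basis. \<forall>j\<in>Basis. continuous_on UNIV (\<lambda>x. H x i \<bullet> j)))"

definition C2_domain :: "'a::euclidean_space set \<Rightarrow> bool" where
  "C2_domain \<Omega> \<longleftrightarrow> open \<Omega> \<and> connected \<Omega> \<and> \<Omega> \<noteq> {} \<and>
     (\<exists>\<rho>. C2_fun \<rho> \<and> \<Omega> = {x. \<rho> x < 0} \<and> frontier \<Omega> = {x. \<rho> x = 0} \<and>
          (\<forall>x\<in>frontier \<Omega>. \<not> (\<rho> has_derivative (\<lambda>h. 0)) (at x)))"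

definition strictly_convex_set :: "'a::euclidean_space set \<Rightarrow> bool" where
  "strictly_convex_set \<Omega> \<longleftrightarrow> convex \<Omega> \<and>
     (\<forall>x\<in>closure \<Omega>. \<forall>y\<in>closure \<Omega>. x \<noteq> y \<longrightarrow> open_segment x y \<subseteq> \<Omega>)"

definition upper_ext :: "'a::euclidean_space set \<Rightarrow> ('a \<Rightarrow> real) \<Rightarrow> ('a \<Rightarrow> real) \<Rightarrow> 'a \<Rightarrow> real" where
  "upper_ext \<Omega> g u x = (if x \<in> \<Omega> then u x else if x \<in> frontier \<Omega> then max (u x) (g x) else g x)"

definition lower_ext :: "'a::euclidean_space set \<Rightarrow> ('a \<Rightarrow> real) \<Rightarrow> ('a \<Rightarrow> real) \<Rightarrow> 'a \<Rightarrow> real" where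
  "lower_ext \<Omega> g u x = (if x \<in> \<Omega> then u x else if x \<in> frontier \<Omega> then min (u x) (g x) else g x)"

text \<open>E_{z,delta}(w,phi,x) with u(x) passed as the value ux. The first integral is a
  principal value integral: limit as eps -> 0+ of the integral over eps < |t| < delta.\<close>

definition E_dir :: "real \<Rightarrow> real \<Rightarrow> ('a::euclidean_space \<Rightarrow> real) \<Rightarrow> ('a \<Rightarrow> real) \<Rightarrow> real \<Rightarrow> 'a \<Rightarrow> 'a \<Rightarrow> real" where
  "E_dir s \<delta> w \<phi> ux x z =
     Lim (at_right 0) (\<lambda>\<epsilon>. set_lebesgue_integral lborel {t::real. \<epsilon> < \<bar>t\<bar> \<and> \<bar>t\<bar> < \<delta>}
            (\<lambda>t. (\<phi> (x + t *\<^sub>R z) - \<phi> x) / \<bar>t\<bar> powr (1 + 2 * s)))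
   + set_lebesgue_integral lborel {t::real. \<delta> \<le> \<bar>t\<bar>}
            (\<lambda>t. (w (x + t *\<^sub>R z) - ux) / \<bar>t\<bar> powr (1 + 2 * s))"

definition E_op :: "real \<Rightarrow> real \<Rightarrow> ('a::euclidean_space \<Rightarrow> real) \<Rightarrow> ('a \<Rightarrow> real) \<Rightarrow> real \<Rightarrow> 'a \<Rightarrow> real" where
  "E_op s \<delta> w \<phi> ux x = - (INF z\<in>sphere 0 1. E_dir s \<delta> w \<phi> ux x z)"

definition usc_env :: "('a::euclidean_space \<Rightarrow> real) \<Rightarrow> 'a \<Rightarrow> real" where
  "usc_env u x = (INF r\<in>{0<..}. SUP y\<in>ball x r. u y)"

definition lsc_env :: "('a::euclidean_space \<Rightarrow> real) \<Rightarrow> 'a \<Rightarrow> real" where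
  "lsc_env u x = (SUP r\<in>{0<..}. INF y\<in>ball x r. u y)"

definition subsol_cond :: "real \<Rightarrow> 'a::euclidean_space set \<Rightarrow> ('a \<Rightarrow> real) \<Rightarrow> ('a \<Rightarrow> real) \<Rightarrow> bool" where
  "subsol_cond s \<Omega> g u \<longleftrightarrow>
     (\<forall>x. x \<notin> closure \<Omega> \<longrightarrow> u x \<le> g x) \<and>
     (\<forall>\<delta>>0. \<forall>\<phi>. \<forall>x0. C2_fun \<phi> \<longrightarrow> (\<forall>y\<in>ball x0 \<delta>. u y - \<phi> y \<le> u x0 - \<phi> x0) \<longrightarrow>
        (x0 \<in> \<Omega> \<longrightarrow> E_op s \<delta> (upper_ext \<Omega> g u) \<phi> (u x0) x0 \<le> 0) \<and>
        (x0 \<in> frontier \<Omega> \<longrightarrow> min (E_op s \<delta> (upper_ext \<Omega> g u) \<phi> (u x0) x0) (u x0 - g x0) \<le> 0))"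

definition supersol_cond :: "real \<Rightarrow> 'a::euclidean_space set \<Rightarrow> ('a \<Rightarrow> real) \<Rightarrow> ('a \<Rightarrow> real) \<Rightarrow> bool" where
  "supersol_cond s \<Omega> g u \<longleftrightarrow>
     (\<forall>x. x \<notin> closure \<Omega> \<longrightarrow> u x \<ge> g x) \<and>
     (\<forall>\<delta>>0. \<forall>\<phi>. \<forall>x0. C2_fun \<phi> \<longrightarrow> (\<forall>y\<in>ball x0 \<delta>. u y - \<phi> y \<ge> u x0 - \<phi> x0) \<longrightarrow>
        (x0 \<in> \<Omega> \<longrightarrow> E_op s \<delta> (lower_ext \<Omega> g u) \<phi> (u x0) x0 \<ge> 0) \<and>
        (x0 \<in> frontier \<Omega> \<longrightarrow> max (E_op s \<delta> (lower_ext \<Omega> g u) \<phi> (u x0) x0) (u x0 - g x0) \<ge> 0))"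

text \<open>For a bounded u the conditions are imposed on its upper (resp. lower)
  semicontinuous envelope; for usc (resp. lsc) u the envelope is u itself.\<close>

definition viscosity_subsolution :: "real \<Rightarrow> 'a::euclidean_space set \<Rightarrow> ('a \<Rightarrow> real) \<Rightarrow> ('a \<Rightarrow> real) \<Rightarrow> bool" where
  "viscosity_subsolution s \<Omega> g u \<longleftrightarrow> bounded (range u) \<and> subsol_cond s \<Omega> g (usc_env u)"

definition viscosity_supersolution :: "real \<Rightarrow> 'a::euclidean_space set \<Rightarrow> ('a \<Rightarrow> real) \<Rightarrow> ('a \<Rightarrow> real) \<Rightarrow> bool" where
  "viscosity_supersolution s \<Omega> g u \<longleftrightarrow> bounded (range u) \<and> supersol_cond s \<Omega> g (lsc_env u)"

definition viscosity_solution :: "real \<Rightarrow> 'a::euclidean_space set \<Rightarrow> ('a \<Rightarrow> real) \<Rightarrow> ('a \<Rightarrow> real) \<Rightarrow> bool" where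
  "viscosity_solution s \<Omega> g u \<longleftrightarrow> viscosity_subsolution s \<Omega> g u \<and> viscosity_supersolution s \<Omega> g u"

end

theory Submission
  imports Defs
begin

text \<open>
  Symmetrising in \<open>t\<close> turns the principal value integral \<open>E_{z,\<delta>}\<close> into an absolutely convergent
  integral over \<open>t > 0\<close> of a second difference against \<open>t^{-1-2s}\<close>, to which dominated convergence
  and a one-sided Fatou lemma apply.

  Boundary values: if \<open>L \<ge> 0\<close> is the affine function of the supporting hyperplane at a boundary point
  \<open>x0\<close>, strict convexity makes \<open>L\<close> vanish on the closure of the domain only at \<open>x0\<close>.  Touching a
  subsolution by \<open>A L\<close> (a supersolution by \<open>- A L\<close>) with \<open>A\<close> large gives a contact point close to
  \<open>x0\<close>; second differences of affine functions vanish, so only the jump towards \<open>g\<close> contributes, and it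
  contributes a quantity of size \<open>T^{-2s}\<close> where \<open>T\<close> is the exit distance.  Hence the datum is attained.

  Comparison is doubling of variables: at the maximum of \<open>U x - V y - n |x - y|^2\<close> an almost optimal
  direction for \<open>V\<close> is used for \<open>U\<close>, and in the limit the tails outside the domain give a strictly
  negative integral.  Existence is Perron's method, where a failure of the supersolution property of the
  lower envelope would allow one to push the supremum up by a small bump.
\<close>

section \<open>Integrals against the kernel\<close>

text \<open>The infimum over directions makes the two sides unequal. A subsolution obeys its
  inequality along every direction, so a direction can be inserted at will; a supersolution provides
  one direction only, not of one's choosing, and only up to a tolerance \<eta>. Hence comparison
  takes its direction from the supersolution and needs compactness of the sphere to survive the
  limit, and the two boundary arguments differ: a subsolution is tested along the outward normal,
  whereas for a supersolution only the smallness of the cap cut off by the supporting hyperplane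
  forces one of the two half-lines out of the domain by distance T. This T is fixed before the slope
  A, so that the gain of order T^{-2s} beats the uncontrolled tail beyond a radius r. The extensions
  u^g and u_g are a further obstacle, since they could differ from the function that is touched.
  They disappear after passing to envelopes: every boundary point is a limit of exterior points,
  where u equals g, so the upper envelope is at least g on the boundary and the lower one at most
  g.\<close>

definition kern_integrable :: "real \<Rightarrow> (real \<Rightarrow> real) \<Rightarrow> bool" where
  "kern_integrable s h \<longleftrightarrow> integrable lborel (\<lambda>t. indicator {0<..} t * (h t / t powr (1 + 2 * s)))"

definition kern_integral :: "real \<Rightarrow> (real \<Rightarrow> real) \<Rightarrow> real" where
  "kern_integral s h = (\<integral>t. indicator {0<..} t * (h t / t powr (1 + 2 * s)) \<partial>lborel)"

lemma kern_integrable_add: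
  assumes "kern_integrable s f" "kern_integrable s h"
  shows "kern_integrable s (\<lambda>t. f t + h t)"
    and "kern_integral s (\<lambda>t. f t + h t) = kern_integral s f + kern_integral s h"
  using assms unfolding kern_integrable_def kern_integral_def
  by (simp_all add: add_divide_distrib distrib_left)

lemma kern_integrable_cmult:
  assumes "kern_integrable s f"
  shows "kern_integrable s (\<lambda>t. c * f t)"
    and "kern_integral s (\<lambda>t. c * f t) = c * kern_integral s f"
proof -
  have eq: "(\<lambda>t. indicator {0<..} t * (c * f t / t powr (1 + 2 * s))) =
        (\<lambda>t. c * (indicator {0<..} t * (f t / t powr (1 + 2 * s))))"
    by (auto simp: fun_eq_iff)
  show "kern_integrable s (\<lambda>t. c * f t)"
    and "kern_integral s (\<lambda>t. c * f t) = c * kern_integral s f"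
    using assms unfolding kern_integrable_def kern_integral_def eq
    by (simp_all only: integral_mult_right_zero Bochner_Integration.integrable_mult_right)
qed

lemma kern_integral_mono:
  assumes "kern_integrable s f" "kern_integrable s h" "\<And>t. 0 < t \<Longrightarrow> f t \<le> h t"
  shows "kern_integral s f \<le> kern_integral s h"
  unfolding kern_integral_def
  using assms(1,2) unfolding kern_integrable_def
  by (intro integral_mono) (auto simp: indicator_def intro!: divide_right_mono assms(3))

text \<open>The quadratic decay supplied by a C2 test function leaves t^{1-2s} near the origin, an
  exponent above -1 because s < 1.\<close>

lemma kern_near:
  assumes "0 < s" "s < 1" "0 < \<delta>"
  shows "kern_integrable s (\<lambda>t. if t < \<delta> then t\<^sup>2 else 0)"
    and "kern_integral s (\<lambda>t. if t < \<delta> then t\<^sup>2 else 0) = \<delta> powr (2 - 2 * s) / (2 - 2 * s)"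
proof -
  let ?f = "\<lambda>t. indicator {0<..} t * ((if t < \<delta> then t\<^sup>2 else 0) / t powr (1 + 2 * s))"
  have eq: "t\<^sup>2 / t powr (1 + 2 * s) = t powr (1 - 2 * s)" if "t > 0" for t
  proof -
    have "t\<^sup>2 = t powr 2" using that by simp
    moreover have "t powr 2 / t powr (1 + 2 * s) = t powr (2 - (1 + 2 * s))"
      by (simp only: powr_diff)
    ultimately show ?thesis by simp
  qed
  have "((\<lambda>t. t powr (1 - 2 * s)) has_integral \<delta> powr ((1 - 2 * s) + 1) / ((1 - 2 * s) + 1)) {0..\<delta>}"
    by (rule has_integral_powr_from_0) (use assms in auto)
  then have I: "((\<lambda>t. t powr (1 - 2 * s)) has_integral \<delta> powr (2 - 2 * s) / (2 - 2 * s)) {0..\<delta>}"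
    by (simp add: algebra_simps)
  have "((\<lambda>t. if t \<in> {0..\<delta>} then t powr (1 - 2 * s) else 0) has_integral
            \<delta> powr (2 - 2 * s) / (2 - 2 * s)) UNIV"
    using I by (simp only: has_integral_restrict_UNIV)
  then have "(?f has_integral \<delta> powr (2 - 2 * s) / (2 - 2 * s)) UNIV"
    by (rule has_integral_spike_finite[of "{0,\<delta>}", rotated 2]) (auto simp: eq)
  then have "(\<integral>\<^sup>+t. ennreal (?f t) \<partial>lborel) = ennreal (\<delta> powr (2 - 2 * s) / (2 - 2 * s))"
    by (intro nn_integral_has_integral_lborel) auto
  then have "has_bochner_integral lborel ?f (\<delta> powr (2 - 2 * s) / (2 - 2 * s))"
    using assms by (intro has_bochner_integral_nn_integral) auto
  then show "kern_integrable s (\<lambda>t. if t < \<delta> then t\<^sup>2 else 0)"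
    and "kern_integral s (\<lambda>t. if t < \<delta> then t\<^sup>2 else 0) = \<delta> powr (2 - 2 * s) / (2 - 2 * s)"
    unfolding kern_integrable_def kern_integral_def
    by (auto simp: has_bochner_integral_iff)
qed

text \<open>The tail exponent -1-2s lies below -1 because s > 0. The resulting \<delta>^{-2s} blows
  up as \<delta> tends to 0, which is the source of the gain at the boundary.\<close>

lemma kern_far:
  assumes "0 < s" "0 < \<delta>"
  shows "kern_integrable s (\<lambda>t. if t < \<delta> then 0 else 1)"
    and "kern_integral s (\<lambda>t. if t < \<delta> then 0 else 1) = \<delta> powr (- 2 * s) / (2 * s)"
proof -
  let ?f = "\<lambda>t. indicator {0<..} t * ((if t < \<delta> then 0 else 1) / t powr (1 + 2 * s))"
  have eq: "1 / t powr (1 + 2 * s) = t powr (- 1 - 2 * s)" for t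
    using powr_minus_divide[of t "1 + 2 * s"] by simp
  have "((\<lambda>t. t powr (- 1 - 2 * s)) has_integral - (\<delta> powr ((- 1 - 2 * s) + 1)) / ((- 1 - 2 * s) + 1)) {\<delta>..}"
    by (rule has_integral_powr_to_inf) (use assms in auto)
  then have I: "((\<lambda>t. t powr (- 1 - 2 * s)) has_integral \<delta> powr (- 2 * s) / (2 * s)) {\<delta>..}"
    by (simp add: algebra_simps)
  have "((\<lambda>t. if t \<in> {\<delta>..} then t powr (- 1 - 2 * s) else 0) has_integral \<delta> powr (- 2 * s) / (2 * s)) UNIV"
    using I by (simp only: has_integral_restrict_UNIV)
  also have "(\<lambda>t. if t \<in> {\<delta>..} then t powr (- 1 - 2 * s) else 0) = ?f"
    using assms eq by (auto simp: fun_eq_iff)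
  finally have "(?f has_integral \<delta> powr (- 2 * s) / (2 * s)) UNIV" .
  then have "(\<integral>\<^sup>+t. ennreal (?f t) \<partial>lborel) = ennreal (\<delta> powr (- 2 * s) / (2 * s))"
    by (intro nn_integral_has_integral_lborel) auto
  then have "has_bochner_integral lborel ?f (\<delta> powr (- 2 * s) / (2 * s))"
    using assms by (intro has_bochner_integral_nn_integral) auto
  then show "kern_integrable s (\<lambda>t. if t < \<delta> then 0 else 1)"
    and "kern_integral s (\<lambda>t. if t < \<delta> then 0 else 1) = \<delta> powr (- 2 * s) / (2 * s)"
    unfolding kern_integrable_def kern_integral_def
    by (auto simp: has_bochner_integral_iff)
qed

lemma kern_majorant:
  assumes "0 < s" "s < 1" "0 < \<delta>"
  shows "kern_integrable s (\<lambda>t. if t < \<delta> then C * t\<^sup>2 else D)"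
    and "kern_integral s (\<lambda>t. if t < \<delta> then C * t\<^sup>2 else D) =
           C * (\<delta> powr (2 - 2 * s) / (2 - 2 * s)) + D * (\<delta> powr (- 2 * s) / (2 * s))"
proof -
  have eq: "(\<lambda>t. if t < \<delta> then C * t\<^sup>2 else D) =
     (\<lambda>t. C * (if t < \<delta> then t\<^sup>2 else 0) + D * (if t < \<delta> then 0 else 1))"
    by (auto simp: fun_eq_iff)
  note 1 = kern_integrable_cmult[OF kern_near(1)[OF assms], of C]
   and 2 = kern_integrable_cmult[OF kern_far(1)[OF assms(1,3)], of D]
  show "kern_integrable s (\<lambda>t. if t < \<delta> then C * t\<^sup>2 else D)"
    and "kern_integral s (\<lambda>t. if t < \<delta> then C * t\<^sup>2 else D) =
           C * (\<delta> powr (2 - 2 * s) / (2 - 2 * s)) + D * (\<delta> powr (- 2 * s) / (2 * s))"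
    unfolding eq using kern_integrable_add[OF 1(1) 2(1)] 1(2) 2(2) kern_near(2)[OF assms] kern_far(2)[OF assms(1,3)]
    by simp_all
qed

lemma kern_integrable_bound:
  assumes "0 < s" "s < 1" "0 < \<delta>" and meas: "h \<in> borel_measurable borel"
    and bnd: "\<And>t. 0 < t \<Longrightarrow> \<bar>h t\<bar> \<le> (if t < \<delta> then C * t\<^sup>2 else D)"
  shows "kern_integrable s h"
  unfolding kern_integrable_def
proof (rule Bochner_Integration.integrable_bound)
  show "integrable lborel (\<lambda>t. indicator {0<..} t * ((if t < \<delta> then C * t\<^sup>2 else D) / t powr (1 + 2 * s)))"
    using kern_majorant(1)[OF assms(1-3)] unfolding kern_integrable_def .
  show "(\<lambda>t. indicator {0<..} t * (h t / t powr (1 + 2 * s))) \<in> borel_measurable lborel"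
    using meas by measurable
  show "AE t in lborel. norm (indicator {0<..} t * (h t / t powr (1 + 2 * s)))
      \<le> norm (indicator {0<..} t * ((if t < \<delta> then C * t\<^sup>2 else D) / t powr (1 + 2 * s)))"
  proof (rule AE_I2)
    fix t :: real
    show "norm (indicator {0<..} t * (h t / t powr (1 + 2 * s)))
      \<le> norm (indicator {0<..} t * ((if t < \<delta> then C * t\<^sup>2 else D) / t powr (1 + 2 * s)))"
    proof (cases "t > 0")
      case True
      then have "\<bar>h t\<bar> \<le> \<bar>if t < \<delta> then C * t\<^sup>2 else D\<bar>" using bnd[of t] by linarith
      then show ?thesis using True by (simp add: abs_divide divide_right_mono)
    qed simp
  qed
qed

lemma kern_integral_tendsto:
  assumes s: "0 < s" "s < 1" "0 < \<delta>"
    and meas: "\<And>n. h n \<in> borel_measurable borel" "f \<in> borel_measurable borel"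
    and bnd: "\<And>n t. 0 < t \<Longrightarrow> \<bar>h n t\<bar> \<le> (if t < \<delta> then C * t\<^sup>2 else D)"
    and lim: "\<And>t. 0 < t \<Longrightarrow> (\<lambda>n. h n t) \<longlonglongrightarrow> f t"
  shows "(\<lambda>n. kern_integral s (h n)) \<longlonglongrightarrow> kern_integral s f"
  unfolding kern_integral_def
proof (rule integral_dominated_convergence)
  show "integrable lborel (\<lambda>t. indicator {0<..} t * ((if t < \<delta> then C * t\<^sup>2 else D) / t powr (1 + 2 * s)))"
    using kern_majorant(1)[OF s] unfolding kern_integrable_def .
  show "(\<lambda>t. indicator {0<..} t * (f t / t powr (1 + 2 * s))) \<in> borel_measurable lborel"
    using meas(2) by measurable
  show "(\<lambda>t. indicator {0<..} t * (h n t / t powr (1 + 2 * s))) \<in> borel_measurable lborel" for n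
    using meas(1)[of n] by measurable
  show "AE t in lborel. norm (indicator {0<..} t * (h n t / t powr (1 + 2 * s)))
      \<le> indicator {0<..} t * ((if t < \<delta> then C * t\<^sup>2 else D) / t powr (1 + 2 * s))" for n
  proof (rule AE_I2)
    fix t :: real
    show "norm (indicator {0<..} t * (h n t / t powr (1 + 2 * s)))
      \<le> indicator {0<..} t * ((if t < \<delta> then C * t\<^sup>2 else D) / t powr (1 + 2 * s))"
      using divide_right_mono[OF bnd[of t n], of "t powr (1 + 2 * s)"]
      by (cases "0 < t") simp_all
  qed
  show "AE t in lborel. (\<lambda>n. indicator {0<..} t * (h n t / t powr (1 + 2 * s))) \<longlonglongrightarrow>
          indicator {0<..} t * (f t / t powr (1 + 2 * s))"
  proof (rule AE_I2)
    fix t :: real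
    show "(\<lambda>n. indicator {0<..} t * (h n t / t powr (1 + 2 * s))) \<longlonglongrightarrow>
          indicator {0<..} t * (f t / t powr (1 + 2 * s))"
    proof (cases "0 < t")
      case True
      then show ?thesis using lim[OF True] by (intro tendsto_intros) auto
    qed simp
  qed
qed

text \<open>Replacing \<open>h n\<close> by its maximum with f turns the one-sided eventual bound
  into pointwise convergence to f, so dominated convergence applies; raising the integrand preserves
  the lower bounds \<open>c n\<close>. Semicontinuous functions give exactly such one-sided bounds
  along moving points.\<close>

lemma kern_integral_fatou:
  assumes s: "0 < s" "s < 1" "0 < \<delta>"
    and meas: "\<And>n. h n \<in> borel_measurable borel" "f \<in> borel_measurable borel"
    and bnd: "\<And>n t. 0 < t \<Longrightarrow> \<bar>h n t\<bar> \<le> (if t < \<delta> then C * t\<^sup>2 else D)"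
    and bndf: "\<And>t. 0 < t \<Longrightarrow> \<bar>f t\<bar> \<le> (if t < \<delta> then C * t\<^sup>2 else D)"
    and lim: "\<And>t e. 0 < t \<Longrightarrow> 0 < e \<Longrightarrow> \<forall>\<^sub>F n in sequentially. h n t < f t + e"
    and c: "\<And>n. c n \<le> kern_integral s (h n)" "c \<longlonglongrightarrow> l"
  shows "l \<le> kern_integral s f"
proof -
  define q where "q n t = max (h n t) (f t)" for n t
  have qm: "q n \<in> borel_measurable borel" for n
    unfolding q_def using meas by measurable
  have qb: "\<bar>q n t\<bar> \<le> (if t < \<delta> then C * t\<^sup>2 else D)" if "0 < t" for n t
    using bnd[OF that, of n] bndf[OF that] unfolding q_def by (auto simp: max_def)
  have qi: "kern_integrable s (q n)" for n
    by (rule kern_integrable_bound[OF s qm qb])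
  have hi: "kern_integrable s (h n)" for n
    by (rule kern_integrable_bound[OF s meas(1) bnd])
  have ql: "(\<lambda>n. q n t) \<longlonglongrightarrow> f t" if "0 < t" for t
  proof (rule order_tendstoI)
    fix a assume "a < f t"
    then show "\<forall>\<^sub>F n in sequentially. a < q n t"
      unfolding q_def by (intro always_eventually) auto
  next
    fix a assume a: "f t < a"
    show "\<forall>\<^sub>F n in sequentially. q n t < a"
      using lim[OF that, of "a - f t"] a by (auto elim!: eventually_mono simp: q_def)
  qed
  have "(\<lambda>n. kern_integral s (q n)) \<longlonglongrightarrow> kern_integral s f"
    by (rule kern_integral_tendsto[OF s qm meas(2) qb ql])
  moreover have "c n \<le> kern_integral s (q n)" for n
    by (rule order_trans[OF c(1) kern_integral_mono[OF hi qi]]) (simp add: q_def)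
  ultimately show ?thesis
    using c(2) by (meson LIMSEQ_le)
qed

lemma kern_integral_lower:
  assumes s: "0 < s" "s < 1" and T: "0 < T" "T \<le> r" and "kern_integrable s h"
    and h: "\<And>t. 0 < t \<Longrightarrow> t < T \<Longrightarrow> 0 \<le> h t"
       "\<And>t. T \<le> t \<Longrightarrow> t < r \<Longrightarrow> a \<le> h t" "\<And>t. r \<le> t \<Longrightarrow> - b \<le> h t"
  shows "(a * (T powr (- 2 * s) - r powr (- 2 * s)) - b * r powr (- 2 * s)) / (2 * s) \<le> kern_integral s h"
proof -
  \<comment> \<open>The step function with values 0, a, -b on the three ranges, written with two
    cut-offs: the jump at r from a to -b has size -a-b.\<close>
  let ?k = "\<lambda>t. a * (if t < T then 0 else 1) + (- a - b) * (if t < r then 0 else 1 :: real)"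
  note 1 = kern_integrable_cmult[OF kern_far(1)[OF s(1) T(1)], of a]
  have r: "0 < r" using T by linarith
  note 2 = kern_integrable_cmult[OF kern_far(1)[OF s(1) r], of "- a - b"]
  note 3 = kern_integrable_add[OF 1(1) 2(1)]
  have "kern_integral s ?k = (a * (T powr (- 2 * s) - r powr (- 2 * s)) - b * r powr (- 2 * s)) / (2 * s)"
    using 3(2) 1(2) 2(2) kern_far(2)[OF s(1) T(1)] kern_far(2)[OF s(1) r] s
    by (simp add: field_simps)
  moreover have "kern_integral s ?k \<le> kern_integral s h"
    by (rule kern_integral_mono[OF 3(1) assms(5)]) (use h T in \<open>auto simp: not_less\<close>)
  ultimately show ?thesis by simp
qed

section \<open>Semicontinuity, second differences and the operator\<close>

text \<open>Lower semicontinuity gets no notion of its own: it is expressed throughout as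
  \<open>usc\<close> of the negated function, so that all limit arguments are one-sided from
  above.\<close>

definition usc :: "('a::topological_space \<Rightarrow> real) \<Rightarrow> bool" where
  "usc f \<longleftrightarrow> (\<forall>x. \<forall>e>0. \<forall>\<^sub>F y in nhds x. f y < f x + e)"

lemma uscI: "(\<And>x e. 0 < e \<Longrightarrow> \<forall>\<^sub>F y in nhds x. f y < f x + e) \<Longrightarrow> usc f"
  unfolding usc_def by blast

lemma uscD: "usc f \<Longrightarrow> 0 < e \<Longrightarrow> \<forall>\<^sub>F y in nhds x. f y < f x + e"
  unfolding usc_def by blast

lemma usc_tendsto:
  assumes "usc f" "(h \<longlongrightarrow> x) F" "0 < e"
  shows "\<forall>\<^sub>F n in F. f (h n) < f x + e"
  using eventually_compose_filterlim[OF uscD[OF assms(1,3)] assms(2)] .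

lemma open_less_usc:
  assumes "usc f"
  shows "open {x. f x < a}"
  unfolding open_subopen[of "{x. f x < a}"]
proof (intro ballI, clarsimp)
  fix x assume "f x < a"
  then have "\<forall>\<^sub>F y in nhds x. f y < a"
    using uscD[OF assms, of "a - f x" x] by simp
  then show "\<exists>T. open T \<and> x \<in> T \<and> T \<subseteq> {x. f x < a}"
    unfolding eventually_nhds by blast
qed

lemma borel_measurable_usc: "usc f \<Longrightarrow> f \<in> borel_measurable borel"
  by (rule borel_measurableI_less) (auto intro!: borel_open open_less_usc)

lemma usc_add:
  assumes "usc f" "usc h"
  shows "usc (\<lambda>x. f x + h x)"
proof (rule uscI)
  fix x and e :: real assume "0 < e"
  then show "\<forall>\<^sub>F y in nhds x. f y + h y < f x + h x + e"
    using uscD[OF assms(1), of "e/2" x] uscD[OF assms(2), of "e/2" x]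
    by (auto elim: eventually_elim2)
qed

lemma usc_continuous:
  assumes "\<And>x. isCont f x"
  shows "usc f"
proof (rule uscI)
  fix x and e :: real assume "0 < e"
  then show "\<forall>\<^sub>F y in nhds x. f y < f x + e"
    using order_tendstoD(2)[OF assms[unfolded isCont_def tendsto_at_iff_tendsto_nhds], of x "f x + e"] by simp
qed

lemma usc_compose:
  assumes "usc f" "\<And>x. isCont h x"
  shows "usc (\<lambda>x. f (h x))"
proof (rule uscI)
  fix x and e :: real assume "0 < e"
  then show "\<forall>\<^sub>F y in nhds x. f (h y) < f (h x) + e"
    by (intro usc_tendsto[OF assms(1)])
       (use assms(2) in \<open>auto simp: isCont_def tendsto_at_iff_tendsto_nhds\<close>)
qed

text \<open>Without a maximum point the open sets {f < f y} with y in K would cover K; the largest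
  level of a finite subcover is then not below any level of the subcover, so its own point is left
  uncovered.\<close>

lemma usc_attains_sup:
  assumes "compact K" "K \<noteq> {}" "usc f"
  shows "\<exists>x\<in>K. \<forall>y\<in>K. f y \<le> f x"
proof (rule ccontr)
  assume "\<not> ?thesis"
  then have *: "\<forall>x\<in>K. \<exists>y\<in>K. f x < f y" by (meson not_le)
  then have "K \<subseteq> (\<Union>y\<in>K. {x. f x < f y})" by blast
  then obtain Y where Y: "Y \<subseteq> K" "finite Y" "K \<subseteq> (\<Union>y\<in>Y. {x. f x < f y})"
    using compactE_image[OF assms(1), of K "\<lambda>y. {x. f x < f y}"] open_less_usc[OF assms(3)] by metis
  then have "Y \<noteq> {}" using assms(2) by blast
  then have "Max (f ` Y) \<in> f ` Y" using Y(2) by (intro Max_in) auto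
  then obtain y where y: "y \<in> Y" "f y = Max (f ` Y)" by auto
  then obtain y' where "y' \<in> Y" "f y < f y'" using Y by blast
  moreover have "f y' \<le> Max (f ` Y)" using Y(2) \<open>y' \<in> Y\<close> by simp
  ultimately show False using y by simp
qed

section \<open>Semicontinuous envelopes of bounded functions\<close>

lemma usc_env_ge:
  assumes "\<forall>x. \<bar>u x\<bar> \<le> (B::real)"
  shows "u x \<le> usc_env u x"
proof -
  have bdd: "bdd_above (u ` S)" for S
    using assms by (intro bdd_aboveI2[of _ _ B]) (simp add: abs_le_iff)
  show ?thesis unfolding usc_env_def
    by (rule cINF_greatest) (auto intro!: cSUP_upper bdd)
qed

lemma usc_env_le:
  assumes "\<forall>x. \<bar>u x\<bar> \<le> (B::real)" "0 < r" "\<And>y. y \<in> ball x r \<Longrightarrow> u y \<le> a"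
  shows "usc_env u x \<le> a"
proof -
  have bdd: "bdd_above (u ` S)" for S
    using assms(1) by (intro bdd_aboveI2[of _ _ B]) (simp add: abs_le_iff)
  \<comment> \<open>Each ball contains its centre, so the suprema are bounded below and the real
    infimum over the radii is a genuine greatest lower bound.\<close>
  have "- B \<le> (SUP y\<in>ball x r. u y)" if "r > 0" for r
  proof -
    have "- B \<le> u x" using assms(1) by (auto simp: abs_le_iff minus_le_iff)
    also have "u x \<le> (SUP y\<in>ball x r. u y)" using that by (intro cSUP_upper bdd) auto
    finally show ?thesis .
  qed
  then have "bdd_below ((\<lambda>r. SUP y\<in>ball x r. u y) ` {0<..})"
    by (intro bdd_belowI2[of _ "- B"]) auto
  then have "usc_env u x \<le> (SUP y\<in>ball x r. u y)"
    unfolding usc_env_def using assms(2) by (intro cINF_lower) auto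
  also have "\<dots> \<le> a" using assms(2,3) by (intro cSUP_least) auto
  finally show ?thesis .
qed

lemma usc_env_less:
  assumes "\<forall>x. \<bar>u x\<bar> \<le> (B::real)" "usc_env u x < a"
  shows "\<exists>r>0. \<forall>y\<in>ball x r. u y < a"
proof -
  have bdd: "bdd_above (u ` S)" for S
    using assms(1) by (intro bdd_aboveI2[of _ _ B]) (simp add: abs_le_iff)
  obtain r where r: "r > 0" "(SUP y\<in>ball x r. u y) < a"
    using cInf_lessD[OF _ assms(2)[unfolded usc_env_def]] by auto
  have "u y < a" if "y \<in> ball x r" for y
    using cSUP_upper[OF that bdd] r(2) by linarith
  then show ?thesis using r(1) by blast
qed

lemma abs_usc_env_le:
  assumes "\<forall>x. \<bar>u x\<bar> \<le> (B::real)"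
  shows "\<bar>usc_env u x\<bar> \<le> B"
proof -
  have "usc_env u x \<le> B"
    by (rule usc_env_le[OF assms, of 1]) (use assms in \<open>auto simp: abs_le_iff\<close>)
  moreover have "- B \<le> usc_env u x"
    using usc_env_ge[OF assms, where x = x] spec[OF assms, of x] by linarith
  ultimately show ?thesis by linarith
qed

lemma usc_usc_env:
  assumes "\<forall>x. \<bar>u x\<bar> \<le> (B::real)"
  shows "usc (usc_env u)"
proof (rule uscI)
  fix x and e :: real assume e: "0 < e"
  then obtain r where r: "r > 0" "\<forall>y\<in>ball x r. u y < usc_env u x + e / 2"
    using usc_env_less[OF assms, where x = x and a = "usc_env u x + e / 2"] by auto
  have "usc_env u y < usc_env u x + e" if y: "y \<in> ball x r" for y
  proof -
    obtain r' where "r' > 0" "ball y r' \<subseteq> ball x r"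
      using y open_contains_ball[of "ball x r"] by blast
    then have "usc_env u y \<le> usc_env u x + e / 2"
      using r by (intro usc_env_le[OF assms, of r']) (blast intro: less_imp_le)+
    then show ?thesis using e by linarith
  qed
  then show "\<forall>\<^sub>F y in nhds x. usc_env u y < usc_env u x + e"
    using r(1) by (auto simp: eventually_nhds_metric dist_commute)
qed

text \<open>The real infimum is by definition the negated supremum of the negated set. All facts on
  lower envelopes are read off from upper ones through this identity.\<close>

lemma lsc_env_eq: "lsc_env u x = - usc_env (\<lambda>x. - u x) x"
proof -
  have "(INF y\<in>ball x r. u y) = - (SUP y\<in>ball x r. - u y)" for r
    by (simp add: Inf_real_def image_comp)
  then show ?thesis
    unfolding lsc_env_def usc_env_def by (simp add: Inf_real_def image_comp)
qed

section \<open>Test functions of class C2\<close>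

lemma C2_fun_add_quadratic:
  fixes \<phi> :: "'a::euclidean_space \<Rightarrow> real"
  assumes "C2_fun \<phi>"
  shows "C2_fun (\<lambda>x. \<phi> x + \<gamma> * (norm (x - p))\<^sup>2 + a \<bullet> x + b)"
proof -
  obtain G H where G: "\<And>x. (\<phi> has_derivative (\<lambda>h. G x \<bullet> h)) (at x)"
    and H: "\<And>x. (G has_derivative H x) (at x)"
    and c: "\<And>i j. i \<in> Basis \<Longrightarrow> j \<in> Basis \<Longrightarrow> continuous_on UNIV (\<lambda>x. H x i \<bullet> j)"
    using assms unfolding C2_fun_def by blast
  show ?thesis unfolding C2_fun_def
  proof (intro exI conjI allI ballI)
    fix x
    show "((\<lambda>x. \<phi> x + \<gamma> * (norm (x - p))\<^sup>2 + a \<bullet> x + b) has_derivative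
        (\<lambda>h. (G x + (2 * \<gamma>) *\<^sub>R (x - p) + a) \<bullet> h)) (at x)"
      unfolding power2_norm_eq_inner
      by (auto intro!: derivative_eq_intros G simp: fun_eq_iff algebra_simps inner_commute)
    show "((\<lambda>x. G x + (2 * \<gamma>) *\<^sub>R (x - p) + a) has_derivative (\<lambda>h. H x h + (2 * \<gamma>) *\<^sub>R h)) (at x)"
      by (auto intro!: derivative_eq_intros H)
  next
    fix i j :: 'a assume "i \<in> Basis" "j \<in> Basis"
    then show "continuous_on UNIV (\<lambda>x. (H x i + (2 * \<gamma>) *\<^sub>R i) \<bullet> j)"
      unfolding inner_add_left by (intro continuous_intros c)
  qed
qed

lemma C2_fun_quadratic: "C2_fun (\<lambda>x::'a::euclidean_space. \<gamma> * (norm (x - p))\<^sup>2 + a \<bullet> x + b)"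
proof -
  have "C2_fun (\<lambda>x::'a. 0)"
    unfolding C2_fun_def by (intro exI[of _ "\<lambda>_. 0"] exI[of _ "\<lambda>_ _. 0"]) (auto intro: has_derivative_eq_rhs[OF has_derivative_const] simp: fun_eq_iff)
  from C2_fun_add_quadratic[OF this, of \<gamma> p a b] show ?thesis by simp
qed

lemma isCont_C2_fun: "C2_fun \<phi> \<Longrightarrow> isCont \<phi> x"
  unfolding C2_fun_def using has_derivative_continuous by blast

text \<open>The mean value theorem, applied twice along a line, bounds the first-order remainder by
  the Hessian, which is bounded on a compact ball enlarged by \<delta>. The constant is uniform in
  base point and direction, as dominated convergence with both of them moving requires.\<close>

lemma C2_second_difference_bound:
  fixes \<phi> :: "'a::euclidean_space \<Rightarrow> real"
  assumes "C2_fun \<phi>"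
  obtains C where "0 \<le> C" "\<And>x z t. x \<in> cball x0 R \<Longrightarrow> norm z = 1 \<Longrightarrow> 0 < t \<Longrightarrow> t < \<delta> \<Longrightarrow>
       \<bar>\<phi> (x + t *\<^sub>R z) + \<phi> (x - t *\<^sub>R z) - 2 * \<phi> x\<bar> \<le> C * t\<^sup>2"
proof -
  obtain G H where G: "\<And>x. (\<phi> has_derivative (\<lambda>h. G x \<bullet> h)) (at x)"
    and H: "\<And>x. (G has_derivative H x) (at x)"
    and c: "\<And>i j. i \<in> Basis \<Longrightarrow> j \<in> Basis \<Longrightarrow> continuous_on UNIV (\<lambda>x. H x i \<bullet> j)"
    using assms unfolding C2_fun_def by blast
  \<comment> \<open>The entrywise 1-norm of the Hessian: continuous because the entries are, and an
    upper bound for the quadratic form because the coordinates of a unit vector are at most 1 in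
    absolute value.\<close>
  define N where "N x = (\<Sum>i\<in>Basis. \<Sum>j\<in>Basis. \<bar>H x i \<bullet> j\<bar>)" for x
  have "continuous_on UNIV N"
    unfolding N_def by (intro continuous_intros c) auto
  then have "continuous_on (cball x0 (R + \<delta>)) N"
    using continuous_on_subset by blast
  then have "bounded (N ` cball x0 (R + \<delta>))"
    by (intro compact_imp_bounded compact_continuous_image) auto
  then obtain C where "\<And>x. x \<in> cball x0 (R + \<delta>) \<Longrightarrow> \<bar>N x\<bar> \<le> C"
    unfolding bounded_iff by (metis imageI real_norm_def)
  then have C: "\<And>x. x \<in> cball x0 (R + \<delta>) \<Longrightarrow> N x \<le> C"
    by (simp add: abs_le_iff)
  have HN: "\<bar>H x z \<bullet> z\<bar> \<le> N x" if z: "norm z = 1" for x z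
  proof -
    interpret bounded_linear "H x" using H has_derivative_bounded_linear by blast
    have "H x z = H x (\<Sum>i\<in>Basis. (z \<bullet> i) *\<^sub>R i)" by (simp only: euclidean_representation)
    also have "\<dots> = (\<Sum>i\<in>Basis. (z \<bullet> i) *\<^sub>R H x i)" by (simp only: sum scaleR)
    finally have "H x z \<bullet> z = (\<Sum>i\<in>Basis. (z \<bullet> i) * (H x i \<bullet> z))"
      by (simp add: inner_sum_left)
    also have "\<dots> = (\<Sum>i\<in>Basis. (z \<bullet> i) * (\<Sum>j\<in>Basis. (H x i \<bullet> j) * (z \<bullet> j)))"
      by (intro sum.cong refl arg_cong[where f = "(*) _"]) (rule euclidean_inner)
    finally have "\<bar>H x z \<bullet> z\<bar> = \<bar>\<Sum>i\<in>Basis. \<Sum>j\<in>Basis. (z \<bullet> i) * ((H x i \<bullet> j) * (z \<bullet> j))\<bar>"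
      by (simp add: sum_distrib_left)
    also have "\<dots> \<le> (\<Sum>i\<in>Basis. \<Sum>j\<in>Basis. \<bar>(z \<bullet> i) * ((H x i \<bullet> j) * (z \<bullet> j))\<bar>)"
      by (intro order_trans[OF sum_abs] sum_mono) auto
    also have "\<dots> \<le> N x"
    proof -
      have "\<bar>(z \<bullet> i) * ((H x i \<bullet> j) * (z \<bullet> j))\<bar> \<le> \<bar>H x i \<bullet> j\<bar>" if "i \<in> Basis" "j \<in> Basis" for i j
      proof -
        have "\<bar>z \<bullet> i\<bar> \<le> 1" "\<bar>z \<bullet> j\<bar> \<le> 1" using Basis_le_norm[of _ z] that z by auto
        then have "\<bar>z \<bullet> i\<bar> * \<bar>z \<bullet> j\<bar> \<le> 1" by (simp add: mult_le_one)
        then have "\<bar>H x i \<bullet> j\<bar> * (\<bar>z \<bullet> i\<bar> * \<bar>z \<bullet> j\<bar>) \<le> \<bar>H x i \<bullet> j\<bar> * 1"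
          by (intro mult_left_mono) auto
        then show ?thesis by (simp add: abs_mult algebra_simps)
      qed
      then show ?thesis unfolding N_def by (intro sum_mono)
    qed
    finally show ?thesis .
  qed
  \<comment> \<open>The gradient term is odd in z, so adding this estimate for z and for -z cancels
    it and doubles the constant.\<close>
  have one: "\<bar>\<phi> (x + t *\<^sub>R z) - \<phi> x - t * (G x \<bullet> z)\<bar> \<le> \<bar>C\<bar> * t\<^sup>2"
    if x: "x \<in> cball x0 R" and z: "norm z = 1" and t: "0 < t" "t < \<delta>" for x z t
  proof -
    have "((\<lambda>t. \<phi> (x + t *\<^sub>R z)) has_derivative (\<lambda>h. h * (G (x + \<tau> *\<^sub>R z) \<bullet> z))) (at \<tau>)" for \<tau>
    proof -
      have "((\<lambda>t. x + t *\<^sub>R z) has_derivative (\<lambda>h. h *\<^sub>R z)) (at \<tau>)"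
        by (auto intro!: derivative_eq_intros)
      from has_derivative_compose[OF this G] show ?thesis by simp
    qed
    then have "((\<lambda>t. \<phi> (x + t *\<^sub>R z)) has_real_derivative (G (x + \<tau> *\<^sub>R z) \<bullet> z)) (at \<tau>)" for \<tau>
      unfolding has_field_derivative_def by (simp add: mult_commute_abs)
    from MVT2[of 0 t "\<lambda>t. \<phi> (x + t *\<^sub>R z)" "\<lambda>\<tau>. G (x + \<tau> *\<^sub>R z) \<bullet> z", OF t(1) this]
    obtain \<xi> where \<xi>: "0 < \<xi>" "\<xi> < t" "\<phi> (x + t *\<^sub>R z) - \<phi> x = t * (G (x + \<xi> *\<^sub>R z) \<bullet> z)" by auto
    have "((\<lambda>t. G (x + t *\<^sub>R z) \<bullet> z) has_derivative (\<lambda>h. H (x + \<tau> *\<^sub>R z) (h *\<^sub>R z) \<bullet> z)) (at \<tau>)" for \<tau>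
    proof -
      have "((\<lambda>t. x + t *\<^sub>R z) has_derivative (\<lambda>h. h *\<^sub>R z)) (at \<tau>)"
        by (auto intro!: derivative_eq_intros)
      from has_derivative_inner_left[OF has_derivative_compose[OF this H]] show ?thesis .
    qed
    moreover have "H y (h *\<^sub>R z) = h *\<^sub>R H y z" for y h
      using H has_derivative_bounded_linear[THEN bounded_linear.linear] linear_cmul by blast
    ultimately have "((\<lambda>t. G (x + t *\<^sub>R z) \<bullet> z) has_real_derivative (H (x + \<tau> *\<^sub>R z) z \<bullet> z)) (at \<tau>)" for \<tau>
      unfolding has_field_derivative_def by (simp add: mult_commute_abs)
    from MVT2[of 0 \<xi> "\<lambda>t. G (x + t *\<^sub>R z) \<bullet> z" "\<lambda>\<tau>. H (x + \<tau> *\<^sub>R z) z \<bullet> z", OF \<xi>(1) this]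
    obtain \<zeta> where \<zeta>: "0 < \<zeta>" "\<zeta> < \<xi>" "G (x + \<xi> *\<^sub>R z) \<bullet> z - G x \<bullet> z = \<xi> * (H (x + \<zeta> *\<^sub>R z) z \<bullet> z)" by auto
    have "x + \<zeta> *\<^sub>R z \<in> cball x0 (R + \<delta>)"
    proof -
      have "dist x0 (x + \<zeta> *\<^sub>R z) \<le> dist x0 x + dist x (x + \<zeta> *\<^sub>R z)" by (rule dist_triangle)
      also have "dist x (x + \<zeta> *\<^sub>R z) = \<zeta>" using z \<zeta> by (simp add: dist_norm)
      finally show ?thesis using x \<xi> \<zeta> t by simp
    qed
    from C[OF this] have bd: "\<bar>H (x + \<zeta> *\<^sub>R z) z \<bullet> z\<bar> \<le> \<bar>C\<bar>"
      using HN[OF z, of "x + \<zeta> *\<^sub>R z"] by linarith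
    have "\<phi> (x + t *\<^sub>R z) - \<phi> x - t * (G x \<bullet> z) = t * (G (x + \<xi> *\<^sub>R z) \<bullet> z - G x \<bullet> z)"
      unfolding \<xi>(3) by (simp add: algebra_simps)
    then have "\<bar>\<phi> (x + t *\<^sub>R z) - \<phi> x - t * (G x \<bullet> z)\<bar> = (t * \<xi>) * \<bar>H (x + \<zeta> *\<^sub>R z) z \<bullet> z\<bar>"
      unfolding \<zeta>(3) using t \<xi> by (simp add: abs_mult)
    also have "\<dots> \<le> (t * t) * \<bar>C\<bar>"
      using bd t \<xi> by (intro mult_mono) auto
    finally show ?thesis by (simp add: power2_eq_square mult.commute)
  qed
  show thesis
  proof (rule that[of "2 * \<bar>C\<bar>"])
    fix x z :: 'a and t
    assume x: "x \<in> cball x0 R" "norm z = 1" "0 < t" "t < \<delta>"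
    show "\<bar>\<phi> (x + t *\<^sub>R z) + \<phi> (x - t *\<^sub>R z) - 2 * \<phi> x\<bar> \<le> 2 * \<bar>C\<bar> * t\<^sup>2"
      using one[OF x] one[OF x(1) _ x(3,4), of "- z"] x(2) by simp
  qed simp
qed


section \<open>The folded integrand and the principal value\<close>

definition second_diff ::
  "real \<Rightarrow> ('a::euclidean_space \<Rightarrow> real) \<Rightarrow> ('a \<Rightarrow> real) \<Rightarrow> real \<Rightarrow> 'a \<Rightarrow> 'a \<Rightarrow> real \<Rightarrow> real" where
  "second_diff \<delta> w \<phi> c x z t =
     (if t < \<delta> then \<phi> (x + t *\<^sub>R z) + \<phi> (x - t *\<^sub>R z) - 2 * \<phi> x
      else w (x + t *\<^sub>R z) + w (x - t *\<^sub>R z) - 2 * c)"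

lemma set_integral_symmetric:
  fixes F :: "real \<Rightarrow> real"
  assumes "set_integrable lborel A F" "set_integrable lborel A (\<lambda>t. F (- t))" "A \<subseteq> {0<..}"
  shows "set_lebesgue_integral lborel {t. \<bar>t\<bar> \<in> A} F = set_lebesgue_integral lborel A (\<lambda>t. F t + F (- t))"
proof -
  let ?R = "\<lambda>t. indicator A (- t) *\<^sub>R F t"
  have i1: "integrable lborel (\<lambda>t. indicator A t *\<^sub>R F t)"
    and i2: "integrable lborel (\<lambda>t. indicator A t *\<^sub>R F (- t))"
    using assms(1,2) unfolding set_integrable_def .
  have i3: "integrable lborel ?R"
    using lborel_integrable_real_affine[OF i2, of "-1" 0] by simp
  have e: "(\<integral>t. ?R t \<partial>lborel) = (\<integral>t. indicator A t *\<^sub>R F (- t) \<partial>lborel)"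
    using lborel_integral_real_affine[of "-1" ?R 0] by simp
  have "indicator {t. \<bar>t\<bar> \<in> A} t *\<^sub>R F t = indicator A t *\<^sub>R F t + ?R t" for t
    using assms(3) by (cases "0 \<le> t") (auto simp: indicator_def)
  then have "set_lebesgue_integral lborel {t. \<bar>t\<bar> \<in> A} F =
      (\<integral>t. indicator A t *\<^sub>R F t \<partial>lborel) + (\<integral>t. ?R t \<partial>lborel)"
    unfolding set_lebesgue_integral_def using i1 i3 by simp
  also have "\<dots> = set_lebesgue_integral lborel A (\<lambda>t. F t + F (- t))"
    unfolding set_lebesgue_integral_def e using i1 i2 by (simp add: distrib_left)
  finally show ?thesis .
qed

lemma borel_measurable_on_line:
  fixes w :: "'a::euclidean_space \<Rightarrow> real"
  assumes "w \<in> borel_measurable borel"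
  shows "(\<lambda>t::real. w (x + t *\<^sub>R z)) \<in> borel_measurable borel"
    and "(\<lambda>t::real. w (x - t *\<^sub>R z)) \<in> borel_measurable borel"
  by (rule measurable_compose[OF _ assms], intro borel_measurable_continuous_onI continuous_intros)+

lemma borel_measurable_C2_fun: "C2_fun \<phi> \<Longrightarrow> \<phi> \<in> borel_measurable borel"
  by (intro borel_measurable_continuous_onI continuous_at_imp_continuous_on) (simp add: isCont_C2_fun)

lemma borel_measurable_second_diff:
  assumes "C2_fun \<phi>" "w \<in> borel_measurable borel"
  shows "second_diff \<delta> w \<phi> c x z \<in> borel_measurable borel"
  unfolding second_diff_def
  using borel_measurable_on_line[OF assms(2)] borel_measurable_on_line[OF borel_measurable_C2_fun[OF assms(1)]]
  by measurable

text \<open>One C serves all base points in the ball, unit directions, heights c and functions w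
  with the given bounds, because sequences below vary these data simultaneously. The height is an
  argument separate from w, since Perron's bump is tested at heights other than the value of the
  function in the tail.\<close>

lemma second_diff_bound:
  fixes \<phi> :: "'a::euclidean_space \<Rightarrow> real"
  assumes "C2_fun \<phi>"
  obtains C where "0 \<le> C" "\<And>w c x z t. x \<in> cball x0 R \<Longrightarrow> norm z = 1 \<Longrightarrow> \<bar>c\<bar> \<le> c0 \<Longrightarrow>
       \<forall>x. \<bar>w x\<bar> \<le> B \<Longrightarrow> 0 < t \<Longrightarrow>
       \<bar>second_diff \<delta> w \<phi> c x z t\<bar> \<le> (if t < \<delta> then C * t\<^sup>2 else 2 * B + 2 * c0)"
proof -
  obtain C where C: "0 \<le> C" "\<And>x z t. x \<in> cball x0 R \<Longrightarrow> norm z = 1 \<Longrightarrow> 0 < t \<Longrightarrow> t < \<delta> \<Longrightarrow>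
       \<bar>\<phi> (x + t *\<^sub>R z) + \<phi> (x - t *\<^sub>R z) - 2 * \<phi> x\<bar> \<le> C * t\<^sup>2"
    using C2_second_difference_bound[OF assms(1)] by metis
  show thesis
  proof (rule that[OF C(1)])
    fix x z :: 'a and t c :: real and w :: "'a \<Rightarrow> real"
    assume *: "x \<in> cball x0 R" "norm z = 1" "\<bar>c\<bar> \<le> c0" "\<forall>x. \<bar>w x\<bar> \<le> B" "0 < t"
    have "\<bar>w (x + t *\<^sub>R z) + w (x - t *\<^sub>R z) - 2 * c\<bar> \<le> 2 * B + 2 * c0"
      using spec[OF *(4), of "x + t *\<^sub>R z"] spec[OF *(4), of "x - t *\<^sub>R z"] *(3) by linarith
    then show "\<bar>second_diff \<delta> w \<phi> c x z t\<bar> \<le> (if t < \<delta> then C * t\<^sup>2 else 2 * B + 2 * c0)"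
      using C(2)[OF *(1,2,5)] unfolding second_diff_def by auto
  qed
qed

lemma kern_integrable_second_diff:
  assumes "0 < s" "s < 1" "0 < \<delta>" "C2_fun \<phi>" "w \<in> borel_measurable borel" "\<forall>x. \<bar>w x\<bar> \<le> B" "norm z = 1"
  shows "kern_integrable s (second_diff \<delta> w \<phi> c x z)"
proof -
  obtain C where C: "\<And>t. 0 < t \<Longrightarrow>
       \<bar>second_diff \<delta> w \<phi> c x z t\<bar> \<le> (if t < \<delta> then C * t\<^sup>2 else 2 * B + 2 * \<bar>c\<bar>)"
    using second_diff_bound[OF assms(4), of x 0 "\<bar>c\<bar>" B \<delta>] assms(6,7)
    by (metis centre_in_cball order_refl)
  show ?thesis
    by (rule kern_integrable_bound[OF assms(1-3) borel_measurable_second_diff[OF assms(4,5)] C])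
qed

lemma kern_integral_eq_set_integral:
  assumes "A \<subseteq> {0<..}"
  shows "set_lebesgue_integral lborel A (\<lambda>t. h t / \<bar>t\<bar> powr (1 + 2 * s)) =
           kern_integral s (\<lambda>t. if t \<in> A then h t else 0)"
    and "set_integrable lborel A (\<lambda>t. h t / \<bar>t\<bar> powr (1 + 2 * s)) \<longleftrightarrow>
           kern_integrable s (\<lambda>t. if t \<in> A then h t else 0)"
proof -
  have "(\<lambda>t. indicator A t *\<^sub>R (h t / \<bar>t\<bar> powr (1 + 2 * s))) =
    (\<lambda>t. indicator {0<..} t * ((if t \<in> A then h t else 0) / t powr (1 + 2 * s)))"
    using assms by (auto simp: fun_eq_iff indicator_def)
  then show "set_lebesgue_integral lborel A (\<lambda>t. h t / \<bar>t\<bar> powr (1 + 2 * s)) =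
           kern_integral s (\<lambda>t. if t \<in> A then h t else 0)"
    and "set_integrable lborel A (\<lambda>t. h t / \<bar>t\<bar> powr (1 + 2 * s)) \<longleftrightarrow>
           kern_integrable s (\<lambda>t. if t \<in> A then h t else 0)"
    unfolding set_lebesgue_integral_def set_integrable_def kern_integral_def kern_integrable_def
    by simp_all
qed

text \<open>At distance \<epsilon> from the origin boundedness of f alone makes the two halves
  integrable separately, so the integral splits and the negative half can be reflected. Near the
  origin only the folded integrand is controlled, which is why the principal value is cut off before
  folding.\<close>

lemma kern_symmetric:
  fixes f :: "real \<Rightarrow> real"
  assumes s: "0 < s" "s < 1" and "0 < \<epsilon>" "A \<subseteq> {\<epsilon>..}" "A \<in> sets borel" and f: "f \<in> borel_measurable borel"
    and bnd: "\<And>t. \<bar>t\<bar> \<in> A \<Longrightarrow> \<bar>f t\<bar> \<le> D"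
  shows "set_lebesgue_integral lborel {t. \<bar>t\<bar> \<in> A} (\<lambda>t. f t / \<bar>t\<bar> powr (1 + 2 * s)) =
     kern_integral s (\<lambda>t. if t \<in> A then f t + f (- t) else 0)"
proof -
  have A: "A \<subseteq> {0<..}" using assms(3,4) by auto
  have [measurable]: "A \<in> sets borel" "f \<in> borel_measurable borel" by fact+
  have i: "set_integrable lborel A (\<lambda>t. h t / \<bar>t\<bar> powr (1 + 2 * s))"
    if [measurable]: "h \<in> borel_measurable borel" and h: "\<And>t. t \<in> A \<Longrightarrow> \<bar>h t\<bar> \<le> D" for h
    unfolding kern_integral_eq_set_integral(2)[OF A]
  proof (rule kern_integrable_bound[OF s assms(3), where C = 0 and D = "\<bar>D\<bar>"])
    fix t :: real assume "0 < t"
    show "\<bar>if t \<in> A then h t else 0\<bar> \<le> (if t < \<epsilon> then 0 * t\<^sup>2 else \<bar>D\<bar>)"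
      using h[of t] assms(4) by (cases "t \<in> A") auto
  qed simp
  have ab: "\<bar>t\<bar> = t" "\<bar>- t\<bar> \<in> A" if "t \<in> A" for t using that A by auto
  have 1: "set_integrable lborel A (\<lambda>t. f t / \<bar>t\<bar> powr (1 + 2 * s))"
    using bnd ab by (intro i) auto
  have 2: "set_integrable lborel A (\<lambda>t. f (- t) / \<bar>t\<bar> powr (1 + 2 * s))"
    using bnd ab by (intro i) auto
  show ?thesis
    using set_integral_symmetric[OF 1 _ A] 2 kern_integral_eq_set_integral(1)[OF A, of "\<lambda>t. f t + f (- t)" s]
    by (simp add: add_divide_distrib)
qed

text \<open>For each cut-off \<epsilon> the near integral folds into
  \<open>?near \<epsilon>\<close>; these are dominated by a multiple of t^2, so they converge as
  \<epsilon> tends to 0.\<close>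

lemma E_dir_eq_kern_integral:
  fixes w :: "'a::euclidean_space \<Rightarrow> real"
  assumes s: "0 < s" "s < 1" and \<delta>: "0 < \<delta>" and \<phi>: "C2_fun \<phi>" and w: "w \<in> borel_measurable borel"
    and B: "\<forall>x. \<bar>w x\<bar> \<le> B" and z: "norm z = 1"
  shows "E_dir s \<delta> w \<phi> c x z = kern_integral s (second_diff \<delta> w \<phi> c x z)"
proof -
  note wm [measurable] = borel_measurable_on_line[OF w]
  note pm [measurable] = borel_measurable_on_line[OF borel_measurable_C2_fun[OF \<phi>]]
  obtain C where C: "\<And>t. 0 < t \<Longrightarrow>
       \<bar>second_diff \<delta> w \<phi> c x z t\<bar> \<le> (if t < \<delta> then C * t\<^sup>2 else 2 * B + 2 * \<bar>c\<bar>)"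
    using second_diff_bound[OF \<phi>, of x 0 "\<bar>c\<bar>" B \<delta>] B z by (metis centre_in_cball order_refl)
  let ?near = "\<lambda>\<epsilon> t. if t \<in> {\<epsilon><..<\<delta>} then \<phi> (x + t *\<^sub>R z) + \<phi> (x - t *\<^sub>R z) - 2 * \<phi> x else 0"
  let ?far = "\<lambda>t. if t \<in> {\<delta>..} then w (x + t *\<^sub>R z) + w (x - t *\<^sub>R z) - 2 * c else 0"
  have far: "set_lebesgue_integral lborel {t. \<delta> \<le> \<bar>t\<bar>} (\<lambda>t. (w (x + t *\<^sub>R z) - c) / \<bar>t\<bar> powr (1 + 2 * s)) =
      kern_integral s ?far"
  proof -
    have "\<bar>w (x + t *\<^sub>R z) - c\<bar> \<le> B + \<bar>c\<bar>" for t
      using spec[OF B, of "x + t *\<^sub>R z"] by linarith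
    then show ?thesis
      using kern_symmetric[OF s \<delta>, of "{\<delta>..}" "\<lambda>t. w (x + t *\<^sub>R z) - c" "B + \<bar>c\<bar>"]
      by (simp add: algebra_simps cong: if_cong)
  qed
  have near: "set_lebesgue_integral lborel {t. \<epsilon> < \<bar>t\<bar> \<and> \<bar>t\<bar> < \<delta>}
      (\<lambda>t. (\<phi> (x + t *\<^sub>R z) - \<phi> x) / \<bar>t\<bar> powr (1 + 2 * s)) = kern_integral s (?near \<epsilon>)" if "0 < \<epsilon>" for \<epsilon>
  proof -
    have "continuous_on {- \<delta>..\<delta>} (\<lambda>t. \<phi> (x + t *\<^sub>R z) - \<phi> x)"
      by (intro continuous_at_imp_continuous_on ballI continuous_intros isCont_o2[OF _ isCont_C2_fun[OF \<phi>]])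
    then have "bounded ((\<lambda>t. \<phi> (x + t *\<^sub>R z) - \<phi> x) ` {- \<delta>..\<delta>})"
      by (intro compact_imp_bounded compact_continuous_image) auto
    then obtain D where D: "\<forall>t\<in>{- \<delta>..\<delta>}. \<bar>\<phi> (x + t *\<^sub>R z) - \<phi> x\<bar> \<le> D"
      unfolding bounded_iff by auto
    have "\<bar>\<phi> (x + t *\<^sub>R z) - \<phi> x\<bar> \<le> D" if "\<bar>t\<bar> \<in> {\<epsilon><..<\<delta>}" for t
      using D that by (auto simp: abs_less_iff)
    then show ?thesis
      using kern_symmetric[OF s \<open>0 < \<epsilon>\<close>, of "{\<epsilon><..<\<delta>}" "\<lambda>t. \<phi> (x + t *\<^sub>R z) - \<phi> x" D]
      by (simp add: algebra_simps subset_eq cong: if_cong)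
  qed
  have bnd: "\<bar>?near \<epsilon> t\<bar> \<le> (if t < \<delta> then \<bar>C\<bar> * t\<^sup>2 else 0)" if "0 < t" for \<epsilon> t
  proof (cases "t < \<delta>")
    case True
    have "C * t\<^sup>2 \<le> \<bar>C\<bar> * t\<^sup>2" by (intro mult_right_mono) auto
    then show ?thesis using C[OF that] True unfolding second_diff_def by auto
  qed simp
  have "((\<lambda>\<epsilon>. kern_integral s (?near \<epsilon>)) \<longlongrightarrow> kern_integral s (?near 0)) (at_right 0)"
  proof (rule tendsto_at_right_sequentially[OF \<delta>])
    fix S :: "nat \<Rightarrow> real" assume S: "\<And>n. 0 < S n" "S \<longlonglongrightarrow> 0"
    show "(\<lambda>n. kern_integral s (?near (S n))) \<longlonglongrightarrow> kern_integral s (?near 0)"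
    proof (rule kern_integral_tendsto[OF s \<delta> _ _ bnd])
      fix t :: real assume t: "0 < t"
      have "\<forall>\<^sub>F n in sequentially. S n < t" using order_tendstoD(2)[OF S(2) t] .
      then show "(\<lambda>n. ?near (S n) t) \<longlonglongrightarrow> ?near 0 t"
        by (intro tendsto_eventually, elim eventually_mono) (simp add: t)
    qed auto
  qed
  moreover have "\<forall>\<^sub>F \<epsilon> in at_right 0. kern_integral s (?near \<epsilon>) =
      set_lebesgue_integral lborel {t. \<epsilon> < \<bar>t\<bar> \<and> \<bar>t\<bar> < \<delta>}
      (\<lambda>t. (\<phi> (x + t *\<^sub>R z) - \<phi> x) / \<bar>t\<bar> powr (1 + 2 * s))"
    using eventually_at_right_less[of 0] by eventually_elim (simp only: near)
  ultimately have "((\<lambda>\<epsilon>. set_lebesgue_integral lborel {t. \<epsilon> < \<bar>t\<bar> \<and> \<bar>t\<bar> < \<delta>}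
      (\<lambda>t. (\<phi> (x + t *\<^sub>R z) - \<phi> x) / \<bar>t\<bar> powr (1 + 2 * s))) \<longlongrightarrow> kern_integral s (?near 0)) (at_right 0)"
    using tendsto_cong by fast
  \<comment> \<open>\<open>Lim\<close> is a description operator and carries its meaning only once
    convergence is established, as has just been done.\<close>
  then have "Lim (at_right 0) (\<lambda>\<epsilon>. set_lebesgue_integral lborel {t. \<epsilon> < \<bar>t\<bar> \<and> \<bar>t\<bar> < \<delta>}
      (\<lambda>t. (\<phi> (x + t *\<^sub>R z) - \<phi> x) / \<bar>t\<bar> powr (1 + 2 * s))) = kern_integral s (?near 0)"
    by (intro tendsto_Lim) auto
  moreover have "kern_integrable s (?near 0)"
    by (rule kern_integrable_bound[OF s \<delta> _ bnd]) measurable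
  moreover have "kern_integrable s ?far"
  proof (rule kern_integrable_bound[OF s \<delta>, where C = 0 and D = "2 * B + 2 * \<bar>c\<bar>"])
    fix t :: real assume "0 < t"
    then show "\<bar>?far t\<bar> \<le> (if t < \<delta> then 0 * t\<^sup>2 else 2 * B + 2 * \<bar>c\<bar>)"
      using C[of t] unfolding second_diff_def by auto
  qed measurable
  ultimately have "E_dir s \<delta> w \<phi> c x z = kern_integral s (\<lambda>t. ?near 0 t + ?far t)"
    unfolding E_dir_def far using kern_integrable_add(2) by simp
  also have "\<dots> = kern_integral s (second_diff \<delta> w \<phi> c x z)"
    unfolding kern_integral_def second_diff_def
    by (intro Bochner_Integration.integral_cong refl) (auto simp: indicator_def)
  finally show ?thesis .
qed

section \<open>Comparison principle\<close>

text \<open>The inequality for the operator with the infimum resolved, and with the tail taken from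
  w itself instead of from its extension by g. The link to the extensions and to the boundary
  alternative is \<open>subsol_cond_iff\<close>.\<close>

definition sub_at :: "real \<Rightarrow> ('a::euclidean_space \<Rightarrow> real) \<Rightarrow> 'a \<Rightarrow> bool" where
  "sub_at s w x \<longleftrightarrow> (\<forall>\<delta>>0. \<forall>\<phi>. C2_fun \<phi> \<longrightarrow> (\<forall>y\<in>ball x \<delta>. w y - \<phi> y \<le> w x - \<phi> x) \<longrightarrow>
     (\<forall>z\<in>sphere 0 1. 0 \<le> kern_integral s (second_diff \<delta> w \<phi> (w x) x z)))"

definition super_at :: "real \<Rightarrow> ('a::euclidean_space \<Rightarrow> real) \<Rightarrow> 'a \<Rightarrow> bool" where
  "super_at s v x \<longleftrightarrow> (\<forall>\<delta>>0. \<forall>\<phi>. C2_fun \<phi> \<longrightarrow> (\<forall>y\<in>ball x \<delta>. v y - \<phi> y \<ge> v x - \<phi> x) \<longrightarrow>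
     (\<forall>\<eta>>0. \<exists>z\<in>sphere 0 1. kern_integral s (second_diff \<delta> v \<phi> (v x) x z) < \<eta>))"

lemma sub_atD:
  assumes "sub_at s w x" "0 < \<delta>" "C2_fun \<phi>" "\<And>y. y \<in> ball x \<delta> \<Longrightarrow> w y - \<phi> y \<le> w x - \<phi> x" "norm z = 1"
  shows "0 \<le> kern_integral s (second_diff \<delta> w \<phi> (w x) x z)"
  using assms unfolding sub_at_def by simp

lemma super_atD:
  assumes "super_at s v x" "0 < \<delta>" "C2_fun \<phi>" "\<And>y. y \<in> ball x \<delta> \<Longrightarrow> v x - \<phi> x \<le> v y - \<phi> y" "0 < \<eta>"
  shows "\<exists>z. norm z = 1 \<and> kern_integral s (second_diff \<delta> v \<phi> (v x) x z) < \<eta>"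
proof -
  have "\<exists>z\<in>sphere 0 1. kern_integral s (second_diff \<delta> v \<phi> (v x) x z) < \<eta>"
    using assms unfolding super_at_def by blast
  then show ?thesis by auto
qed

lemma borel_measurable_lsc:
  assumes "usc (\<lambda>x. - v x)"
  shows "v \<in> borel_measurable borel"
  using borel_measurable_uminus[OF borel_measurable_usc[OF assms]] by simp

text \<open>The common majorant of the integrands bounds the directional integrals from below over
  the whole sphere, so the real infimum is genuine and its sign can be read off direction by
  direction.\<close>

lemma E_op_sign:
  fixes w :: "'a::euclidean_space \<Rightarrow> real"
  assumes s: "0 < s" "s < 1" and \<delta>: "0 < \<delta>" and \<phi>: "C2_fun \<phi>" and w: "w \<in> borel_measurable borel"
    and B: "\<forall>x. \<bar>w x\<bar> \<le> B"
  shows "E_op s \<delta> w \<phi> c x \<le> 0 \<longleftrightarrow> (\<forall>z\<in>sphere 0 1. 0 \<le> kern_integral s (second_diff \<delta> w \<phi> c x z))"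
    and "0 \<le> E_op s \<delta> w \<phi> c x \<longleftrightarrow>
      (\<forall>\<eta>>0. \<exists>z\<in>sphere 0 1. kern_integral s (second_diff \<delta> w \<phi> c x z) < \<eta>)"
proof -
  let ?I = "\<lambda>z. kern_integral s (second_diff \<delta> w \<phi> c x z)"
  have eq: "E_op s \<delta> w \<phi> c x = - (INF z\<in>sphere 0 1. ?I z)"
    unfolding E_op_def by (simp add: E_dir_eq_kern_integral[OF s \<delta> \<phi> w B] cong: INF_cong_simp)
  obtain C where C: "\<And>z t. norm z = 1 \<Longrightarrow> 0 < t \<Longrightarrow>
       \<bar>second_diff \<delta> w \<phi> c x z t\<bar> \<le> (if t < \<delta> then C * t\<^sup>2 else 2 * B + 2 * \<bar>c\<bar>)"
    using second_diff_bound[OF \<phi>, of x 0 "\<bar>c\<bar>" B \<delta>] B by (metis centre_in_cball order_refl)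
  let ?m = "\<lambda>t. if t < \<delta> then C * t\<^sup>2 else 2 * B + 2 * \<bar>c\<bar>"
  note m = kern_integrable_cmult[OF kern_majorant(1)[OF s \<delta>, of C "2 * B + 2 * \<bar>c\<bar>"], of "-1"]
  have "kern_integral s (\<lambda>t. - 1 * ?m t) \<le> ?I z" if "z \<in> sphere 0 1" for z
  proof (rule kern_integral_mono[OF m(1)])
    show "kern_integrable s (second_diff \<delta> w \<phi> c x z)"
      using that by (intro kern_integrable_second_diff[OF s \<delta> \<phi> w B]) simp
    show "- 1 * ?m t \<le> second_diff \<delta> w \<phi> c x z t" if "0 < t" for t
      using C[OF _ that, of z] \<open>z \<in> sphere 0 1\<close> by (auto simp: abs_le_iff split: if_splits)
  qed
  then have bdd: "bdd_below (?I ` sphere 0 1)" by (intro bdd_belowI2) auto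
  have ne: "sphere 0 1 \<noteq> ({} :: 'a set)" by simp
  show "E_op s \<delta> w \<phi> c x \<le> 0 \<longleftrightarrow> (\<forall>z\<in>sphere 0 1. 0 \<le> ?I z)"
    unfolding eq using le_cINF_iff[OF ne bdd, of 0] by simp
  have pos: "0 \<le> - m \<longleftrightarrow> (\<forall>\<eta>>0. m < \<eta>)" for m :: real
    by (auto simp: not_le[symmetric])
  show "0 \<le> E_op s \<delta> w \<phi> c x \<longleftrightarrow> (\<forall>\<eta>>0. \<exists>z\<in>sphere 0 1. ?I z < \<eta>)"
    unfolding eq pos cINF_less_iff[OF ne bdd] ..
qed

lemma C2_fun_affine: "C2_fun (\<lambda>y::'a::euclidean_space. A * (\<nu> \<bullet> (p - y)))"
  using C2_fun_quadratic[of 0 0 "- A *\<^sub>R \<nu>" "A * (\<nu> \<bullet> p)"]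
  by (simp add: algebra_simps)

lemma C2_fun_sq_norm: "C2_fun (\<lambda>y::'a::euclidean_space. k * (norm (y - p))\<^sup>2)"
  using C2_fun_quadratic[of k p 0 0] by simp

text \<open>The parallelogram identity. The value involves neither x nor p, so a quadratic penalty
  contributes the same amount at every base point.\<close>

lemma sq_norm_second_difference:
  fixes x :: "'a::euclidean_space"
  assumes "norm z = 1"
  shows "(norm (x + t *\<^sub>R z - p))\<^sup>2 + (norm (x - t *\<^sub>R z - p))\<^sup>2 - 2 * (norm (x - p))\<^sup>2 = 2 * t\<^sup>2"
proof -
  have "z \<bullet> z = 1" using assms by (simp add: dot_square_norm)
  then show ?thesis
    unfolding power2_norm_eq_inner by (simp add: algebra_simps inner_commute power2_eq_square)
qed

lemma ex_small_powr_neg: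
  assumes "0 < s" "0 < (r::real)"
  shows "\<exists>T. 0 < T \<and> T < r \<and> K < T powr (- 2 * s)"
proof -
  \<comment> \<open>The solution of q^{-2s} = \<bar>K\<bar> + 1; shrinking it further to r/2 only
    increases the power.\<close>
  define q where "q = (\<bar>K\<bar> + 1) powr (- 1 / (2 * s))"
  define T where "T = min (r / 2) q"
  have q: "0 < q" unfolding q_def by simp
  have "q powr (- 2 * s) = \<bar>K\<bar> + 1"
    unfolding q_def powr_powr using assms by simp
  moreover have "q powr (- 2 * s) \<le> T powr (- 2 * s)"
    using assms q by (intro powr_mono2') (auto simp: T_def)
  ultimately have "K < T powr (- 2 * s)" by linarith
  then show ?thesis using assms q by (intro exI[of _ T]) (auto simp: T_def)
qed

lemma ex_small_powr:
  assumes "s < 1" "0 < (r::real)" "0 < e"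
  shows "\<exists>T. 0 < T \<and> T < r \<and> K * (T powr (2 - 2 * s) / (2 - 2 * s)) < e"
proof -
  have "((\<lambda>T. K * (T powr (2 - 2 * s) / (2 - 2 * s))) \<longlongrightarrow> K * (0 powr (2 - 2 * s) / (2 - 2 * s))) (at_right 0)"
    using assms by (intro tendsto_intros tendsto_powr2) (auto simp: eventually_at_filter)
  then have "\<forall>\<^sub>F T in at_right 0. K * (T powr (2 - 2 * s) / (2 - 2 * s)) < e"
    using assms by (intro order_tendstoD(2)) auto
  moreover have "\<forall>\<^sub>F T in at_right 0. 0 < T \<and> T < r"
    using assms by (auto simp: eventually_at_right)
  ultimately have "\<forall>\<^sub>F T in at_right 0. 0 < T \<and> T < r \<and> K * (T powr (2 - 2 * s) / (2 - 2 * s)) < e"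
    by eventually_elim auto
  then show ?thesis using eventually_happens'[OF trivial_limit_at_right_real] by blast
qed

text \<open>Three ranges of t are treated differently. Up to \<delta>, chosen for each n, the
  penalty is integrated and made small although its coefficient grows with n. From \<delta> to the
  fixed \<open>\<delta>0\<close> the maximum property of the doubled functional gives the sign.
  Beyond \<open>\<delta>0\<close> boundedness allows passing to the limit.\<close>

lemma comparison:
  fixes U V :: "'a::euclidean_space \<Rightarrow> real"
  assumes s: "0 < s" "s < 1" and \<Omega>: "open \<Omega>" "bounded \<Omega>"
    and U: "usc U" "\<forall>x. \<bar>U x\<bar> \<le> D" and V: "usc (\<lambda>x. - V x)" "\<forall>x. \<bar>V x\<bar> \<le> D"
    and off: "\<And>x. x \<notin> \<Omega> \<Longrightarrow> U x \<le> V x"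
    and sub: "\<And>x. x \<in> \<Omega> \<Longrightarrow> sub_at s U x" and super: "\<And>x. x \<in> \<Omega> \<Longrightarrow> super_at s V x"
  shows "U p \<le> V p"
proof (rule ccontr)
  assume p: "\<not> U p \<le> V p"
  then have p\<Omega>: "p \<in> \<Omega>" using off by blast
  let ?K = "closure \<Omega>"
  have K: "compact ?K" "?K \<noteq> {}" using \<Omega> p\<Omega> by auto
  define W where "W x = U x + - V x" for x
  have Wusc: "usc W" unfolding W_def by (rule usc_add[OF U(1) V(1)])
  obtain q where q: "q \<in> ?K" "\<And>y. y \<in> ?K \<Longrightarrow> W y \<le> W q"
    using usc_attains_sup[OF K Wusc] by blast
  define M where "M = W q"
  have M0: "0 < M" using q(2)[of p] p p\<Omega> closure_subset[of \<Omega>] unfolding M_def W_def by force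
  have Woff: "W y \<le> 0" if "y \<notin> \<Omega>" for y using off[OF that] unfolding W_def by simp
  have WM: "W y \<le> M" for y
    using q(2)[of y] Woff[of y] M0 closure_subset[of \<Omega>] unfolding M_def by force
  note mU = borel_measurable_usc[OF U(1)] and mV = borel_measurable_lsc[OF V(1)]

  have "\<exists>x\<in>?K \<times> ?K. \<forall>y\<in>?K \<times> ?K. U (fst y) + - V (snd y) + - (real n * (norm (fst y - snd y))\<^sup>2)
          \<le> U (fst x) + - V (snd x) + - (real n * (norm (fst x - snd x))\<^sup>2)" for n
  proof (rule usc_attains_sup)
    show "usc (\<lambda>x. U (fst x) + - V (snd x) + - (real n * (norm (fst x - snd x))\<^sup>2))"
      by (intro usc_add usc_compose[OF U(1)] usc_compose[OF V(1)] usc_continuous)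
         (auto intro!: continuous_intros)
  qed (use K compact_Times[OF K(1) K(1)] in auto)
  then obtain P where P: "\<And>n. P n \<in> ?K \<times> ?K" "\<And>n y. y \<in> ?K \<times> ?K \<Longrightarrow>
      U (fst y) + - V (snd y) + - (real n * (norm (fst y - snd y))\<^sup>2)
          \<le> U (fst (P n)) + - V (snd (P n)) + - (real n * (norm (fst (P n) - snd (P n)))\<^sup>2)"
    by metis
  define X Y where "X n = fst (P n)" and "Y n = snd (P n)" for n
  have XY: "X n \<in> ?K" "Y n \<in> ?K" for n using P(1)[of n] unfolding X_def Y_def by auto
  have mx: "U x - V y - real n * (norm (x - y))\<^sup>2 \<le> U (X n) - V (Y n) - real n * (norm (X n - Y n))\<^sup>2"
    if "x \<in> ?K" "y \<in> ?K" for n x y using P(2)[of "(x, y)" n] that unfolding X_def Y_def by simp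
  have low: "M \<le> U (X n) - V (Y n) - real n * (norm (X n - Y n))\<^sup>2" for n
    using mx[OF q(1) q(1), of n] unfolding M_def W_def by simp
  have lowM: "M \<le> U (X n) - V (Y n)" for n
  proof -
    have "0 \<le> real n * (norm (X n - Y n))\<^sup>2" by simp
    then show ?thesis using low[of n] by linarith
  qed
  have "real n * (norm (X n - Y n))\<^sup>2 \<le> 2 * D" for n
    using low[of n] M0 spec[OF U(2), of "X n"] spec[OF V(2), of "Y n"] by linarith
  then have sq: "(norm (X n - Y n))\<^sup>2 \<le> 2 * D * inverse (real n)" if "n > 0" for n
    using that by (simp add: field_simps)
  have "(\<lambda>n. (norm (X n - Y n))\<^sup>2) \<longlonglongrightarrow> 0"
  proof (rule tendsto_sandwich[OF _ _ tendsto_const])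
    show "(\<lambda>n. 2 * D * inverse (real n)) \<longlonglongrightarrow> 0"
      by (rule tendsto_mult_right_zero[OF lim_inverse_n])
    show "\<forall>\<^sub>F n in sequentially. (norm (X n - Y n))\<^sup>2 \<le> 2 * D * inverse (real n)"
      using eventually_gt_at_top[of 0] by eventually_elim (rule sq)
  qed simp
  from tendsto_real_sqrt[OF this] have XYlim: "(\<lambda>n. X n - Y n) \<longlonglongrightarrow> 0"
    by (simp add: tendsto_norm_zero_iff)
  obtain x1 \<rho> where x1: "strict_mono (\<rho> :: nat \<Rightarrow> nat)" "(X \<circ> \<rho>) \<longlonglongrightarrow> x1"
    using K(1) XY(1) unfolding compact_def by metis
  have "(\<lambda>n. (X \<circ> \<rho>) n - (X (\<rho> n) - Y (\<rho> n))) \<longlonglongrightarrow> x1 - 0"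
    using LIMSEQ_subseq_LIMSEQ[OF XYlim x1(1)] by (intro tendsto_diff x1(2)) (simp add: o_def)
  then have y1: "(\<lambda>n. Y (\<rho> n)) \<longlonglongrightarrow> x1" by simp
  have x1': "(\<lambda>n. X (\<rho> n)) \<longlonglongrightarrow> x1" using x1(2) by (simp add: o_def)
  \<comment> \<open>Semicontinuity keeps the positive level M in the limit. As U does not exceed V
    off the domain, the limit point must be interior.\<close>
  have "M \<le> W x1"
  proof (rule field_le_epsilon)
    fix e :: real assume "0 < e"
    then have "\<forall>\<^sub>F n in sequentially. U (X (\<rho> n)) < U x1 + e / 2"
       "\<forall>\<^sub>F n in sequentially. - V (Y (\<rho> n)) < - V x1 + e / 2"
      using usc_tendsto[OF U(1) x1', of "e / 2"] usc_tendsto[OF V(1) y1, of "e / 2"] by auto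
    then have "\<forall>\<^sub>F n in sequentially. M \<le> W x1 + e"
    proof eventually_elim
      case (elim n)
      then show ?case using lowM[of "\<rho> n"] unfolding W_def by linarith
    qed
    then show "M \<le> W x1 + e" by (auto simp: eventually_sequentially)
  qed
  then have "x1 \<in> \<Omega>" using Woff[of x1] M0 by force
  then obtain d where d: "0 < d" "ball x1 d \<subseteq> \<Omega>"
    using \<Omega>(1) open_contains_ball by blast
  define \<delta>0 where "\<delta>0 = d / 2"
  have \<delta>0: "0 < \<delta>0" "ball x1 (2 * \<delta>0) \<subseteq> \<Omega>" using d unfolding \<delta>0_def by auto
  have "\<forall>\<^sub>F n in sequentially. dist (X (\<rho> n)) x1 < \<delta>0 \<and> dist (Y (\<rho> n)) x1 < \<delta>0"
    using tendstoD[OF x1' \<delta>0(1)] tendstoD[OF y1 \<delta>0(1)] by eventually_elim auto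
  then obtain N where N: "\<And>n. n \<ge> N \<Longrightarrow> dist (X (\<rho> n)) x1 < \<delta>0 \<and> dist (Y (\<rho> n)) x1 < \<delta>0"
    unfolding eventually_sequentially by blast
  \<comment> \<open>Initial indices are dropped so that all points, and not just eventually, lie
    within \<open>\<delta>0\<close> of x1; the one-sided limit lemma asks for its bounds at every
    index.\<close>
  define \<xi> \<upsilon> k where "\<xi> n = X (\<rho> (n + N))" and "\<upsilon> n = Y (\<rho> (n + N))" and "k n = real (\<rho> (n + N))" for n
  have \<xi>lim: "\<xi> \<longlonglongrightarrow> x1" and \<upsilon>lim: "\<upsilon> \<longlonglongrightarrow> x1"
    unfolding \<xi>_def \<upsilon>_def using LIMSEQ_ignore_initial_segment[OF x1'] LIMSEQ_ignore_initial_segment[OF y1] by auto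
  have \<xi>d: "dist (\<xi> n) x1 < \<delta>0" "dist (\<upsilon> n) x1 < \<delta>0" for n
    using N[of "n + N"] unfolding \<xi>_def \<upsilon>_def by auto
  have in\<Omega>: "a \<in> \<Omega>" if "dist b x1 < \<delta>0" "dist a b < \<delta>0" for a b
    using that \<delta>0(2) dist_triangle[of a x1 b] by (auto simp: dist_commute)
  have \<xi>\<Omega>: "\<xi> n \<in> \<Omega>" "\<upsilon> n \<in> \<Omega>" for n using in\<Omega>[OF \<xi>d(1)[of n], of "\<xi> n"] in\<Omega>[OF \<xi>d(2)[of n], of "\<upsilon> n"] \<delta>0(1) by auto
  have mx': "U x - V y - k n * (norm (x - y))\<^sup>2 \<le> U (\<xi> n) - V (\<upsilon> n) - k n * (norm (\<xi> n - \<upsilon> n))\<^sup>2"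
    if "x \<in> \<Omega>" "y \<in> \<Omega>" for n x y
    using mx that closure_subset unfolding \<xi>_def \<upsilon>_def k_def by blast
  have lowM': "M \<le> U (\<xi> n) - V (\<upsilon> n)" for n unfolding \<xi>_def \<upsilon>_def by (rule lowM)
  have k0: "0 \<le> k n" for n unfolding k_def by simp

  \<comment> \<open>The difference of the two integrands beyond \<open>\<delta>0\<close>. Below, it
    is replaced by 0, which is an upper bound up to the penalty.\<close>
  define Q where "Q n z t = (if t < \<delta>0 then 0 else U (\<xi> n + t *\<^sub>R z) + U (\<xi> n - t *\<^sub>R z)
      + - V (\<upsilon> n + t *\<^sub>R z) + - V (\<upsilon> n - t *\<^sub>R z) - 2 * (U (\<xi> n) - V (\<upsilon> n)))" for n z t
  have Qm: "Q n z \<in> borel_measurable borel" for n z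
    unfolding Q_def using borel_measurable_on_line[OF mU] borel_measurable_on_line[OF mV] by measurable
  have Qb: "\<bar>Q n z t\<bar> \<le> (if t < \<delta>0 then 0 * t\<^sup>2 else 8 * D)" for n z t
    using spec[OF U(2), of "\<xi> n + t *\<^sub>R z"] spec[OF U(2), of "\<xi> n - t *\<^sub>R z"] spec[OF U(2), of "\<xi> n"]
      spec[OF V(2), of "\<upsilon> n + t *\<^sub>R z"] spec[OF V(2), of "\<upsilon> n - t *\<^sub>R z"] spec[OF V(2), of "\<upsilon> n"]
    unfolding Q_def by auto
  have Qi: "kern_integrable s (Q n z)" for n z
    by (rule kern_integrable_bound[OF s \<delta>0(1) Qm Qb])

  have "\<exists>z. norm z = 1 \<and> - 2 / real (Suc n) \<le> kern_integral s (Q n z)" for n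
  proof -
    \<comment> \<open>Each of the two quadratic test functions contributes 2 k t^2, which together
      give the factor 4 k.\<close>
    obtain \<delta> where \<delta>: "0 < \<delta>" "\<delta> < \<delta>0" "4 * k n * (\<delta> powr (2 - 2 * s) / (2 - 2 * s)) < 1 / real (Suc n)"
      using ex_small_powr[OF s(2) \<delta>0(1), of "1 / real (Suc n)" "4 * k n"] by auto
    define \<phi> \<psi> where "\<phi> x = k n * (norm (x - \<upsilon> n))\<^sup>2" and "\<psi> y = - k n * (norm (y - \<xi> n))\<^sup>2" for x y
    have C2: "C2_fun \<phi>" "C2_fun \<psi>" unfolding \<phi>_def \<psi>_def by (rule C2_fun_sq_norm)+
    have ge: "0 \<le> kern_integral s (second_diff \<delta> U \<phi> (U (\<xi> n)) (\<xi> n) z)" if "norm z = 1" for z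
    proof (rule sub_atD[OF sub[OF \<xi>\<Omega>(1)] \<delta>(1) C2(1) _ that])
      fix y assume "y \<in> ball (\<xi> n) \<delta>"
      then have "y \<in> \<Omega>" using \<delta>(2) by (intro in\<Omega>[OF \<xi>d(1)[of n]]) (auto simp: dist_commute)
      then show "U y - \<phi> y \<le> U (\<xi> n) - \<phi> (\<xi> n)"
        using mx'[OF _ \<xi>\<Omega>(2)[of n], of y n] unfolding \<phi>_def by simp
    qed
    obtain z where z: "norm z = 1" "kern_integral s (second_diff \<delta> V \<psi> (V (\<upsilon> n)) (\<upsilon> n) z) < 1 / real (Suc n)"
    proof (atomize_elim, rule super_atD[OF super[OF \<xi>\<Omega>(2)] \<delta>(1) C2(2)])
      fix y assume "y \<in> ball (\<upsilon> n) \<delta>"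
      then have "y \<in> \<Omega>" using \<delta>(2) by (intro in\<Omega>[OF \<xi>d(2)[of n]]) (auto simp: dist_commute)
      then show "V (\<upsilon> n) - \<psi> (\<upsilon> n) \<le> V y - \<psi> y"
        using mx'[OF \<xi>\<Omega>(1)[of n], of y n] unfolding \<psi>_def by (simp add: norm_minus_commute)
    qed simp
    let ?f = "\<lambda>t. second_diff \<delta> U \<phi> (U (\<xi> n)) (\<xi> n) z t + - 1 * second_diff \<delta> V \<psi> (V (\<upsilon> n)) (\<upsilon> n) z t"
    let ?h = "\<lambda>t. 4 * k n * (if t < \<delta> then t\<^sup>2 else 0) + Q n z t"
    note 1 = kern_integrable_second_diff[OF s \<delta>(1) C2(1) mU U(2) z(1), of "U (\<xi> n)" "\<xi> n"]
    note 2 = kern_integrable_cmult[OF kern_integrable_second_diff[OF s \<delta>(1) C2(2) mV V(2) z(1), of "V (\<upsilon> n)" "\<upsilon> n"], of "-1"]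
    note 3 = kern_integrable_add[OF 1 2(1)]
    note 4 = kern_integrable_cmult[OF kern_near(1)[OF s \<delta>(1)], of "4 * k n"]
    note 5 = kern_integrable_add[OF 4(1) Qi[of n z]]
    have "kern_integral s ?f \<le> kern_integral s ?h"
    proof (rule kern_integral_mono[OF 3(1) 5(1)])
      fix t :: real assume t: "0 < t"
      consider "t < \<delta>" | "\<delta> \<le> t" "t < \<delta>0" | "\<delta>0 \<le> t" by linarith
      then show "?f t \<le> ?h t"
      proof cases
        case 1
        have "?f t = k n * ((norm (\<xi> n + t *\<^sub>R z - \<upsilon> n))\<^sup>2 + (norm (\<xi> n - t *\<^sub>R z - \<upsilon> n))\<^sup>2 - 2 * (norm (\<xi> n - \<upsilon> n))\<^sup>2)
           + k n * ((norm (\<upsilon> n + t *\<^sub>R z - \<xi> n))\<^sup>2 + (norm (\<upsilon> n - t *\<^sub>R z - \<xi> n))\<^sup>2 - 2 * (norm (\<upsilon> n - \<xi> n))\<^sup>2)"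
          using 1 unfolding second_diff_def \<phi>_def \<psi>_def by (simp add: algebra_simps)
        then show ?thesis
          unfolding sq_norm_second_difference[OF z(1)] using 1 \<delta> by (simp add: Q_def)
      next
        case 2
        \<comment> \<open>Shifting both points by the same vector leaves their difference, hence the
          penalty, unchanged.\<close>
        have "U (\<xi> n + \<sigma> *\<^sub>R z) - V (\<upsilon> n + \<sigma> *\<^sub>R z) \<le> U (\<xi> n) - V (\<upsilon> n)" if "\<bar>\<sigma>\<bar> = t" for \<sigma>
        proof -
          have "\<xi> n + \<sigma> *\<^sub>R z \<in> \<Omega>" "\<upsilon> n + \<sigma> *\<^sub>R z \<in> \<Omega>"
            using 2 that z(1) in\<Omega>[OF \<xi>d(1)[of n], of "\<xi> n + \<sigma> *\<^sub>R z"]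
              in\<Omega>[OF \<xi>d(2)[of n], of "\<upsilon> n + \<sigma> *\<^sub>R z"] by (auto simp: dist_norm)
          from mx'[OF this, of n] show ?thesis by simp
        qed
        from this[of t] this[of "- t"] show ?thesis
          using 2 t by (simp add: second_diff_def Q_def)
      next
        case 3
        then show ?thesis using \<delta> by (simp add: second_diff_def Q_def)
      qed
    qed
    moreover have "- 1 / real (Suc n) \<le> kern_integral s ?f"
      using 3(2) 2(2) ge[OF z(1)] z(2) by simp
    moreover have "kern_integral s ?h = 4 * k n * (\<delta> powr (2 - 2 * s) / (2 - 2 * s)) + kern_integral s (Q n z)"
      using 5(2) 4(2) kern_near(2)[OF s \<delta>(1)] by simp
    ultimately have "- 1 / real (Suc n) - 1 / real (Suc n) \<le> kern_integral s (Q n z)"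
      using \<delta>(3) by linarith
    then show ?thesis using z(1) by (intro exI[of _ z]) (simp add: diff_divide_distrib[symmetric])
  qed
  then obtain Z where Z: "\<And>n. norm (Z n) = 1" "\<And>n. - 2 / real (Suc n) \<le> kern_integral s (Q n (Z n))"
    by metis
  then have "\<forall>n. Z n \<in> sphere 0 1" by simp
  then obtain z \<pi> where z: "z \<in> sphere 0 1" "strict_mono (\<pi> :: nat \<Rightarrow> nat)" "(Z \<circ> \<pi>) \<longlonglongrightarrow> z"
    using compact_sphere[of "0 :: 'a" 1] unfolding compact_def by metis
  have zn: "norm z = 1" using z(1) by simp
  have Zlim: "(\<lambda>n. Z (\<pi> n)) \<longlonglongrightarrow> z" using z(3) by (simp add: o_def)
  have \<xi>lim': "(\<lambda>n. \<xi> (\<pi> n)) \<longlonglongrightarrow> x1" and \<upsilon>lim': "(\<lambda>n. \<upsilon> (\<pi> n)) \<longlonglongrightarrow> x1"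
    using LIMSEQ_subseq_LIMSEQ[OF \<xi>lim z(2)] LIMSEQ_subseq_LIMSEQ[OF \<upsilon>lim z(2)] by (auto simp: o_def)
  define f where "f t = (if t < \<delta>0 then 0 else W (x1 + t *\<^sub>R z) + W (x1 - t *\<^sub>R z) - 2 * M)" for t
  have fm: "f \<in> borel_measurable borel"
    unfolding f_def using borel_measurable_on_line[OF borel_measurable_usc[OF Wusc]] by measurable
  have "M \<le> 2 * D" using spec[OF U(2), of q] spec[OF V(2), of q] unfolding M_def W_def by linarith
  then have fb: "\<bar>f t\<bar> \<le> (if t < \<delta>0 then 0 * t\<^sup>2 else 8 * D)" for t
    using spec[OF U(2), of "x1 + t *\<^sub>R z"] spec[OF U(2), of "x1 - t *\<^sub>R z"]
      spec[OF V(2), of "x1 + t *\<^sub>R z"] spec[OF V(2), of "x1 - t *\<^sub>R z"] M0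
    unfolding f_def W_def by auto
  have fi: "kern_integrable s f"
    by (rule kern_integrable_bound[OF s \<delta>0(1) fm fb])
  have "0 \<le> kern_integral s f"
  proof (rule kern_integral_fatou[OF s \<delta>0(1) _ fm _ fb])
    show "Q (\<pi> n) (Z (\<pi> n)) \<in> borel_measurable borel" for n by (rule Qm)
    show "\<bar>Q (\<pi> n) (Z (\<pi> n)) t\<bar> \<le> (if t < \<delta>0 then 0 * t\<^sup>2 else 8 * D)" for n t by (rule Qb)
    show "- 2 / real (Suc (\<pi> n)) \<le> kern_integral s (Q (\<pi> n) (Z (\<pi> n)))" for n by (rule Z(2))
    have "(\<lambda>n. - 2 * (1 / real (Suc n))) \<longlonglongrightarrow> - 2 * 0"
      by (intro tendsto_mult tendsto_const LIMSEQ_Suc[OF lim_1_over_n])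
    from LIMSEQ_subseq_LIMSEQ[OF this z(2)] show "(\<lambda>n. - 2 / real (Suc (\<pi> n))) \<longlonglongrightarrow> 0"
      by (simp add: o_def)
    fix t e :: real assume "0 < t" and e: "0 < e"
    have "\<forall>\<^sub>F n in sequentially. U (\<xi> (\<pi> n) + \<sigma> *\<^sub>R Z (\<pi> n)) < U (x1 + \<sigma> *\<^sub>R z) + e / 4" for \<sigma>
      using e by (intro usc_tendsto[OF U(1)] tendsto_intros \<xi>lim' Zlim) simp
    note 1 = this[of t] this[of "- t"]
    have "\<forall>\<^sub>F n in sequentially. - V (\<upsilon> (\<pi> n) + \<sigma> *\<^sub>R Z (\<pi> n)) < - V (x1 + \<sigma> *\<^sub>R z) + e / 4" for \<sigma>
      using e by (intro usc_tendsto[OF V(1)] tendsto_intros \<upsilon>lim' Zlim) simp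
    note 2 = this[of t] this[of "- t"]
    show "\<forall>\<^sub>F n in sequentially. Q (\<pi> n) (Z (\<pi> n)) t < f t + e"
      using 1 2
    proof eventually_elim
      case (elim n)
      then show ?case using e lowM'[of "\<pi> n"] unfolding Q_def f_def W_def by simp
    qed
  qed
  moreover
  obtain R where R: "0 < R" "\<Omega> \<subseteq> ball x1 R"
    using bounded_subset_ballD[OF \<Omega>(2)] by blast
  \<comment> \<open>Beyond R both points x1 + tz and x1 - tz are outside the domain, where W is at
    most 0, so f is at most -2M; the radius must also exceed \<open>\<delta>0\<close>, below which f
    is cut off to 0.\<close>
  define R' where "R' = max R \<delta>0"
  note m = kern_integrable_cmult[OF fi, of "-1"]
  have "(0 * (\<delta>0 powr (- 2 * s) - R' powr (- 2 * s)) - (- 2 * M) * R' powr (- 2 * s)) / (2 * s)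
       \<le> kern_integral s (\<lambda>t. - 1 * f t)"
  proof (rule kern_integral_lower[OF s \<delta>0(1) _ m(1)])
    have le: "f t \<le> 0" for t using WM[of "x1 + t *\<^sub>R z"] WM[of "x1 - t *\<^sub>R z"] by (simp add: f_def)
    show "0 \<le> - 1 * f t" "0 \<le> - 1 * f t" for t using le by auto
    fix t assume t: "R' \<le> t"
    then have "x1 + t *\<^sub>R z \<notin> ball x1 R" "x1 - t *\<^sub>R z \<notin> ball x1 R"
      using zn R(1) by (auto simp: dist_norm R'_def)
    then have "W (x1 + t *\<^sub>R z) \<le> 0" "W (x1 - t *\<^sub>R z) \<le> 0"
      using Woff R(2) by blast+
    then show "- (- 2 * M) \<le> - 1 * f t" using t by (simp add: f_def R'_def)
  qed (simp add: R'_def)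
  moreover have "0 < 2 * M * R' powr (- 2 * s) / (2 * s)"
    using M0 s R(1) by (simp add: R'_def)
  ultimately show False using m(2) by simp
qed

section \<open>Attainment of the boundary datum\<close>

locale strictly_convex_dirichlet =
  fixes s :: real and \<Omega> :: "'a::euclidean_space set" and g :: "'a \<Rightarrow> real" and B :: real
  assumes s: "0 < s" "s < 1"
    and open_\<Omega>: "open \<Omega>" and bounded_\<Omega>: "bounded \<Omega>"
    and strictly_convex: "strictly_convex_set \<Omega>"
    and continuous_g: "continuous_on (- \<Omega>) g"
    and g_le: "\<And>x. x \<notin> \<Omega> \<Longrightarrow> \<bar>g x\<bar> \<le> B"
    and B_nonneg: "0 \<le> B"
begin

lemma closure_cases: "x \<in> closure \<Omega> \<Longrightarrow> x \<notin> \<Omega> \<Longrightarrow> x \<in> frontier \<Omega>"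
  and frontier_notin: "x \<in> frontier \<Omega> \<Longrightarrow> x \<notin> \<Omega>"
  and frontier_in_closure: "x \<in> frontier \<Omega> \<Longrightarrow> x \<in> closure \<Omega>"
  using open_\<Omega> by (auto simp: frontier_def interior_open)

lemma continuous_g_ball:
  assumes "x \<notin> \<Omega>" "0 < e"
  shows "\<exists>r>0. \<forall>y. y \<notin> \<Omega> \<longrightarrow> dist y x < r \<longrightarrow> \<bar>g y - g x\<bar> < e"
  using continuous_g[unfolded continuous_on_iff dist_real_def] assms by fastforce

text \<open>The midpoint of x0 and another point of the closure is interior, so the supporting
  inequality is strict there and hence at that other point. Compactness then makes the caps near the
  hyperplane shrink to x0.\<close>

lemma supporting_normal:
  assumes x0: "x0 \<in> frontier \<Omega>"
  obtains \<nu> where "norm \<nu> = 1" "\<And>x. x \<in> closure \<Omega> \<Longrightarrow> x \<noteq> x0 \<Longrightarrow> 0 < \<nu> \<bullet> (x0 - x)"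
    "\<And>\<rho>. 0 < \<rho> \<Longrightarrow> \<exists>l>0. \<forall>x\<in>closure \<Omega>. \<nu> \<bullet> (x0 - x) \<le> l \<longrightarrow> dist x x0 < \<rho>"
proof -
  have cvx: "convex \<Omega>" using strictly_convex unfolding strictly_convex_set_def by blast
  have x0c: "x0 \<in> closure \<Omega>" "x0 \<notin> \<Omega>" using x0 frontier_notin frontier_in_closure by blast+
  then have nri: "x0 \<notin> rel_interior \<Omega>" using open_\<Omega> by (simp add: rel_interior_open)
  obtain a where a: "a \<noteq> 0" "\<And>y. y \<in> closure \<Omega> \<Longrightarrow> a \<bullet> x0 \<le> a \<bullet> y"
      "\<And>y. y \<in> rel_interior \<Omega> \<Longrightarrow> a \<bullet> x0 < a \<bullet> y"
    by (rule supporting_hyperplane_relative_frontier[OF cvx x0c(1) nri]) iprover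
  have pos: "a \<bullet> x0 < a \<bullet> y" if y: "y \<in> closure \<Omega>" "y \<noteq> x0" for y
  proof -
    have "midpoint x0 y \<in> open_segment x0 y" using y by simp
    moreover have "open_segment x0 y \<subseteq> \<Omega>"
      using strictly_convex x0c(1) y unfolding strictly_convex_set_def by simp
    ultimately have "midpoint x0 y \<in> \<Omega>" by (rule subsetD[rotated])
    then have "a \<bullet> x0 < a \<bullet> midpoint x0 y" using a(3) open_\<Omega> by (simp add: rel_interior_open)
    then show ?thesis by (simp add: midpoint_def inner_add_right field_simps)
  qed
  define \<nu> where "\<nu> = - (inverse (norm a) *\<^sub>R a)"
  have \<nu>: "\<nu> \<bullet> (x0 - x) = (a \<bullet> x - a \<bullet> x0) / norm a" for x
    unfolding \<nu>_def using a(1) by (simp add: inner_diff_right field_simps)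
  have \<nu>pos: "0 < \<nu> \<bullet> (x0 - x)" if "x \<in> closure \<Omega>" "x \<noteq> x0" for x
    unfolding \<nu> using pos[OF that] a(1) by simp
  show thesis
  proof (rule that[of \<nu>])
    show "norm \<nu> = 1" unfolding \<nu>_def using a(1) by simp
    show "\<exists>l>0. \<forall>x\<in>closure \<Omega>. \<nu> \<bullet> (x0 - x) \<le> l \<longrightarrow> dist x x0 < \<rho>" if "0 < \<rho>" for \<rho>
    proof (cases "closure \<Omega> - ball x0 \<rho> = {}")
      case True
      then show ?thesis by (intro exI[of _ 1]) (auto simp: dist_commute)
    next
      case False
      have "compact (closure \<Omega> - ball x0 \<rho>)"
        using bounded_\<Omega> by (intro compact_diff) auto
      moreover have "continuous_on (closure \<Omega> - ball x0 \<rho>) (\<lambda>x. \<nu> \<bullet> (x0 - x))"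
        by (intro continuous_intros)
      ultimately obtain y where y: "y \<in> closure \<Omega> - ball x0 \<rho>"
        "\<And>x. x \<in> closure \<Omega> - ball x0 \<rho> \<Longrightarrow> \<nu> \<bullet> (x0 - y) \<le> \<nu> \<bullet> (x0 - x)"
        using continuous_attains_inf[OF _ False] by meson
      define m where "m = \<nu> \<bullet> (x0 - y)"
      have "0 < m" unfolding m_def using y(1) that by (intro \<nu>pos) auto
      moreover have "dist x x0 < \<rho>" if "x \<in> closure \<Omega>" "\<nu> \<bullet> (x0 - x) \<le> m / 2" for x
      proof (rule ccontr)
        assume "\<not> dist x x0 < \<rho>"
        then have "m \<le> \<nu> \<bullet> (x0 - x)"
          unfolding m_def using that(1) by (intro y(2)) (auto simp: dist_commute)
        then show False using that(2) \<open>0 < m\<close> by linarith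
      qed
      ultimately show ?thesis by (intro exI[of _ "m / 2"]) auto
    qed
  qed (use \<nu>pos in auto)
qed

text \<open>To be read with \<open>W = U\<close>, \<open>h = g\<close> for a subsolution \<open>U\<close> and with \<open>W = - V\<close>, \<open>h = - g\<close> for a
  supersolution \<open>V\<close>.\<close>

lemma boundary_touching:
  assumes W: "usc W" "\<forall>x. \<bar>W x\<bar> \<le> D" "\<And>x. x \<notin> closure \<Omega> \<Longrightarrow> W x \<le> h x"
    and h: "\<And>x e. x \<notin> \<Omega> \<Longrightarrow> 0 < e \<Longrightarrow> \<exists>r>0. \<forall>y. y \<notin> \<Omega> \<longrightarrow> dist y x < r \<longrightarrow> h y < h x + e"
    and x0: "x0 \<in> frontier \<Omega>" "h x0 < W x0"
  obtains r c \<nu> T A x1 where "0 < T" "T < r" "0 < c" "norm \<nu> = 1"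
    "0 < c / 2 * (T powr (- 2 * s) - r powr (- 2 * s)) - 4 * D * r powr (- 2 * s)"
    "\<And>y. dist y x0 < 2 * r \<Longrightarrow> W y \<le> W x0 + c / 2"
    "\<And>y. dist y x0 < 2 * r \<Longrightarrow> y \<notin> closure \<Omega> \<Longrightarrow> W y \<le> W x0 - c"
    "\<And>x. x \<in> closure \<Omega> \<Longrightarrow> 0 \<le> \<nu> \<bullet> (x0 - x)"
    "0 < A" "x1 \<in> closure \<Omega>" "c / A < T" "dist x1 x0 < T / 2"
    "x1 \<in> frontier \<Omega> \<Longrightarrow> h x1 < W x1" "W x0 \<le> W x1" "A * (\<nu> \<bullet> (x0 - x1)) \<le> c / 2"
    "\<And>y. y \<in> closure \<Omega> \<union> ball x1 (c / A) \<Longrightarrow> W y - A * (\<nu> \<bullet> (x0 - y)) \<le> W x1 - A * (\<nu> \<bullet> (x0 - x1))"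
    "\<And>y. y \<in> closure \<Omega> \<Longrightarrow> A * (\<nu> \<bullet> (x0 - y)) \<le> c / 2 \<Longrightarrow> dist y x0 < T / 2"
proof -
  \<comment> \<open>The gap is 2c. Exterior points near x0 lie c below W x0 and arbitrary nearby
    points at most c/2 above it, so one exterior end of a segment still leaves a net loss of
    c/2.\<close>
  define c where "c = (W x0 - h x0) / 2"
  have c: "0 < c" "h x0 + c = W x0 - c" using x0(2) unfolding c_def by (auto simp: field_simps)
  have x0\<Omega>: "x0 \<notin> \<Omega>" "x0 \<in> closure \<Omega>" using x0(1) frontier_notin frontier_in_closure by blast+
  obtain r1 where r1: "0 < r1" "\<And>y. dist y x0 < r1 \<Longrightarrow> W y < W x0 + c / 2"
    using uscD[OF W(1), of "c / 2" x0] c(1) unfolding eventually_nhds_metric by auto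
  obtain r2 where r2: "0 < r2" "\<And>y. y \<notin> \<Omega> \<Longrightarrow> dist y x0 < r2 \<Longrightarrow> h y < W x0 - c"
    using h[OF x0\<Omega>(1) c(1)] c(2) by auto
  define r where "r = min r1 r2 / 2"
  have r: "0 < r" "2 * r \<le> r1" "2 * r \<le> r2" using r1(1) r2(1) unfolding r_def by auto
  obtain \<nu> where \<nu>: "norm \<nu> = 1" "\<And>x. x \<in> closure \<Omega> \<Longrightarrow> x \<noteq> x0 \<Longrightarrow> 0 < \<nu> \<bullet> (x0 - x)"
    "\<And>\<rho>. 0 < \<rho> \<Longrightarrow> \<exists>l>0. \<forall>x\<in>closure \<Omega>. \<nu> \<bullet> (x0 - x) \<le> l \<longrightarrow> dist x x0 < \<rho>"
    using supporting_normal[OF x0(1)] by blast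
  define L where "L x = \<nu> \<bullet> (x0 - x)" for x
  have L0: "0 \<le> L x" if "x \<in> closure \<Omega>" for x
    using \<nu>(2)[OF that] unfolding L_def by (cases "x = x0") auto
  have Wle: "W y \<le> W x0 + c / 2" if "dist y x0 < 2 * r" for y
    using r1(2)[of y] that r(2) by simp
  have Wout: "W y \<le> W x0 - c" if "dist y x0 < 2 * r" "y \<notin> closure \<Omega>" for y
    using r2(2)[of y] W(3)[OF that(2)] that r(3) closure_subset[of \<Omega>] by force
  \<comment> \<open>Tuned so that the gain c/2 on the range from T to r exceeds the worst tail, of
    size 4D, beyond r.\<close>
  obtain T where T: "0 < T" "T < r" "r powr (- 2 * s) + 8 * D * r powr (- 2 * s) / c < T powr (- 2 * s)"
    using ex_small_powr_neg[OF s(1) r(1)] by blast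
  have "8 * D * r powr (- 2 * s) / c < T powr (- 2 * s) - r powr (- 2 * s)" using T(3) by linarith
  then have "8 * D * r powr (- 2 * s) < c * (T powr (- 2 * s) - r powr (- 2 * s))"
    using c(1) by (simp add: field_simps)
  then have T4: "0 < c / 2 * (T powr (- 2 * s) - r powr (- 2 * s)) - 4 * D * r powr (- 2 * s)" by linarith
  obtain l where l: "0 < l" "\<And>x. x \<in> closure \<Omega> \<Longrightarrow> L x \<le> l \<Longrightarrow> dist x x0 < T / 2"
    using \<nu>(3)[of "T / 2"] T(1) unfolding L_def by auto
  have D0: "0 \<le> D" using spec[OF W(2), of x0] by linarith
  \<comment> \<open>A sum of nonnegative terms, hence at least each of them: c/l and 2D/l confine to
    distance T/2 the points of the closure where the barrier is at most c/2 or 2D, and 2c/T makes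
    the contact radius c/A smaller than T.\<close>
  define A where "A = c / l + 2 * D / l + 2 * c / T"
  have "0 < c / l" "0 \<le> 2 * D / l" "0 < 2 * c / T" using c l T D0 by auto
  then have A: "0 < A" "c / l \<le> A" "2 * D / l \<le> A" "2 * c / T \<le> A" unfolding A_def by linarith+
  have Al: "c \<le> A * l" "2 * D \<le> A * l" using A l(1) by (auto simp: field_simps)
  have AT: "c / A < T"
  proof -
    have "c < 2 * c" using c by simp
    also have "2 * c \<le> A * T" using A(4) T(1) by (simp add: field_simps)
    finally show ?thesis using A(1) by (simp add: field_simps)
  qed
  have small: "dist y x0 < T / 2" if "y \<in> closure \<Omega>" "A * L y \<le> max (c / 2) (2 * D)" for y
  proof (rule l(2)[OF that(1)])
    have "A * L y \<le> A * l" using that(2) Al c(1) by linarith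
    then show "L y \<le> l" using A(1) by simp
  qed
  have cc: "compact (closure \<Omega>)" "closure \<Omega> \<noteq> {}" using bounded_\<Omega> x0\<Omega>(2) by auto
  have "usc (\<lambda>y. W y + - (A * L y))"
    unfolding L_def by (intro usc_add W(1) usc_continuous) (auto intro!: continuous_intros)
  then obtain x1 where x1: "x1 \<in> closure \<Omega>" "\<And>y. y \<in> closure \<Omega> \<Longrightarrow> W y + - (A * L y) \<le> W x1 + - (A * L x1)"
    using usc_attains_sup[OF cc] by blast
  have "L x0 = 0" unfolding L_def by simp
  then have ge: "W x0 \<le> W x1 - A * L x1" using x1(2)[OF x0\<Omega>(2)] by simp
  have AL0: "0 \<le> A * L x1" using L0[OF x1(1)] A(1) by simp
  \<comment> \<open>A bootstrap: the crude bound by boundedness places x1 near x0, where the upper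
    bound on W improves it to c/2.\<close>
  have "A * L x1 \<le> 2 * D" using ge spec[OF W(2), of x0] spec[OF W(2), of x1] by linarith
  then have d1: "dist x1 x0 < T / 2" by (intro small[OF x1(1)]) auto
  then have "W x1 \<le> W x0 + c / 2" using T by (intro Wle) auto
  then have Lx1: "A * L x1 \<le> c / 2" using ge by linarith
  have W1: "W x0 \<le> W x1" using ge AL0 by linarith
  have hx1: "h x1 < W x1" if "x1 \<in> frontier \<Omega>"
    using r2(2)[OF frontier_notin[OF that]] d1 T r c(1) W1 by force
  have mx: "W y - A * L y \<le> W x1 - A * L x1" if "y \<in> closure \<Omega> \<union> ball x1 (c / A)" for y
  proof (cases "y \<in> closure \<Omega>")
    case True then show ?thesis using x1(2)[of y] by simp
  next
    case False
    then have y: "dist y x1 < c / A" using that by (simp add: dist_commute)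
    have "dist y x0 < 2 * r" using dist_triangle[of y x0 x1] y d1 AT T by linarith
    then have "W y \<le> W x0 - c" using Wout False by blast
    \<comment> \<open>L has Lipschitz constant 1, so within c/A the barrier falls by at most c,
      which the drop of W by c outside the closure pays for. Contact thus extends to a full ball
      about x1.\<close>
    moreover have "A * L x1 - A * L y \<le> c"
    proof -
      have "L x1 - L y = \<nu> \<bullet> (y - x1)" unfolding L_def by (simp add: inner_diff_right)
      also have "\<dots> \<le> norm \<nu> * norm (y - x1)" by (rule norm_cauchy_schwarz)
      also have "\<dots> \<le> c / A" using \<nu>(1) y by (simp add: dist_norm)
      finally have "A * (L x1 - L y) \<le> A * (c / A)" using A(1) by (intro mult_left_mono) auto
      then show ?thesis using A(1) by (simp add: right_diff_distrib)
    qed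
    ultimately show ?thesis using ge AL0 by linarith
  qed
  have near: "dist y x0 < T / 2" if "y \<in> closure \<Omega>" "A * L y \<le> c / 2" for y
    using small[OF that(1)] that(2) by simp
  show thesis
    by (rule that[OF T(1,2) c(1) \<nu>(1) T4 Wle Wout L0[unfolded L_def] A(1) x1(1) AT d1 hx1 W1
          Lx1[unfolded L_def] mx[unfolded L_def] near[unfolded L_def]])
qed

text \<open>Along \<nu> the barrier decreases by A t. It is at most c/2 at x1 and nonnegative on the
  closure, so the point x1 + t\<nu> is exterior from t = c/A on, exactly where the test function
  stops being used.\<close>

lemma subsolution_boundary:
  assumes U: "usc U" "\<forall>x. \<bar>U x\<bar> \<le> D" "\<And>x. x \<notin> closure \<Omega> \<Longrightarrow> U x \<le> g x"
    and x0: "x0 \<in> frontier \<Omega>"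
    and sub: "\<And>x. x \<in> closure \<Omega> \<Longrightarrow> (x \<in> frontier \<Omega> \<Longrightarrow> g x < U x) \<Longrightarrow> sub_at s U x"
  shows "U x0 \<le> g x0"
proof (rule ccontr)
  assume "\<not> U x0 \<le> g x0"
  then have gt: "g x0 < U x0" by simp
  have gc: "\<exists>r>0. \<forall>y. y \<notin> \<Omega> \<longrightarrow> dist y x < r \<longrightarrow> g y < g x + e" if x: "x \<notin> \<Omega>" "0 < e" for x e
  proof -
    obtain r where "0 < r" "\<And>y. y \<notin> \<Omega> \<Longrightarrow> dist y x < r \<Longrightarrow> \<bar>g y - g x\<bar> < e"
      using continuous_g_ball[OF x] by blast
    then show ?thesis by (intro exI[of _ r]) (auto simp: abs_less_iff algebra_simps)
  qed
  show False
  proof (rule boundary_touching[OF U gc x0 gt])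
    fix r c \<nu> T A x1
    assume T: "0 < T" "T < r" and c: "0 < c" and \<nu>: "norm \<nu> = 1"
      and T4: "0 < c / 2 * (T powr (- 2 * s) - r powr (- 2 * s)) - 4 * D * r powr (- 2 * s)"
      and le: "\<And>y. dist y x0 < 2 * r \<Longrightarrow> U y \<le> U x0 + c / 2"
      and out: "\<And>y. dist y x0 < 2 * r \<Longrightarrow> y \<notin> closure \<Omega> \<Longrightarrow> U y \<le> U x0 - c"
      and L0: "\<And>x. x \<in> closure \<Omega> \<Longrightarrow> 0 \<le> \<nu> \<bullet> (x0 - x)"
      and A: "0 < A" and x1: "x1 \<in> closure \<Omega>" "c / A < T" "dist x1 x0 < T / 2"
       "x1 \<in> frontier \<Omega> \<Longrightarrow> g x1 < U x1" "U x0 \<le> U x1" "A * (\<nu> \<bullet> (x0 - x1)) \<le> c / 2"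
       "\<And>y. y \<in> closure \<Omega> \<union> ball x1 (c / A) \<Longrightarrow> U y - A * (\<nu> \<bullet> (x0 - y)) \<le> U x1 - A * (\<nu> \<bullet> (x0 - x1))"
    define \<delta> where "\<delta> = c / A"
    have \<delta>: "0 < \<delta>" "\<delta> < T" "A * \<delta> = c" using A c x1(2) unfolding \<delta>_def by auto
    define \<phi> where "\<phi> y = A * (\<nu> \<bullet> (x0 - y))" for y
    have C2: "C2_fun \<phi>" unfolding \<phi>_def by (rule C2_fun_affine)
    have ge: "0 \<le> kern_integral s (second_diff \<delta> U \<phi> (U x1) x1 \<nu>)"
      using x1(7) unfolding \<delta>_def \<phi>_def[symmetric]
      by (intro sub_atD[OF sub[OF x1(1,4)] _ C2 _ \<nu>]) (use \<delta>(1) in \<open>auto simp: \<delta>_def\<close>)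
    note m = kern_integrable_cmult[OF kern_integrable_second_diff[OF s \<delta>(1) C2 borel_measurable_usc[OF U(1)] U(2) \<nu>, of "U x1" x1], of "-1"]
    have "(c / 2 * (\<delta> powr (- 2 * s) - r powr (- 2 * s)) - 4 * D * r powr (- 2 * s)) / (2 * s)
        \<le> kern_integral s (\<lambda>t. - 1 * second_diff \<delta> U \<phi> (U x1) x1 \<nu> t)"
    proof (rule kern_integral_lower[OF s \<delta>(1) _ m(1)])
      fix t assume t: "0 < t" "t < \<delta>"
      then show "0 \<le> - 1 * second_diff \<delta> U \<phi> (U x1) x1 \<nu> t"
        unfolding second_diff_def \<phi>_def by (simp add: algebra_simps)
    next
      fix t assume t: "\<delta> \<le> t" "t < r"
      have "dist (x1 + t *\<^sub>R \<nu>) x0 \<le> dist x1 x0 + norm (t *\<^sub>R \<nu>)" "dist (x1 - t *\<^sub>R \<nu>) x0 \<le> dist x1 x0 + norm (t *\<^sub>R \<nu>)"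
        using norm_triangle_ineq[of "x1 - x0" "t *\<^sub>R \<nu>"] norm_triangle_ineq[of "x1 - x0" "- t *\<^sub>R \<nu>"]
        by (auto simp: dist_norm algebra_simps)
      then have d: "dist (x1 + t *\<^sub>R \<nu>) x0 < 2 * r" "dist (x1 - t *\<^sub>R \<nu>) x0 < 2 * r"
        using \<nu> t x1(3) \<delta>(1) T by auto
      have "\<nu> \<bullet> \<nu> = 1" using \<nu> by (simp add: dot_square_norm)
      then have "A * (\<nu> \<bullet> (x0 - (x1 + t *\<^sub>R \<nu>))) = A * (\<nu> \<bullet> (x0 - x1)) - A * t"
        by (simp add: algebra_simps)
      also have "\<dots> \<le> c / 2 - A * \<delta>" using x1(6) A t(1) mult_left_mono[of \<delta> t A] by linarith
      also have "\<dots> < 0" using \<delta>(3) c by simp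
      finally have "x1 + t *\<^sub>R \<nu> \<notin> closure \<Omega>"
        using L0[of "x1 + t *\<^sub>R \<nu>"] A by (auto simp: mult_less_0_iff)
      then have "U (x1 + t *\<^sub>R \<nu>) \<le> U x0 - c" using out d by blast
      then show "c / 2 \<le> - 1 * second_diff \<delta> U \<phi> (U x1) x1 \<nu> t"
        using le[OF d(2)] x1(5) t unfolding second_diff_def by simp
    next
      fix t assume "r \<le> t"
      then show "- (4 * D) \<le> - 1 * second_diff \<delta> U \<phi> (U x1) x1 \<nu> t"
        using \<delta> T spec[OF U(2), of "x1 + t *\<^sub>R \<nu>"] spec[OF U(2), of "x1 - t *\<^sub>R \<nu>"] spec[OF U(2), of x1]
        unfolding second_diff_def by (simp add: abs_le_iff)
    qed (use \<delta> T in auto)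
    moreover have "0 < (c / 2 * (\<delta> powr (- 2 * s) - r powr (- 2 * s)) - 4 * D * r powr (- 2 * s)) / (2 * s)"
    proof -
      \<comment> \<open>The gain here starts already at \<delta> < T, so the inequality tuned for T
        only improves.\<close>
      have "T powr (- 2 * s) \<le> \<delta> powr (- 2 * s)" using \<delta> s by (intro powr_mono2') auto
      then have "c / 2 * (T powr (- 2 * s) - r powr (- 2 * s)) \<le> c / 2 * (\<delta> powr (- 2 * s) - r powr (- 2 * s))"
        using c by (intro mult_left_mono) auto
      then show ?thesis using T4 s(1) by (intro divide_pos_pos) auto
    qed
    ultimately show False using ge m(2) by simp
  qed
qed

text \<open>The direction is imposed, so a gain is certain only from T on. Between \<delta> and T
  the second difference must merely be nonnegative: with both ends in the closure the maximum
  property gives this, since the affine terms cancel, and with one end outside the exterior drop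
  does.\<close>

lemma supersolution_boundary:
  assumes V: "usc (\<lambda>x. - V x)" "\<forall>x. \<bar>V x\<bar> \<le> D" "\<And>x. x \<notin> closure \<Omega> \<Longrightarrow> g x \<le> V x"
    and x0: "x0 \<in> frontier \<Omega>"
    and super: "\<And>x. x \<in> closure \<Omega> \<Longrightarrow> (x \<in> frontier \<Omega> \<Longrightarrow> V x < g x) \<Longrightarrow> super_at s V x"
  shows "g x0 \<le> V x0"
proof (rule ccontr)
  assume "\<not> g x0 \<le> V x0"
  then have gt: "- g x0 < - V x0" by simp
  have gc: "\<exists>r>0. \<forall>y. y \<notin> \<Omega> \<longrightarrow> dist y x < r \<longrightarrow> - g y < - g x + e" if x: "x \<notin> \<Omega>" "0 < e" for x e
  proof -
    obtain r where "0 < r" "\<And>y. y \<notin> \<Omega> \<Longrightarrow> dist y x < r \<Longrightarrow> \<bar>g y - g x\<bar> < e"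
      using continuous_g_ball[OF x] by blast
    then show ?thesis by (intro exI[of _ r]) (auto simp: abs_less_iff algebra_simps)
  qed
  have V2: "\<forall>x. \<bar>- V x\<bar> \<le> D" and V3: "\<And>x. x \<notin> closure \<Omega> \<Longrightarrow> - V x \<le> - g x" using V by auto
  show False
  proof (rule boundary_touching[OF V(1) V2 V3 gc x0 gt])
    fix r c \<nu> T A x1
    assume T: "0 < T" "T < r" and c: "0 < c"
      and T4: "0 < c / 2 * (T powr (- 2 * s) - r powr (- 2 * s)) - 4 * D * r powr (- 2 * s)"
      and le: "\<And>y. dist y x0 < 2 * r \<Longrightarrow> - V y \<le> - V x0 + c / 2"
      and out: "\<And>y. dist y x0 < 2 * r \<Longrightarrow> y \<notin> closure \<Omega> \<Longrightarrow> - V y \<le> - V x0 - c"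
      and A: "0 < A" and x1: "x1 \<in> closure \<Omega>" "c / A < T" "dist x1 x0 < T / 2"
       "x1 \<in> frontier \<Omega> \<Longrightarrow> - g x1 < - V x1" "- V x0 \<le> - V x1" "A * (\<nu> \<bullet> (x0 - x1)) \<le> c / 2"
      and mx: "\<And>y. y \<in> closure \<Omega> \<union> ball x1 (c / A) \<Longrightarrow> - V y - A * (\<nu> \<bullet> (x0 - y)) \<le> - V x1 - A * (\<nu> \<bullet> (x0 - x1))"
      and small: "\<And>y. y \<in> closure \<Omega> \<Longrightarrow> A * (\<nu> \<bullet> (x0 - y)) \<le> c / 2 \<Longrightarrow> dist y x0 < T / 2"
    have x14: "V x1 < g x1" if "x1 \<in> frontier \<Omega>" using x1(4)[OF that] by simp
    define \<delta> where "\<delta> = c / A"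
    have \<delta>: "0 < \<delta>" "\<delta> < T" using A c x1(2) unfolding \<delta>_def by auto
    define \<phi> where "\<phi> y = - A * (\<nu> \<bullet> (x0 - y))" for y
    have C2: "C2_fun \<phi>" unfolding \<phi>_def by (rule C2_fun_affine)
    \<comment> \<open>Exactly the lower bound derived below for every direction, so the direction
      granted for this tolerance is contradictory.\<close>
    define \<eta> where "\<eta> = (c / 2 * (T powr (- 2 * s) - r powr (- 2 * s)) - 4 * D * r powr (- 2 * s)) / (2 * s)"
    have \<eta>: "0 < \<eta>" unfolding \<eta>_def using T4 s(1) by (intro divide_pos_pos) auto
    have "\<exists>z. norm z = 1 \<and> kern_integral s (second_diff \<delta> V \<phi> (V x1) x1 z) < \<eta>"
    proof (rule super_atD[OF super[OF x1(1) x14] \<delta>(1) C2 _ \<eta>])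
      fix y assume "y \<in> ball x1 \<delta>"
      then show "V x1 - \<phi> x1 \<le> V y - \<phi> y" using mx[of y] unfolding \<phi>_def \<delta>_def by simp
    qed
    then obtain z where z: "norm z = 1" "kern_integral s (second_diff \<delta> V \<phi> (V x1) x1 z) < \<eta>" by blast
    have "\<eta> \<le> kern_integral s (second_diff \<delta> V \<phi> (V x1) x1 z)"
      unfolding \<eta>_def
    proof (rule kern_integral_lower[OF s T(1)])
      show "kern_integrable s (second_diff \<delta> V \<phi> (V x1) x1 z)"
        by (rule kern_integrable_second_diff[OF s \<delta>(1) C2 borel_measurable_lsc[OF V(1)] V(2) z(1)])
      have near: "dist (x1 + \<sigma> *\<^sub>R z) x0 < 2 * r" if "\<bar>\<sigma>\<bar> < r" for \<sigma>
      proof -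
        have "dist (x1 + \<sigma> *\<^sub>R z) x0 \<le> dist x1 x0 + norm (\<sigma> *\<^sub>R z)"
          using norm_triangle_ineq[of "x1 - x0" "\<sigma> *\<^sub>R z"] by (auto simp: dist_norm algebra_simps)
        then show ?thesis using z(1) that x1(3) T by auto
      qed
      have one_out: "c / 2 \<le> V (x1 + t *\<^sub>R z) + V (x1 - t *\<^sub>R z) - 2 * V x1"
        if "0 < t" "t < r" "x1 + t *\<^sub>R z \<notin> closure \<Omega> \<or> x1 - t *\<^sub>R z \<notin> closure \<Omega>" for t
        using near[of t] near[of "- t"] le[of "x1 + t *\<^sub>R z"] le[of "x1 - t *\<^sub>R z"]
          out[of "x1 + t *\<^sub>R z"] out[of "x1 - t *\<^sub>R z"] that x1(5) c by auto
      fix t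
      { assume t: "0 < t" "t < T"
        show "0 \<le> second_diff \<delta> V \<phi> (V x1) x1 z t"
        proof (cases "t < \<delta>")
          case True
          then show ?thesis unfolding second_diff_def \<phi>_def by (simp add: algebra_simps)
        next
          case False
          have "0 \<le> V (x1 + t *\<^sub>R z) + V (x1 - t *\<^sub>R z) - 2 * V x1"
          proof (cases "x1 + t *\<^sub>R z \<in> closure \<Omega> \<and> x1 - t *\<^sub>R z \<in> closure \<Omega>")
            case True
            then show ?thesis using mx[of "x1 + t *\<^sub>R z"] mx[of "x1 - t *\<^sub>R z"]
              by (simp add: algebra_simps)
          next
            case False
            then show ?thesis using one_out[of t] t T c by auto
          qed
          then show ?thesis using False unfolding second_diff_def by simp
        qed }
      { assume t: "T \<le> t" "t < r"
        \<comment> \<open>With the sign chosen so that \<sigma> (\<nu> \<bullet> z) \<ge> 0 the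
          barrier does not rise. A point still in the closure would then belong to the small cap and
          lie within T of x1.\<close>
        have far: "x1 + \<sigma> *\<^sub>R z \<notin> closure \<Omega>" if \<sigma>: "\<bar>\<sigma>\<bar> = t" "0 \<le> \<sigma> * (\<nu> \<bullet> z)" for \<sigma>
        proof
          assume "x1 + \<sigma> *\<^sub>R z \<in> closure \<Omega>"
          moreover have "A * (\<nu> \<bullet> (x0 - (x1 + \<sigma> *\<^sub>R z))) \<le> c / 2"
            using x1(6) mult_nonneg_nonneg[OF less_imp_le[OF A] \<sigma>(2)] by (simp add: algebra_simps)
          ultimately have "dist (x1 + \<sigma> *\<^sub>R z) x0 < T / 2" by (rule small)
          then have "dist (x1 + \<sigma> *\<^sub>R z) x1 < T" using x1(3) dist_triangle2[of "x1 + \<sigma> *\<^sub>R z" x1 x0] by linarith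
          then show False using \<sigma>(1) t(1) z(1) by (simp add: dist_norm)
        qed
        have "x1 + t *\<^sub>R z \<notin> closure \<Omega> \<or> x1 - t *\<^sub>R z \<notin> closure \<Omega>"
          using far[of t] far[of "- t"] t T(1) by (cases "0 \<le> \<nu> \<bullet> z") (auto simp: mult_nonneg_nonneg mult_nonneg_nonpos)
        then have "c / 2 \<le> V (x1 + t *\<^sub>R z) + V (x1 - t *\<^sub>R z) - 2 * V x1"
          using one_out t T by auto
        then show "c / 2 \<le> second_diff \<delta> V \<phi> (V x1) x1 z t"
          using t \<delta> unfolding second_diff_def by simp }
      assume "r \<le> t"
      then show "- (4 * D) \<le> second_diff \<delta> V \<phi> (V x1) x1 z t"
        using \<delta> T spec[OF V(2), of "x1 + t *\<^sub>R z"] spec[OF V(2), of "x1 - t *\<^sub>R z"] spec[OF V(2), of x1]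
        unfolding second_diff_def by (simp add: abs_le_iff)
    qed (use T in auto)
    then show False using z(2) by simp
  qed
qed

end

section \<open>Perron's method\<close>

lemma kern_integral_nonneg:
  assumes "\<And>t. 0 < t \<Longrightarrow> 0 \<le> h t"
  shows "0 \<le> kern_integral s h"
  unfolding kern_integral_def using assms
  by (intro integral_nonneg_AE AE_I2) (auto simp: indicator_def)

lemma tendsto_C2_fun: "C2_fun \<phi> \<Longrightarrow> (h \<longlongrightarrow> x) F \<Longrightarrow> ((\<lambda>n. \<phi> (h n)) \<longlongrightarrow> \<phi> x) F"
  using isCont_tendsto_compose[OF isCont_C2_fun] by blast

lemma tendsto_second_difference:
  assumes "C2_fun \<phi>" "(X \<longlongrightarrow> x) F" "(Z \<longlongrightarrow> z) F"
  shows "((\<lambda>n. \<phi> (X n + t *\<^sub>R Z n) + \<phi> (X n - t *\<^sub>R Z n) - 2 * \<phi> (X n)) \<longlongrightarrow>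
          \<phi> (x + t *\<^sub>R z) + \<phi> (x - t *\<^sub>R z) - 2 * \<phi> x) F"
  by (intro tendsto_intros tendsto_C2_fun[OF assms(1)] assms(2,3))

context strictly_convex_dirichlet
begin

text \<open>Members equal g on the whole complement, boundary included. Perturbations must therefore
  leave the complement untouched, and a limit of members belongs to the class only after the
  boundary argument.\<close>

definition perron_class :: "('a \<Rightarrow> real) set" where
  "perron_class = {w. usc w \<and> (\<forall>x. \<bar>w x\<bar> \<le> B) \<and> (\<forall>x. x \<notin> \<Omega> \<longrightarrow> w x = g x) \<and> (\<forall>x\<in>\<Omega>. sub_at s w x)}"

definition perron :: "'a \<Rightarrow> real" where
  "perron x = (SUP w\<in>perron_class. w x)"

lemma perron_classD:
  assumes "w \<in> perron_class"
  shows "usc w" "\<forall>x. \<bar>w x\<bar> \<le> B" "\<And>x. x \<notin> \<Omega> \<Longrightarrow> w x = g x" "\<And>x. x \<in> \<Omega> \<Longrightarrow> sub_at s w x"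
  using assms unfolding perron_class_def by auto

text \<open>Inside the domain the value -B is a global minimum, so a function touching from above
  has nonnegative second differences, and so has the tail. At the boundary the jump into the domain
  is downwards, which upper semicontinuity permits.\<close>

lemma bottom_in_perron_class: "(\<lambda>x. if x \<in> \<Omega> then - B else g x) \<in> perron_class"
proof -
  define w where "w x = (if x \<in> \<Omega> then - B else g x)" for x
  have low: "- B \<le> w x" for x using g_le[of x] by (auto simp: w_def)
  have "usc w"
  proof (rule uscI)
    fix x and e :: real assume e: "0 < e"
    show "\<forall>\<^sub>F y in nhds x. w y < w x + e"
    proof (cases "x \<in> \<Omega>")
      case True
      show ?thesis
        using eventually_nhds_in_open[OF open_\<Omega> True] by eventually_elim (use e True in \<open>simp add: w_def\<close>)
    next
      case False
      obtain r where r: "0 < r" "\<And>y. y \<notin> \<Omega> \<Longrightarrow> dist y x < r \<Longrightarrow> \<bar>g y - g x\<bar> < e"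
        using continuous_g_ball[OF False e] by blast
      have "w y < w x + e" if "dist y x < r" for y
        using r(2)[OF _ that] low[of x] e False by (cases "y \<in> \<Omega>") (auto simp: w_def)
      then show ?thesis unfolding eventually_nhds_metric using r(1) by blast
    qed
  qed
  moreover have "\<bar>w x\<bar> \<le> B" for x using g_le[of x] B_nonneg by (auto simp: w_def)
  moreover have "sub_at s w x" if x: "x \<in> \<Omega>" for x
    unfolding sub_at_def
  proof (intro allI impI ballI kern_integral_nonneg)
    fix \<delta> t :: real and \<phi> and z :: 'a
    assume *: "0 < \<delta>" "\<forall>y\<in>ball x \<delta>. w y - \<phi> y \<le> w x - \<phi> x" "z \<in> sphere 0 1" "0 < t"
    have wx: "w x = - B" using x by (simp add: w_def)
    have "\<phi> x \<le> \<phi> (x + t *\<^sub>R z)" "\<phi> x \<le> \<phi> (x - t *\<^sub>R z)" if "t < \<delta>"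
      using bspec[OF *(2), of "x + t *\<^sub>R z"] bspec[OF *(2), of "x - t *\<^sub>R z"] *(3,4) that
        low[of "x + t *\<^sub>R z"] low[of "x - t *\<^sub>R z"] wx by (auto simp: dist_norm)
    then show "0 \<le> second_diff \<delta> w \<phi> (w x) x z t"
      using low[of "x + t *\<^sub>R z"] low[of "x - t *\<^sub>R z"] wx unfolding second_diff_def by auto
  qed
  moreover have "w x = g x" if "x \<notin> \<Omega>" for x using that by (simp add: w_def)
  ultimately have "w \<in> perron_class" unfolding perron_class_def by blast
  then show ?thesis by (simp add: w_def[abs_def])
qed

lemma perron_upper:
  assumes "w \<in> perron_class"
  shows "w x \<le> perron x"
  unfolding perron_def
proof (rule cSUP_upper[OF assms])
  show "bdd_above ((\<lambda>w. w x) ` perron_class)"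
    using perron_classD(2) by (intro bdd_aboveI2[of _ _ B]) (auto simp: abs_le_iff)
qed

lemma perron_approx:
  assumes "a < perron x"
  shows "\<exists>w\<in>perron_class. a < w x"
proof (rule ccontr)
  assume "\<not> ?thesis"
  then have "perron x \<le> a"
    unfolding perron_def using bottom_in_perron_class by (intro cSUP_least) (auto simp: not_less)
  then show False using assms by simp
qed

lemma abs_perron_le: "\<forall>x. \<bar>perron x\<bar> \<le> B"
proof
  fix x
  let ?w = "\<lambda>x. if x \<in> \<Omega> then - B else g x"
  have "- B \<le> ?w x" using g_le[of x] by auto
  then have "- B \<le> perron x" using perron_upper[OF bottom_in_perron_class, of x] by linarith
  moreover have "perron x \<le> B"
    unfolding perron_def using bottom_in_perron_class perron_classD(2)
    by (intro cSUP_least) (auto simp: abs_le_iff)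
  ultimately show "\<bar>perron x\<bar> \<le> B" by linarith
qed

lemma perron_off:
  assumes x: "x \<notin> \<Omega>"
  shows "perron x = g x"
proof (rule antisym)
  show "perron x \<le> g x"
    unfolding perron_def
  proof (rule cSUP_least)
    show "w x \<le> g x" if "w \<in> perron_class" for w using perron_classD(3)[OF that x] by simp
  qed (use bottom_in_perron_class in blast)
  show "g x \<le> perron x" using perron_upper[OF bottom_in_perron_class, of x] x by simp
qed

text \<open>A function touching w from above at x also touches the smaller u there, and passing from
  u to w only raises the tail.\<close>

lemma sub_at_mono:
  fixes u w :: "'a \<Rightarrow> real"
  assumes u: "usc u" "\<forall>x. \<bar>u x\<bar> \<le> B" and w: "usc w" "\<forall>x. \<bar>w x\<bar> \<le> B"
    and le: "\<And>y. u y \<le> w y" and eq: "u x = w x" and "sub_at s u x"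
  shows "sub_at s w x"
  unfolding sub_at_def
proof (intro allI impI ballI)
  fix \<delta> \<phi> and z :: 'a
  assume *: "0 < \<delta>" "C2_fun \<phi>" "\<forall>y\<in>ball x \<delta>. w y - \<phi> y \<le> w x - \<phi> x" "z \<in> sphere 0 1"
  then have z: "norm z = 1" by simp
  have "0 \<le> kern_integral s (second_diff \<delta> u \<phi> (u x) x z)"
  proof (rule sub_atD[OF assms(7) *(1,2) _ z])
    fix y assume "y \<in> ball x \<delta>"
    then show "u y - \<phi> y \<le> u x - \<phi> x" using bspec[OF *(3), of y] le[of y] eq by linarith
  qed
  also have "\<dots> \<le> kern_integral s (second_diff \<delta> w \<phi> (w x) x z)"
  proof (rule kern_integral_mono)
    show "second_diff \<delta> u \<phi> (u x) x z t \<le> second_diff \<delta> w \<phi> (w x) x z t" for t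
      using le[of "x + t *\<^sub>R z"] le[of "x - t *\<^sub>R z"] eq unfolding second_diff_def by simp
  qed (rule kern_integrable_second_diff[OF s *(1,2) borel_measurable_usc[OF u(1)] u(2) z]
      kern_integrable_second_diff[OF s *(1,2) borel_measurable_usc[OF w(1)] w(2) z])+
  finally show "0 \<le> kern_integral s (second_diff \<delta> w \<phi> (w x) x z)" .
qed

text \<open>A function equal to g off the domain whose values approach a along points tending to x0
  must eventually be evaluated inside the domain. For interior x0 the radius is chosen to make the
  claim vacuous.\<close>

lemma g_less_near:
  assumes "x0 \<in> closure \<Omega>" "x0 \<in> frontier \<Omega> \<Longrightarrow> g x0 < a"
  shows "\<exists>r>0. \<exists>c>0. \<forall>y. y \<notin> \<Omega> \<longrightarrow> dist y x0 < r \<longrightarrow> g y < a - c"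
proof (cases "x0 \<in> \<Omega>")
  case True
  then obtain r where r: "0 < r" "ball x0 r \<subseteq> \<Omega>" using open_\<Omega> open_contains_ball by blast
  then have "y \<in> \<Omega>" if "dist y x0 < r" for y using that by (auto simp: dist_commute)
  then show ?thesis using r(1) zero_less_one by blast
next
  case False
  then have less: "g x0 < a" using assms closure_cases by blast
  then obtain r where r: "0 < r" "\<And>y. y \<notin> \<Omega> \<Longrightarrow> dist y x0 < r \<Longrightarrow> \<bar>g y - g x0\<bar> < (a - g x0) / 2"
    using continuous_g_ball[OF False, of "(a - g x0) / 2"] by auto
  have "g y < a - (a - g x0) / 2" if "y \<notin> \<Omega>" "dist y x0 < r" for y
    using r(2)[OF that] unfolding abs_less_iff by (simp add: field_simps)
  then show ?thesis using r(1) less by (intro exI[of _ r] conjI exI[of _ "(a - g x0) / 2"]) auto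
qed

lemma g_greater_near:
  assumes "x0 \<in> closure \<Omega>" "x0 \<in> frontier \<Omega> \<Longrightarrow> a < g x0"
  shows "\<exists>r>0. \<exists>c>0. \<forall>y. y \<notin> \<Omega> \<longrightarrow> dist y x0 < r \<longrightarrow> a + c < g y"
proof (cases "x0 \<in> \<Omega>")
  case True
  then obtain r where r: "0 < r" "ball x0 r \<subseteq> \<Omega>" using open_\<Omega> open_contains_ball by blast
  then have "y \<in> \<Omega>" if "dist y x0 < r" for y using that by (auto simp: dist_commute)
  then show ?thesis using r(1) zero_less_one by blast
next
  case False
  then have less: "a < g x0" using assms closure_cases by blast
  then obtain r where r: "0 < r" "\<And>y. y \<notin> \<Omega> \<Longrightarrow> dist y x0 < r \<Longrightarrow> \<bar>g y - g x0\<bar> < (g x0 - a) / 2"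
    using continuous_g_ball[OF False, of "(g x0 - a) / 2"] by auto
  have "a + (g x0 - a) / 2 < g y" if "y \<notin> \<Omega>" "dist y x0 < r" for y
    using r(2)[OF that] unfolding abs_less_iff by (simp add: field_simps)
  then show ?thesis using r(1) less by (intro exI[of _ r] conjI exI[of _ "(g x0 - a) / 2"]) auto
qed

text \<open>Stability of subsolutions under suprema: near-optimal members are maximised against a
  test function made strict by \<gamma> \<bar>y - x0\<bar>^2, their inequalities pass to the limit
  because they lie below U in the tail, and \<gamma> is removed last.\<close>

lemma sub_at_usc_env_perron:
  assumes x0: "x0 \<in> closure \<Omega>" "x0 \<in> frontier \<Omega> \<Longrightarrow> g x0 < usc_env perron x0"
  shows "sub_at s (usc_env perron) x0"
  unfolding sub_at_def
proof (intro allI impI ballI)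
  define U where "U = usc_env perron"
  have U: "usc U" "\<forall>x. \<bar>U x\<bar> \<le> B" "\<And>x. perron x \<le> U x"
    unfolding U_def using usc_usc_env[OF abs_perron_le] abs_usc_env_le[OF abs_perron_le] usc_env_ge[OF abs_perron_le] by auto
  fix \<delta> \<phi> and z :: 'a
  assume \<delta>: "0 < \<delta>" and \<phi>: "C2_fun \<phi>" and "\<forall>y\<in>ball x0 \<delta>. usc_env perron y - \<phi> y \<le> usc_env perron x0 - \<phi> x0"
    and "z \<in> sphere 0 1"
  then have z: "norm z = 1" and "\<forall>y. dist x0 y < \<delta> \<longrightarrow> U y - \<phi> y \<le> U x0 - \<phi> x0"
    by (auto simp: U_def)
  then have touch: "U y - \<phi> y \<le> U x0 - \<phi> x0" if "dist y x0 < \<delta>" for y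
    using that by (simp add: dist_commute)
  \<comment> \<open>Nested radii: a ball of radius \<delta>/2 about a point within \<delta>/4 of x0
    fits into the closed ball of radius 3\<delta>/4, which in turn stays inside the region of
    contact.\<close>
  define \<delta>1 \<rho> where "\<delta>1 = \<delta> / 2" and "\<rho> = 3 * \<delta> / 4"
  have \<delta>1: "0 < \<delta>1" "\<delta>1 < \<delta>" and \<rho>: "0 < \<rho>" "\<rho> < \<delta>" using \<delta> by (auto simp: \<delta>1_def \<rho>_def)
  define K where "K = \<delta>1 powr (2 - 2 * s) / (2 - 2 * s)"
  have K: "0 \<le> K" unfolding K_def using s by simp
  let ?I = "kern_integral s (second_diff \<delta> U \<phi> (U x0) x0 z)"
  note mU = borel_measurable_usc[OF U(1)]
  have main: "- (2 * \<gamma> * K) \<le> ?I" if \<gamma>: "0 < \<gamma>" for \<gamma>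
  proof -
    define \<psi> where "\<psi> y = \<phi> y + \<gamma> * (norm (y - x0))\<^sup>2" for y
    have \<psi>: "C2_fun \<psi>" using C2_fun_add_quadratic[OF \<phi>, of \<gamma> x0 0 0] by (simp add: \<psi>_def[abs_def])
    define \<epsilon> where "\<epsilon> n = 1 / real (Suc n)" for n
    have \<epsilon>0: "0 < \<epsilon> n" for n by (simp add: \<epsilon>_def)
    have \<epsilon>lim: "\<epsilon> \<longlonglongrightarrow> 0" unfolding \<epsilon>_def by (rule LIMSEQ_Suc[OF lim_1_over_n])
    have "\<exists>y w. dist y x0 < min (\<epsilon> n) \<rho> \<and> w \<in> perron_class \<and> U x0 - \<epsilon> n < w y" for n
    proof -
      have "\<exists>y\<in>ball x0 (min (\<epsilon> n) \<rho>). U x0 - \<epsilon> n < perron y"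
      proof (rule ccontr)
        assume "\<not> ?thesis"
        then have "usc_env perron x0 \<le> U x0 - \<epsilon> n"
          using \<epsilon>0[of n] \<rho>(1) by (intro usc_env_le[OF abs_perron_le, of "min (\<epsilon> n) \<rho>"]) (force simp: not_less)+
        then show False using \<epsilon>0[of n] by (simp add: U_def)
      qed
      then show ?thesis using perron_approx by (metis dist_commute mem_ball)
    qed
    then obtain Y W where Y: "\<And>n. dist (Y n) x0 < min (\<epsilon> n) \<rho>" and W: "\<And>n. W n \<in> perron_class"
      and WY: "\<And>n. U x0 - \<epsilon> n < W n (Y n)" by metis
    have WU: "W n x \<le> U x" for n x using perron_upper[OF W] U(3) order_trans by blast
    have "\<exists>x\<in>cball x0 \<rho>. \<forall>y\<in>cball x0 \<rho>. W n y + - \<psi> y \<le> W n x + - \<psi> x" for n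
    proof (rule usc_attains_sup)
      show "usc (\<lambda>y. W n y + - \<psi> y)"
        by (intro usc_add perron_classD(1)[OF W] usc_continuous) (auto intro!: continuous_intros isCont_C2_fun[OF \<psi>])
    qed (use \<rho> in auto)
    then obtain X where X: "\<And>n. X n \<in> cball x0 \<rho>"
      and Xmax: "\<And>n y. y \<in> cball x0 \<rho> \<Longrightarrow> W n y + - \<psi> y \<le> W n (X n) + - \<psi> (X n)"
      by metis
    have Ylim: "Y \<longlonglongrightarrow> x0"
    proof (rule metric_tendsto_imp_tendsto[OF \<epsilon>lim], intro always_eventually allI)
      show "dist (Y n) x0 \<le> dist (\<epsilon> n) 0" for n using Y[of n] \<epsilon>0[of n] by (simp add: dist_real_def)
    qed
    have "\<psi> x0 = \<phi> x0" by (simp add: \<psi>_def)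
    then have \<psi>Y: "(\<lambda>n. \<psi> (Y n)) \<longlonglongrightarrow> \<phi> x0" using tendsto_C2_fun[OF \<psi> Ylim] by simp
    \<comment> \<open>\<open>low\<close> compares the maximum with the near-optimal point
      \<open>Y n\<close>, \<open>up\<close> uses contact of U with \<phi>. Their difference is the
      penalty, which forces \<open>X n\<close> to x0 and pins the values to U x0.\<close>
    have low: "U x0 - \<epsilon> n - \<psi> (Y n) + \<psi> (X n) \<le> W n (X n)" for n
      using Xmax[of "Y n" n] Y[of n] WY[of n] by (simp add: dist_commute)
    have up: "W n (X n) \<le> U x0 + \<phi> (X n) - \<phi> x0" for n
      using touch[of "X n"] X[of n] \<rho>(2) WU[of n "X n"] by (simp add: dist_commute)
    have "\<gamma> * (norm (X n - x0))\<^sup>2 \<le> \<epsilon> n + \<psi> (Y n) - \<phi> x0" for n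
      using low[of n] up[of n] by (simp add: \<psi>_def)
    then have sq: "(norm (X n - x0))\<^sup>2 \<le> (\<epsilon> n + \<psi> (Y n) - \<phi> x0) / \<gamma>" for n
      using \<gamma> by (simp add: field_simps)
    have "(\<lambda>n. (norm (X n - x0))\<^sup>2) \<longlonglongrightarrow> 0"
    proof (rule tendsto_sandwich[OF _ _ tendsto_const])
      have "(\<lambda>n. (\<epsilon> n + \<psi> (Y n) - \<phi> x0) / \<gamma>) \<longlonglongrightarrow> (0 + \<phi> x0 - \<phi> x0) / \<gamma>"
        by (intro tendsto_intros \<epsilon>lim \<psi>Y) (use \<gamma> in simp)
      then show "(\<lambda>n. (\<epsilon> n + \<psi> (Y n) - \<phi> x0) / \<gamma>) \<longlonglongrightarrow> 0" by simp
    qed (use sq in auto)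
    from tendsto_real_sqrt[OF this] have "(\<lambda>n. X n - x0) \<longlonglongrightarrow> 0"
      by (simp add: tendsto_norm_zero_iff)
    then have Xlim: "X \<longlonglongrightarrow> x0" by (rule LIM_zero_cancel)
    have WX: "(\<lambda>n. W n (X n)) \<longlonglongrightarrow> U x0"
    proof (rule tendsto_sandwich)
      have "(\<lambda>n. U x0 - \<epsilon> n - \<psi> (Y n) + \<psi> (X n)) \<longlonglongrightarrow> U x0 - 0 - \<phi> x0 + \<psi> x0"
        by (intro tendsto_intros \<epsilon>lim \<psi>Y tendsto_C2_fun[OF \<psi> Xlim])
      then show "(\<lambda>n. U x0 - \<epsilon> n - \<psi> (Y n) + \<psi> (X n)) \<longlonglongrightarrow> U x0" by (simp add: \<psi>_def)
      have "(\<lambda>n. U x0 + \<phi> (X n) - \<phi> x0) \<longlonglongrightarrow> U x0 + \<phi> x0 - \<phi> x0"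
        by (intro tendsto_intros tendsto_C2_fun[OF \<phi> Xlim])
      then show "(\<lambda>n. U x0 + \<phi> (X n) - \<phi> x0) \<longlonglongrightarrow> U x0" by simp
    qed (use low up in auto)
    \<comment> \<open>Members equal g off the domain and g stays below U x0 - c near x0; since the
      values at \<open>X n\<close> tend to U x0, these points are eventually interior, where the
      subsolution inequality is available.\<close>
    obtain r c where r: "0 < r" "0 < c" "\<And>y. y \<notin> \<Omega> \<Longrightarrow> dist y x0 < r \<Longrightarrow> g y < U x0 - c"
      using g_less_near[OF x0] unfolding U_def by blast
    have "\<forall>\<^sub>F n in sequentially. X n \<in> \<Omega> \<and> dist (X n) x0 < \<delta> / 4"
    proof -
      have "\<forall>\<^sub>F n in sequentially. U x0 - c < W n (X n)" using order_tendstoD(1)[OF WX, of "U x0 - c"] r(2) by simp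
      moreover have "\<forall>\<^sub>F n in sequentially. dist (X n) x0 < min r (\<delta> / 4)"
        using tendstoD[OF Xlim, of "min r (\<delta> / 4)"] r(1) \<delta> by simp
      ultimately show ?thesis
      proof eventually_elim
        case (elim n)
        then show ?case using r(3)[of "X n"] perron_classD(3)[OF W, of "X n" n] by force
      qed
    qed
    then obtain N where N: "\<And>n. n \<ge> N \<Longrightarrow> X n \<in> \<Omega> \<and> dist (X n) x0 < \<delta> / 4"
      unfolding eventually_sequentially by blast
    define X' W' where "X' n = X (n + N)" and "W' n = W (n + N)" for n
    have X'lim: "X' \<longlonglongrightarrow> x0" unfolding X'_def by (rule LIMSEQ_ignore_initial_segment[OF Xlim])
    have WX': "(\<lambda>n. W' n (X' n)) \<longlonglongrightarrow> U x0" unfolding X'_def W'_def by (rule LIMSEQ_ignore_initial_segment[OF WX])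
    have W': "W' n \<in> perron_class" for n unfolding W'_def by (rule W)
    have X': "X' n \<in> \<Omega>" "dist (X' n) x0 < \<delta> / 4" for n using N[of "n + N"] by (auto simp: X'_def)
    have pos: "0 \<le> kern_integral s (second_diff \<delta>1 (W' n) \<psi> (W' n (X' n)) (X' n) z)" for n
    proof (rule sub_atD[OF perron_classD(4)[OF W' X'(1)] \<delta>1(1) \<psi> _ z])
      fix y assume "y \<in> ball (X' n) \<delta>1"
      then have "y \<in> cball x0 \<rho>"
        using dist_triangle[of x0 y "X' n"] X'(2)[of n] by (simp add: dist_commute \<delta>1_def \<rho>_def)
      then show "W' n y - \<psi> y \<le> W' n (X' n) - \<psi> (X' n)"
        using Xmax[of y "n + N"] by (simp add: W'_def X'_def)
    qed
    obtain C where C: "\<And>w c x t. x \<in> cball x0 \<delta> \<Longrightarrow> \<bar>c\<bar> \<le> B \<Longrightarrow> \<forall>x. \<bar>w x\<bar> \<le> B \<Longrightarrow> 0 < t \<Longrightarrow>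
       \<bar>second_diff \<delta>1 w \<psi> c x z t\<bar> \<le> (if t < \<delta>1 then C * t\<^sup>2 else 2 * B + 2 * B)"
      using second_diff_bound[OF \<psi>, of x0 \<delta> B B \<delta>1] z by metis
    have "0 \<le> kern_integral s (second_diff \<delta>1 U \<psi> (U x0) x0 z)"
    proof (rule kern_integral_fatou[OF s \<delta>1(1)])
      show "second_diff \<delta>1 (W' n) \<psi> (W' n (X' n)) (X' n) z \<in> borel_measurable borel" for n
        by (intro borel_measurable_second_diff[OF \<psi>] borel_measurable_usc perron_classD(1)[OF W'])
      show "second_diff \<delta>1 U \<psi> (U x0) x0 z \<in> borel_measurable borel"
        by (rule borel_measurable_second_diff[OF \<psi> mU])
      show "\<bar>second_diff \<delta>1 (W' n) \<psi> (W' n (X' n)) (X' n) z t\<bar> \<le> (if t < \<delta>1 then C * t\<^sup>2 else 2 * B + 2 * B)"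
        if "0 < t" for n t
        using perron_classD(2)[OF W', of n] X'(2)[of n] \<delta> that
        by (intro C) (auto simp: dist_commute)
      show "\<bar>second_diff \<delta>1 U \<psi> (U x0) x0 z t\<bar> \<le> (if t < \<delta>1 then C * t\<^sup>2 else 2 * B + 2 * B)" if "0 < t" for t
        using U(2) \<delta> that by (intro C) auto
      show "0 \<le> kern_integral s (second_diff \<delta>1 (W' n) \<psi> (W' n (X' n)) (X' n) z)" for n by (rule pos)
      fix t e :: real assume t: "0 < t" and e: "0 < e"
      show "\<forall>\<^sub>F n in sequentially. second_diff \<delta>1 (W' n) \<psi> (W' n (X' n)) (X' n) z t
          < second_diff \<delta>1 U \<psi> (U x0) x0 z t + e"
      proof (cases "t < \<delta>1")
        case True
        then show ?thesis
          using order_tendstoD(2)[OF tendsto_second_difference[OF \<psi> X'lim tendsto_const, of t z]] e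
          unfolding second_diff_def by simp
      next
        case False
        have "\<forall>\<^sub>F n in sequentially. U (X' n + \<sigma> *\<^sub>R z) < U (x0 + \<sigma> *\<^sub>R z) + e / 4" for \<sigma>
          using e by (intro usc_tendsto[OF U(1)] tendsto_intros X'lim) simp
        note 1 = this[of t] this[of "- t"]
        have 2: "\<forall>\<^sub>F n in sequentially. U x0 - e / 4 < W' n (X' n)"
          using order_tendstoD(1)[OF WX', of "U x0 - e / 4"] e by simp
        show ?thesis using 1 2
        proof eventually_elim
          case (elim n)
          then show ?case
            using False WU[of "n + N" "X' n + t *\<^sub>R z"] WU[of "n + N" "X' n - t *\<^sub>R z"]
            unfolding second_diff_def by (simp add: W'_def)
        qed
      qed
    qed (rule tendsto_const)
    moreover
    note i1 = kern_integrable_second_diff[OF s \<delta>1(1) \<psi> mU U(2) z, of "U x0" x0]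
    note i2 = kern_integrable_second_diff[OF s \<delta> \<phi> mU U(2) z, of "U x0" x0]
    note i3 = kern_integrable_cmult[OF kern_near(1)[OF s \<delta>1(1)], of "2 * \<gamma>"]
    note i4 = kern_integrable_add[OF i2 i3(1)]
    have "kern_integral s (second_diff \<delta>1 U \<psi> (U x0) x0 z) \<le>
        kern_integral s (\<lambda>t. second_diff \<delta> U \<phi> (U x0) x0 z t + 2 * \<gamma> * (if t < \<delta>1 then t\<^sup>2 else 0))"
    proof (rule kern_integral_mono[OF i1 i4(1)])
      fix t :: real assume t: "0 < t"
      consider "t < \<delta>1" | "\<delta>1 \<le> t" "t < \<delta>" | "\<delta> \<le> t" by linarith
      then show "second_diff \<delta>1 U \<psi> (U x0) x0 z t
          \<le> second_diff \<delta> U \<phi> (U x0) x0 z t + 2 * \<gamma> * (if t < \<delta>1 then t\<^sup>2 else 0)"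
      proof cases
        case 1
        then show ?thesis using \<delta>1(2) z unfolding second_diff_def \<psi>_def by (simp add: algebra_simps)
      next
        case 2
        then show ?thesis using touch[of "x0 + t *\<^sub>R z"] touch[of "x0 - t *\<^sub>R z"] z t
          unfolding second_diff_def by (simp add: dist_norm)
      next
        case 3
        then show ?thesis using \<delta>1(2) unfolding second_diff_def by simp
      qed
    qed
    moreover have "\<dots> = ?I + 2 * \<gamma> * K"
      using i4(2) i3(2) kern_near(2)[OF s \<delta>1(1)] by (simp add: K_def)
    ultimately show ?thesis by linarith
  qed
  have "0 \<le> ?I"
  proof (rule field_le_epsilon)
    fix e :: real assume e: "0 < e"
    define \<gamma> where "\<gamma> = e / (2 * K + 1)"
    have "0 < \<gamma>" using e K by (simp add: \<gamma>_def)
    moreover have "2 * \<gamma> * K \<le> e" using e K by (simp add: \<gamma>_def field_simps)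
    ultimately show "0 \<le> ?I + e" using main[of \<gamma>] by linarith
  qed
  then show "0 \<le> kern_integral s (second_diff \<delta> (usc_env perron) \<phi> (usc_env perron x0) x0 z)"
    by (simp add: U_def)
qed

text \<open>Failure means a uniform excess \<eta> in all directions at x0. The excess persists as
  nonnegativity at nearby points and heights, so the test function lifted slightly above V is a
  subsolution where it exceeds u, and gluing it to u contradicts maximality.\<close>

lemma super_at_lsc_env:
  assumes u: "u \<in> perron_class" and maximal: "\<And>w x. w \<in> perron_class \<Longrightarrow> w x \<le> u x"
    and x0: "x0 \<in> closure \<Omega>" "x0 \<in> frontier \<Omega> \<Longrightarrow> lsc_env u x0 < g x0"
  shows "super_at s (lsc_env u) x0"
proof (rule ccontr)
  define V where "V = lsc_env u"
  assume "\<not> super_at s (lsc_env u) x0"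
  then obtain \<delta> \<phi> \<eta> where \<delta>: "0 < \<delta>" and \<phi>: "C2_fun \<phi>" and \<eta>: "0 < \<eta>"
    and tch: "\<forall>y\<in>ball x0 \<delta>. V y - \<phi> y \<ge> V x0 - \<phi> x0"
    and big: "\<forall>z\<in>sphere 0 1. \<eta> \<le> kern_integral s (second_diff \<delta> V \<phi> (V x0) x0 z)"
    unfolding super_at_def V_def by (auto simp: not_less)
  have touch: "V x0 - \<phi> x0 \<le> V y - \<phi> y" if "dist y x0 < \<delta>" for y
    using tch that by (simp add: dist_commute)
  note ub = perron_classD(2)[OF u]
  have ub': "\<forall>x. \<bar>- u x\<bar> \<le> B" using ub by simp
  have Veq: "V x = - usc_env (\<lambda>x. - u x) x" for x unfolding V_def by (rule lsc_env_eq)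
  have Vusc: "usc (\<lambda>x. - V x)" unfolding Veq using usc_usc_env[OF ub'] by simp
  have Vb: "\<forall>x. \<bar>V x\<bar> \<le> B" unfolding Veq using abs_usc_env_le[OF ub'] by simp
  have Vu: "V x \<le> u x" for x unfolding Veq using usc_env_ge[OF ub', of x] by simp
  note mV = borel_measurable_lsc[OF Vusc]

  define \<delta>1 where "\<delta>1 = \<delta> / 2"
  have \<delta>1: "0 < \<delta>1" "\<delta>1 < \<delta>" using \<delta> by (auto simp: \<delta>1_def)
  define K where "K = \<delta>1 powr (2 - 2 * s) / (2 - 2 * s)"
  have K: "0 < K" unfolding K_def using s \<delta>1(1) by simp
  \<comment> \<open>Half of the excess \<eta> is spent on making the contact strict: the penalty
    costs 2\<gamma>K = \<eta>/2.\<close>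
  define \<gamma> where "\<gamma> = \<eta> / (4 * K)"
  have \<gamma>: "0 < \<gamma>" "2 * \<gamma> * K = \<eta> / 2" using \<eta> K by (auto simp: \<gamma>_def field_simps)
  define \<psi> where "\<psi> y = \<phi> y - \<gamma> * (norm (y - x0))\<^sup>2" for y
  have \<psi>: "C2_fun \<psi>" using C2_fun_add_quadratic[OF \<phi>, of "- \<gamma>" x0 0 0] by (simp add: \<psi>_def[abs_def])

  have half: "\<eta> / 2 \<le> kern_integral s (second_diff \<delta>1 V \<psi> (V x0) x0 z)" if z: "norm z = 1" for z
  proof -
    note i1 = kern_integrable_second_diff[OF s \<delta>1(1) \<psi> mV Vb z, of "V x0" x0]
    note i2 = kern_integrable_second_diff[OF s \<delta> \<phi> mV Vb z, of "V x0" x0]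
    note i3 = kern_integrable_cmult[OF kern_near(1)[OF s \<delta>1(1)], of "2 * \<gamma>"]
    note i4 = kern_integrable_add[OF i1 i3(1)]
    have "\<eta> \<le> kern_integral s (second_diff \<delta> V \<phi> (V x0) x0 z)" using big z by simp
    also have "\<dots> \<le> kern_integral s (\<lambda>t. second_diff \<delta>1 V \<psi> (V x0) x0 z t + 2 * \<gamma> * (if t < \<delta>1 then t\<^sup>2 else 0))"
    proof (rule kern_integral_mono[OF i2 i4(1)])
      fix t :: real assume t: "0 < t"
      consider "t < \<delta>1" | "\<delta>1 \<le> t" "t < \<delta>" | "\<delta> \<le> t" by linarith
      then show "second_diff \<delta> V \<phi> (V x0) x0 z t
          \<le> second_diff \<delta>1 V \<psi> (V x0) x0 z t + 2 * \<gamma> * (if t < \<delta>1 then t\<^sup>2 else 0)"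
      proof cases
        case 1
        then show ?thesis using \<delta>1(2) z unfolding second_diff_def \<psi>_def by (simp add: algebra_simps)
      next
        case 2
        then show ?thesis using touch[of "x0 + t *\<^sub>R z"] touch[of "x0 - t *\<^sub>R z"] z t
          unfolding second_diff_def by (simp add: dist_norm)
      next
        case 3
        then show ?thesis using \<delta>1(2) unfolding second_diff_def by simp
      qed
    qed
    also have "\<dots> = kern_integral s (second_diff \<delta>1 V \<psi> (V x0) x0 z) + \<eta> / 2"
      using i4(2) i3(2) kern_near(2)[OF s \<delta>1(1)] \<gamma>(2) by (simp add: K_def)
    finally show ?thesis by linarith
  qed

  \<comment> \<open>A sequence of failures has convergent directions; lower semicontinuity of V
    passes the negative integrals to the limit at x0, against the remaining excess \<eta>/2.\<close>
  have "\<exists>\<rho>>0. \<forall>y c z. dist y x0 < \<rho> \<longrightarrow> \<bar>c - V x0\<bar> < \<rho> \<longrightarrow> norm z = 1 \<longrightarrow>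
      0 \<le> kern_integral s (second_diff \<delta>1 V \<psi> c y z)"
  proof (rule ccontr)
    assume neg: "\<not> ?thesis"
    have "\<exists>y c z. dist y x0 < 1 / real (Suc n) \<and> \<bar>c - V x0\<bar> < 1 / real (Suc n) \<and> norm z = 1 \<and>
        kern_integral s (second_diff \<delta>1 V \<psi> c y z) < 0" for n
    proof -
      have "0 < 1 / real (Suc n)" by simp
      then show ?thesis using neg by (meson not_le)
    qed
    then obtain Y c Z where Y: "\<And>n. dist (Y n) x0 < 1 / real (Suc n)"
      and c: "\<And>n. \<bar>c n - V x0\<bar> < 1 / real (Suc n)" and Z: "\<And>n. norm (Z n) = 1"
      and lt: "\<And>n. kern_integral s (second_diff \<delta>1 V \<psi> (c n) (Y n) (Z n)) < 0" by metis
    have elim: "(\<lambda>n. 1 / real (Suc n)) \<longlonglongrightarrow> 0" by (rule LIMSEQ_Suc[OF lim_1_over_n])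
    have "\<forall>n. Z n \<in> sphere 0 1" using Z by simp
    then obtain z \<pi> where z: "z \<in> sphere 0 1" "strict_mono (\<pi> :: nat \<Rightarrow> nat)" "(Z \<circ> \<pi>) \<longlonglongrightarrow> z"
      using compact_sphere[of "0 :: 'a" 1] unfolding compact_def by metis
    have zn: "norm z = 1" using z(1) by simp
    have Zlim: "(\<lambda>n. Z (\<pi> n)) \<longlonglongrightarrow> z" using z(3) by (simp add: o_def)
    have "Y \<longlonglongrightarrow> x0"
    proof (rule metric_tendsto_imp_tendsto[OF elim], intro always_eventually allI)
      show "dist (Y n) x0 \<le> dist (1 / real (Suc n)) 0" for n using Y[of n] by (simp add: dist_real_def)
    qed
    from LIMSEQ_subseq_LIMSEQ[OF this z(2)] have Ylim: "(\<lambda>n. Y (\<pi> n)) \<longlonglongrightarrow> x0" by (simp add: o_def)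
    have "c \<longlonglongrightarrow> V x0"
    proof (rule metric_tendsto_imp_tendsto[OF elim], intro always_eventually allI)
      show "dist (c n) (V x0) \<le> dist (1 / real (Suc n)) 0" for n using c[of n] by (simp add: dist_real_def)
    qed
    from LIMSEQ_subseq_LIMSEQ[OF this z(2)] have clim: "(\<lambda>n. c (\<pi> n)) \<longlonglongrightarrow> V x0" by (simp add: o_def)
    obtain C where C: "\<And>c x z t. x \<in> cball x0 1 \<Longrightarrow> norm z = 1 \<Longrightarrow> \<bar>c\<bar> \<le> B + 1 \<Longrightarrow> 0 < t \<Longrightarrow>
       \<bar>second_diff \<delta>1 V \<psi> c x z t\<bar> \<le> (if t < \<delta>1 then C * t\<^sup>2 else 2 * B + 2 * (B + 1))"
      using second_diff_bound[OF \<psi>, of x0 1 "B + 1" B \<delta>1] Vb by metis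
    have le1: "1 / real (Suc n) \<le> 1" for n by simp
    have "0 \<le> kern_integral s (\<lambda>t. - 1 * second_diff \<delta>1 V \<psi> (V x0) x0 z t)"
    proof (rule kern_integral_fatou[OF s \<delta>1(1)])
      show "(\<lambda>t. - 1 * second_diff \<delta>1 V \<psi> (c (\<pi> n)) (Y (\<pi> n)) (Z (\<pi> n)) t) \<in> borel_measurable borel" for n
        using borel_measurable_second_diff[OF \<psi> mV] by measurable
      show "(\<lambda>t. - 1 * second_diff \<delta>1 V \<psi> (V x0) x0 z t) \<in> borel_measurable borel"
        using borel_measurable_second_diff[OF \<psi> mV] by measurable
      show "\<bar>- 1 * second_diff \<delta>1 V \<psi> (c (\<pi> n)) (Y (\<pi> n)) (Z (\<pi> n)) t\<bar>
          \<le> (if t < \<delta>1 then C * t\<^sup>2 else 2 * B + 2 * (B + 1))" if "0 < t" for n t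
      proof -
        have "dist (Y (\<pi> n)) x0 \<le> 1" using Y[of "\<pi> n"] le1[of "\<pi> n"] by linarith
        then have "Y (\<pi> n) \<in> cball x0 1" by (simp add: dist_commute)
        moreover have "\<bar>c (\<pi> n)\<bar> \<le> B + 1" using c[of "\<pi> n"] le1[of "\<pi> n"] spec[OF Vb, of x0] by linarith
        ultimately show ?thesis using C[OF _ Z _ that] by (simp only: abs_mult abs_minus_cancel abs_one mult_1_left)
      qed
      show "\<bar>- 1 * second_diff \<delta>1 V \<psi> (V x0) x0 z t\<bar> \<le> (if t < \<delta>1 then C * t\<^sup>2 else 2 * B + 2 * (B + 1))"
        if "0 < t" for t
      proof -
        have "\<bar>V x0\<bar> \<le> B + 1" using spec[OF Vb, of x0] by linarith
        then show ?thesis using C[of x0, OF _ zn _ that] by (simp only: abs_mult abs_minus_cancel abs_one mult_1_left centre_in_cball)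
      qed
      show "0 \<le> kern_integral s (\<lambda>t. - 1 * second_diff \<delta>1 V \<psi> (c (\<pi> n)) (Y (\<pi> n)) (Z (\<pi> n)) t)" for n
        using kern_integrable_cmult(2)[OF kern_integrable_second_diff[OF s \<delta>1(1) \<psi> mV Vb Z], of "-1" "c (\<pi> n)" "Y (\<pi> n)" "\<pi> n"]
          lt[of "\<pi> n"] by simp
      fix t e :: real assume t: "0 < t" and e: "0 < e"
      show "\<forall>\<^sub>F n in sequentially. - 1 * second_diff \<delta>1 V \<psi> (c (\<pi> n)) (Y (\<pi> n)) (Z (\<pi> n)) t
          < - 1 * second_diff \<delta>1 V \<psi> (V x0) x0 z t + e"
      proof (cases "t < \<delta>1")
        case True
        have "\<forall>\<^sub>F n in sequentially. \<psi> (x0 + t *\<^sub>R z) + \<psi> (x0 - t *\<^sub>R z) - 2 * \<psi> x0 - e <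
           \<psi> (Y (\<pi> n) + t *\<^sub>R Z (\<pi> n)) + \<psi> (Y (\<pi> n) - t *\<^sub>R Z (\<pi> n)) - 2 * \<psi> (Y (\<pi> n))"
          using e by (intro order_tendstoD(1)[OF tendsto_second_difference[OF \<psi> Ylim Zlim]]) simp
        then show ?thesis
          by eventually_elim (use True in \<open>simp add: second_diff_def\<close>)
      next
        case False
        have "\<forall>\<^sub>F n in sequentially. - V (Y (\<pi> n) + \<sigma> *\<^sub>R Z (\<pi> n)) < - V (x0 + \<sigma> *\<^sub>R z) + e / 4" for \<sigma>
          using e by (intro usc_tendsto[OF Vusc] tendsto_intros Ylim Zlim) simp
        note 1 = this[of t] this[of "- t"]
        have 2: "\<forall>\<^sub>F n in sequentially. c (\<pi> n) < V x0 + e / 4"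
          using order_tendstoD(2)[OF clim, of "V x0 + e / 4"] e by simp
        show ?thesis using 1 2
          by eventually_elim (use False in \<open>simp add: second_diff_def\<close>)
      qed
    qed (rule tendsto_const)
    then show False
      using kern_integrable_cmult(2)[OF kern_integrable_second_diff[OF s \<delta>1(1) \<psi> mV Vb zn], of "-1" "V x0" x0]
        half[OF zn] \<eta> by simp
  qed
  then obtain \<rho> where \<rho>: "0 < \<rho>" and stable: "\<And>y c z. dist y x0 < \<rho> \<Longrightarrow> \<bar>c - V x0\<bar> < \<rho> \<Longrightarrow> norm z = 1 \<Longrightarrow>
      0 \<le> kern_integral s (second_diff \<delta>1 V \<psi> c y z)" by blast

  \<comment> \<open>At height B the point x0 would be a global maximum of V and all second
    differences nonpositive. The strict inequality is the room needed to raise u within the bound of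
    the class.\<close>
  have VB: "V x0 < B"
  proof (rule ccontr)
    assume "\<not> V x0 < B"
    then have max: "V y \<le> V x0" for y using spec[OF Vb, of y] by linarith
    obtain z :: 'a where z: "norm z = 1" using norm_Basis nonempty_Basis by blast
    have "0 \<le> kern_integral s (\<lambda>t. - 1 * second_diff \<delta> V \<phi> (V x0) x0 z t)"
    proof (rule kern_integral_nonneg)
      fix t :: real assume t: "0 < t"
      have "\<phi> (x0 + t *\<^sub>R z) \<le> \<phi> x0" "\<phi> (x0 - t *\<^sub>R z) \<le> \<phi> x0" if "t < \<delta>"
        using touch[of "x0 + t *\<^sub>R z"] touch[of "x0 - t *\<^sub>R z"] max[of "x0 + t *\<^sub>R z"] max[of "x0 - t *\<^sub>R z"]
          z t that by (auto simp: dist_norm)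
      then show "0 \<le> - 1 * second_diff \<delta> V \<phi> (V x0) x0 z t"
        using max[of "x0 + t *\<^sub>R z"] max[of "x0 - t *\<^sub>R z"] unfolding second_diff_def by auto
    qed
    moreover have "\<eta> \<le> kern_integral s (second_diff \<delta> V \<phi> (V x0) x0 z)" using big z by simp
    ultimately show False
      using kern_integrable_cmult(2)[OF kern_integrable_second_diff[OF s \<delta> \<phi> mV Vb z], of "-1" "V x0" x0] \<eta> by simp
  qed

  obtain r1 c1 where r1: "0 < r1" "0 < c1" "\<And>y. y \<notin> \<Omega> \<Longrightarrow> dist y x0 < r1 \<Longrightarrow> V x0 + c1 < g y"
    using g_greater_near[OF x0] unfolding V_def by blast
  \<comment> \<open>The height available to the bump: below g off the domain, below B, and inside
    the window where nonnegativity persists.\<close>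
  define c2 where "c2 = min c1 (min (B - V x0) \<rho>)"
  have c2: "0 < c2" "c2 \<le> c1" "c2 \<le> B - V x0" "c2 \<le> \<rho>" using r1(2) VB \<rho> by (auto simp: c2_def)
  obtain r2 where r2: "0 < r2" "\<And>y. dist y x0 < r2 \<Longrightarrow> \<bar>\<psi> y - \<psi> x0\<bar> < c2 / 4"
    using isCont_C2_fun[OF \<psi>, of x0] c2(1) unfolding continuous_at_eps_delta dist_real_def
    by (metis divide_pos_pos zero_less_numeral)
  define r where "r = min (min r1 r2) (min \<rho> \<delta>1)"
  have r: "0 < r" "r \<le> r1" "r \<le> r2" "r \<le> \<rho>" "r \<le> \<delta>1" using r1 r2 \<rho> \<delta>1 by (auto simp: r_def)
  \<comment> \<open>The lift. At distance r/2 the strictness \<gamma> (r/2)^2 has used it up, so the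
    bump lies below V from there on; c2/4 leaves room for the oscillation of \<psi>.\<close>
  define \<kappa> where "\<kappa> = min (c2 / 4) (\<gamma> * (r / 2)\<^sup>2)"
  have \<kappa>: "0 < \<kappa>" "\<kappa> \<le> c2 / 4" "\<kappa> \<le> \<gamma> * (r / 2)\<^sup>2" using c2(1) \<gamma>(1) r(1) by (auto simp: \<kappa>_def)
  define \<beta> where "\<beta> y = \<psi> y - \<psi> x0 + V x0 + \<kappa>" for y
  have \<psi>x0: "\<psi> x0 = \<phi> x0" by (simp add: \<psi>_def)
  have \<beta>near: "\<bar>\<beta> y - V x0\<bar> < c2" if "dist y x0 < r" for y
  proof -
    have "\<bar>\<psi> y - \<psi> x0\<bar> < c2 / 4" using that r(3) by (intro r2(2)) linarith
    then show ?thesis using \<kappa>(1,2) c2(1) unfolding \<beta>_def by linarith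
  qed
  have \<beta>far: "\<beta> y \<le> V y" if "r / 2 \<le> dist y x0" "dist y x0 < \<delta>" for y
  proof -
    have "(r / 2)\<^sup>2 \<le> (norm (y - x0))\<^sup>2" using that(1) r(1) by (intro power_mono) (auto simp: dist_norm)
    then have "\<gamma> * (r / 2)\<^sup>2 \<le> \<gamma> * (norm (y - x0))\<^sup>2" using \<gamma>(1) by simp
    then show ?thesis using touch[OF that(2)] \<kappa>(3) \<psi>x0 unfolding \<beta>_def \<psi>_def by linarith
  qed
  define w where "w y = (if dist y x0 < r then max (u y) (\<beta> y) else u y)" for y
  have wu: "u y \<le> w y" for y by (simp add: w_def)
  \<comment> \<open>The modification thus ends at r/2 while the case distinction is at r; on the
    annulus between, both formulas agree, so w has no jump at radius r.\<close>
  have weq: "w y = u y" if "r / 2 \<le> dist y x0" for y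
    using \<beta>far[OF that] Vu[of y] r(5) \<delta>1(2) by (auto simp: w_def max_def)
  have w\<beta>: "\<beta> y \<le> w y" if "dist y x0 < \<delta>" for y
    using \<beta>far[OF _ that] Vu[of y] r(1) by (cases "dist y x0 < r") (auto simp: w_def)
  have wV: "V y \<le> w y" for y using Vu[of y] wu[of y] by linarith
  have \<beta>cont: "isCont \<beta> y" for y unfolding \<beta>_def by (intro continuous_intros isCont_C2_fun[OF \<psi>])
  have wusc: "usc w"
  proof (rule uscI)
    fix x and e :: real assume e: "0 < e"
    have 1: "\<forall>\<^sub>F y in nhds x. u y < u x + e" by (rule uscD[OF perron_classD(1)[OF u] e])
    have 2: "\<forall>\<^sub>F y in nhds x. \<beta> y < \<beta> x + e" by (rule uscD[OF usc_continuous[OF \<beta>cont] e])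
    have dc: "((\<lambda>y. dist y x0) \<longlongrightarrow> dist x x0) (nhds x)" by (intro tendsto_intros filterlim_ident)
    show "\<forall>\<^sub>F y in nhds x. w y < w x + e"
    proof (cases "dist x x0 < r")
      case True
      from order_tendstoD(2)[OF dc True] 1 2 show ?thesis
        by eventually_elim (use True in \<open>auto simp: w_def\<close>)
    next
      case False
      then have "r / 2 < dist x x0" using r(1) by linarith
      from order_tendstoD(1)[OF dc this] 1 show ?thesis
      proof eventually_elim
        case (elim y)
        then show ?case using weq[of y] wu[of x] by linarith
      qed
    qed
  qed
  have wb: "\<forall>x. \<bar>w x\<bar> \<le> B"
  proof
    fix x
    have "\<beta> x \<le> B" if "dist x x0 < r" using \<beta>near[OF that] c2(3) by linarith
    then have "w x \<le> B" using spec[OF ub, of x] by (auto simp: w_def)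
    then show "\<bar>w x\<bar> \<le> B" using wu[of x] spec[OF ub, of x] by linarith
  qed
  have woff: "w x = g x" if "x \<notin> \<Omega>" for x
  proof -
    have "\<beta> x \<le> u x" if "dist x x0 < r"
      using \<beta>near[OF that] r1(3)[OF \<open>x \<notin> \<Omega>\<close>] that r(2) c2(2) perron_classD(3)[OF u \<open>x \<notin> \<Omega>\<close>] by auto
    then show ?thesis using perron_classD(3)[OF u that] by (auto simp: w_def max_def)
  qed
  have wsub: "sub_at s w y" if y: "y \<in> \<Omega>" for y
  proof (cases "w y = u y")
    case True
    then show ?thesis
      using sub_at_mono[OF perron_classD(1,2)[OF u] wusc wb wu _ perron_classD(4)[OF u y]] by simp
  next
    case False
    then have d: "dist y x0 < r / 2" using weq[of y] by force
    then have dr: "dist y x0 < r" using r(1) by linarith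
    then have wy: "w y = \<beta> y" using False by (simp add: w_def max_def split: if_splits)
    show ?thesis
      unfolding sub_at_def
    proof (intro allI impI ballI)
      fix \<delta>' \<theta> and z :: 'a
      assume *: "0 < \<delta>'" "C2_fun \<theta>" "\<forall>a\<in>ball y \<delta>'. w a - \<theta> a \<le> w y - \<theta> y" "z \<in> sphere 0 1"
      then have z: "norm z = 1" by simp
      have "0 \<le> kern_integral s (second_diff \<delta>1 V \<psi> (\<beta> y) y z)"
        using dr r(4) \<beta>near[OF dr] c2(4) by (intro stable[OF _ _ z]) auto
      also have "\<dots> \<le> kern_integral s (second_diff \<delta>' w \<theta> (w y) y z)"
      proof (rule kern_integral_mono)
        fix t :: real assume t: "0 < t"
        \<comment> \<open>Increments of \<psi> lie below those of w, which dominates \<beta> with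
          equality at y, and increments of w below those of the touching \<theta>. The integrands
          therefore compare whichever of the two radii is larger.\<close>
        have 1: "w (y + \<sigma> *\<^sub>R z) - w y \<le> \<theta> (y + \<sigma> *\<^sub>R z) - \<theta> y" if "\<bar>\<sigma>\<bar> = t" "t < \<delta>'" for \<sigma>
          using bspec[OF *(3), of "y + \<sigma> *\<^sub>R z"] that z by (auto simp: dist_norm)
        have 2: "\<psi> (y + \<sigma> *\<^sub>R z) - \<psi> y \<le> w (y + \<sigma> *\<^sub>R z) - w y" if "\<bar>\<sigma>\<bar> = t" "t < \<delta>1" for \<sigma>
        proof -
          have "dist (y + \<sigma> *\<^sub>R z) x0 \<le> dist (y + \<sigma> *\<^sub>R z) y + dist y x0" by (rule dist_triangle)
          also have "dist (y + \<sigma> *\<^sub>R z) y = t" using that z by (simp add: dist_norm)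
          finally have "dist (y + \<sigma> *\<^sub>R z) x0 < \<delta>" using that(2) dr r(5) by (simp add: \<delta>1_def)
          from w\<beta>[OF this] show ?thesis unfolding wy by (simp add: \<beta>_def)
        qed
        show "second_diff \<delta>1 V \<psi> (\<beta> y) y z t \<le> second_diff \<delta>' w \<theta> (w y) y z t"
          using 1[of t] 1[of "- t"] 2[of t] 2[of "- t"] t wV[of "y + t *\<^sub>R z"] wV[of "y - t *\<^sub>R z"] wy
          unfolding second_diff_def by (cases "t < \<delta>1"; cases "t < \<delta>'") simp_all
      qed (rule kern_integrable_second_diff[OF s \<delta>1(1) \<psi> mV Vb z]
          kern_integrable_second_diff[OF s *(1,2) borel_measurable_usc[OF wusc] wb z])+
      finally show "0 \<le> kern_integral s (second_diff \<delta>' w \<theta> (w y) y z)" .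
    qed
  qed
  have "w \<in> perron_class" unfolding perron_class_def using wusc wb woff wsub by blast
  then have wle: "w y \<le> u y" for y by (rule maximal)

  \<comment> \<open>Maximality gives u \<ge> w \<ge> \<beta> near x0, and half of the lift survives
    by continuity, against V being the lower envelope of u.\<close>
  have "V x0 + \<kappa> / 2 < \<beta> x0" using \<kappa>(1) by (simp add: \<beta>_def)
  then have "\<forall>\<^sub>F y in nhds x0. V x0 + \<kappa> / 2 < \<beta> y"
    using order_tendstoD(1)[OF \<beta>cont[unfolded isCont_def tendsto_at_iff_tendsto_nhds]] by blast
  then obtain r' where r': "0 < r'" "\<And>y. dist y x0 < r' \<Longrightarrow> V x0 + \<kappa> / 2 < \<beta> y"
    unfolding eventually_nhds_metric by blast
  have "usc_env (\<lambda>x. - u x) x0 \<le> - (V x0 + \<kappa> / 2)"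
  proof (rule usc_env_le[OF ub', of "min r r'"])
    show "0 < min r r'" using r(1) r'(1) by simp
    fix y assume "y \<in> ball x0 (min r r')"
    then have "V x0 + \<kappa> / 2 < \<beta> y" "\<beta> y \<le> w y"
      using r'(2)[of y] by (auto simp: dist_commute w_def)
    then show "- u y \<le> - (V x0 + \<kappa> / 2)" using wle[of y] by linarith
  qed
  then show False using Veq[of x0] \<kappa>(1) by linarith
qed

section \<open>Envelopes of functions prescribed outside the closure\<close>

lemma usc_env_exterior:
  assumes u: "\<forall>x. \<bar>u x\<bar> \<le> D" "\<And>x. x \<notin> closure \<Omega> \<Longrightarrow> u x = h x"
    and h: "\<And>x e. x \<notin> \<Omega> \<Longrightarrow> 0 < e \<Longrightarrow> \<exists>r>0. \<forall>y. y \<notin> \<Omega> \<longrightarrow> dist y x < r \<longrightarrow> \<bar>h y - h x\<bar> < e"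
  shows "x \<notin> closure \<Omega> \<Longrightarrow> usc_env u x = h x" and "x \<in> frontier \<Omega> \<Longrightarrow> h x \<le> usc_env u x"
proof -
  assume x: "x \<notin> closure \<Omega>"
  then have x\<Omega>: "x \<notin> \<Omega>" using closure_subset by blast
  obtain r0 where r0: "0 < r0" "ball x r0 \<subseteq> - closure \<Omega>"
    using x open_contains_ball[of "- closure \<Omega>"] by blast
  show "usc_env u x = h x"
  proof (rule antisym)
    show "h x \<le> usc_env u x" using usc_env_ge[OF u(1), of x] u(2)[OF x] by simp
    show "usc_env u x \<le> h x"
    proof (rule field_le_epsilon)
      fix e :: real assume "0 < e"
      then obtain r where r: "0 < r" "\<And>y. y \<notin> \<Omega> \<Longrightarrow> dist y x < r \<Longrightarrow> \<bar>h y - h x\<bar> < e"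
        using h[OF x\<Omega>] by blast
      show "usc_env u x \<le> h x + e"
      proof (rule usc_env_le[OF u(1), of "min r0 r"])
        show "0 < min r0 r" using r0 r by simp
        fix y assume y: "y \<in> ball x (min r0 r)"
        then have yc: "y \<notin> closure \<Omega>" using r0(2) by auto
        then have "y \<notin> \<Omega>" using closure_subset by blast
        then have "\<bar>h y - h x\<bar> < e" using r(2)[of y] y by (simp add: dist_commute)
        then show "u y \<le> h x + e" using u(2)[OF yc] by linarith
      qed
    qed
  qed
next
  assume x: "x \<in> frontier \<Omega>"
  \<comment> \<open>The outward normal provides exterior points x + t\<nu> arbitrarily near the
    boundary point, where u equals h.\<close>
  obtain \<nu> where \<nu>: "norm \<nu> = 1" "\<And>y. y \<in> closure \<Omega> \<Longrightarrow> y \<noteq> x \<Longrightarrow> 0 < \<nu> \<bullet> (x - y)"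
    by (rule supporting_normal[OF x]) iprover
  show "h x \<le> usc_env u x"
  proof (rule ccontr)
    assume "\<not> h x \<le> usc_env u x"
    define e where "e = (h x - usc_env u x) / 2"
    have e: "0 < e" "usc_env u x < h x - e" using \<open>\<not> h x \<le> usc_env u x\<close> by (auto simp: e_def field_simps)
    obtain r where r: "0 < r" "\<forall>y\<in>ball x r. u y < h x - e" using usc_env_less[OF u(1) e(2)] by blast
    obtain r' where r': "0 < r'" "\<And>y. y \<notin> \<Omega> \<Longrightarrow> dist y x < r' \<Longrightarrow> \<bar>h y - h x\<bar> < e"
      using h[OF frontier_notin[OF x] e(1)] by blast
    define t where "t = min r r' / 2"
    have t: "0 < t" "t < r" "t < r'" using r(1) r'(1) by (auto simp: t_def)
    let ?y = "x + t *\<^sub>R \<nu>"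
    have d: "dist ?y x = t" using t(1) \<nu>(1) by (simp add: dist_norm)
    have "\<nu> \<bullet> \<nu> = 1" using \<nu>(1) by (simp add: dot_square_norm)
    moreover have "\<nu> \<noteq> 0" using \<nu>(1) by auto
    ultimately have "?y \<notin> closure \<Omega>" using \<nu>(2)[of ?y] t(1) by auto
    moreover from this have "?y \<notin> \<Omega>" using closure_subset by blast
    ultimately have "h x - e < u ?y" using u(2)[of ?y] r'(2)[of ?y] d t by (simp add: abs_less_iff)
    moreover have "u ?y < h x - e" using r(2) d t by (simp add: dist_commute)
    ultimately show False by simp
  qed
qed

context
  fixes u :: "'a \<Rightarrow> real" and D :: real
  assumes u_le: "\<forall>x. \<bar>u x\<bar> \<le> D" and u_off: "\<And>x. x \<notin> closure \<Omega> \<Longrightarrow> u x = g x"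
begin

lemma envelope_facts:
  shows "usc (usc_env u)" "\<forall>x. \<bar>usc_env u x\<bar> \<le> D" "\<And>x. u x \<le> usc_env u x"
    "\<And>x. x \<notin> closure \<Omega> \<Longrightarrow> usc_env u x = g x" "\<And>x. x \<in> frontier \<Omega> \<Longrightarrow> g x \<le> usc_env u x"
    "usc (\<lambda>x. - lsc_env u x)" "\<forall>x. \<bar>lsc_env u x\<bar> \<le> D" "\<And>x. lsc_env u x \<le> u x"
    "\<And>x. x \<notin> closure \<Omega> \<Longrightarrow> lsc_env u x = g x" "\<And>x. x \<in> frontier \<Omega> \<Longrightarrow> lsc_env u x \<le> g x"
proof -
  have u': "\<forall>x. \<bar>- u x\<bar> \<le> D" using u_le by simp
  have neg: "\<exists>r>0. \<forall>y. y \<notin> \<Omega> \<longrightarrow> dist y x < r \<longrightarrow> \<bar>- g y - - g x\<bar> < e" if "x \<notin> \<Omega>" "0 < e" for x e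
    using continuous_g_ball[OF that] by (simp add: abs_minus_commute)
  show "usc (usc_env u)" "\<forall>x. \<bar>usc_env u x\<bar> \<le> D" "\<And>x. u x \<le> usc_env u x"
    using usc_usc_env[OF u_le] abs_usc_env_le[OF u_le] usc_env_ge[OF u_le] by auto
  show "usc (\<lambda>x. - lsc_env u x)" "\<forall>x. \<bar>lsc_env u x\<bar> \<le> D"
    unfolding lsc_env_eq using usc_usc_env[OF u'] abs_usc_env_le[OF u'] by auto
  show "lsc_env u x \<le> u x" for x unfolding lsc_env_eq using usc_env_ge[OF u', of x] by simp
  show "usc_env u x = g x" if "x \<notin> closure \<Omega>" for x
    using usc_env_exterior(1)[OF u_le u_off continuous_g_ball that] .
  show "g x \<le> usc_env u x" if "x \<in> frontier \<Omega>" for x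
    using usc_env_exterior(2)[OF u_le u_off continuous_g_ball that] .
  have off': "- u x = - g x" if "x \<notin> closure \<Omega>" for x using u_off[OF that] by simp
  show "lsc_env u x = g x" if "x \<notin> closure \<Omega>" for x
    unfolding lsc_env_eq using usc_env_exterior(1)[OF u' off' neg that] by simp
  show "lsc_env u x \<le> g x" if "x \<in> frontier \<Omega>" for x
    unfolding lsc_env_eq using usc_env_exterior(2)[OF u' off' neg that] by simp
qed

text \<open>On the boundary the envelope already dominates g, so the maximum changes nothing; off
  the closure both sides equal g.\<close>

lemma upper_ext_usc_env: "upper_ext \<Omega> g (usc_env u) = usc_env u"
  using envelope_facts(4,5) closure_cases by (fastforce simp: upper_ext_def fun_eq_iff max_def)

lemma lower_ext_lsc_env: "lower_ext \<Omega> g (lsc_env u) = lsc_env u"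
  using envelope_facts(9,10) closure_cases by (fastforce simp: lower_ext_def fun_eq_iff min_def)

text \<open>At a boundary point the minimum is already nonpositive when the envelope does not exceed
  g. The alternative thus demands the operator inequality only where the datum is exceeded, the form
  used in the boundary argument.\<close>

lemma subsol_cond_iff:
  "subsol_cond s \<Omega> g (usc_env u) \<longleftrightarrow>
     (\<forall>x\<in>closure \<Omega>. (x \<in> frontier \<Omega> \<longrightarrow> g x < usc_env u x) \<longrightarrow> sub_at s (usc_env u) x)"
proof -
  let ?U = "usc_env u"
  have E: "E_op s \<delta> (upper_ext \<Omega> g ?U) \<phi> c x \<le> 0 \<longleftrightarrow>
      (\<forall>z\<in>sphere 0 1. 0 \<le> kern_integral s (second_diff \<delta> ?U \<phi> c x z))" if "0 < \<delta>" "C2_fun \<phi>" for \<delta> \<phi> c x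
    unfolding upper_ext_usc_env
    by (rule E_op_sign(1)[OF s that borel_measurable_usc[OF envelope_facts(1)] envelope_facts(2)])
  show ?thesis
  proof
    assume *: "subsol_cond s \<Omega> g ?U"
    show "\<forall>x\<in>closure \<Omega>. (x \<in> frontier \<Omega> \<longrightarrow> g x < ?U x) \<longrightarrow> sub_at s ?U x"
      unfolding sub_at_def
    proof (intro ballI impI allI)
      fix x \<delta> \<phi> and z :: 'a
      assume x: "x \<in> closure \<Omega>" "x \<in> frontier \<Omega> \<longrightarrow> g x < ?U x" and \<delta>: "0 < \<delta>" and \<phi>: "C2_fun \<phi>"
        and t: "\<forall>y\<in>ball x \<delta>. ?U y - \<phi> y \<le> ?U x - \<phi> x" and z: "z \<in> sphere 0 1"
      have "(x \<in> \<Omega> \<longrightarrow> E_op s \<delta> (upper_ext \<Omega> g ?U) \<phi> (?U x) x \<le> 0) \<and>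
          (x \<in> frontier \<Omega> \<longrightarrow> min (E_op s \<delta> (upper_ext \<Omega> g ?U) \<phi> (?U x) x) (?U x - g x) \<le> 0)"
        using * \<delta> \<phi> t unfolding subsol_cond_def by blast
      then have "E_op s \<delta> (upper_ext \<Omega> g ?U) \<phi> (?U x) x \<le> 0"
        using x closure_cases[of x] by (cases "x \<in> \<Omega>") (auto simp: min_le_iff_disj)
      then show "0 \<le> kern_integral s (second_diff \<delta> ?U \<phi> (?U x) x z)" using E[OF \<delta> \<phi>] z by blast
    qed
  next
    assume *: "\<forall>x\<in>closure \<Omega>. (x \<in> frontier \<Omega> \<longrightarrow> g x < ?U x) \<longrightarrow> sub_at s ?U x"
    have main: "E_op s \<delta> (upper_ext \<Omega> g ?U) \<phi> (?U x) x \<le> 0"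
      if "0 < \<delta>" "C2_fun \<phi>" "\<forall>y\<in>ball x \<delta>. ?U y - \<phi> y \<le> ?U x - \<phi> x" "x \<in> closure \<Omega>"
        "x \<in> frontier \<Omega> \<longrightarrow> g x < ?U x" for \<delta> \<phi> x
      unfolding E[OF that(1,2)] using *[rule_format, OF that(4), unfolded sub_at_def] that by blast
    show "subsol_cond s \<Omega> g ?U"
      unfolding subsol_cond_def
    proof (intro conjI allI impI)
      show "?U x \<le> g x" if "x \<notin> closure \<Omega>" for x using envelope_facts(4)[OF that] by simp
      fix \<delta> \<phi> x
      assume a: "0 < \<delta>" "C2_fun \<phi>" "\<forall>y\<in>ball x \<delta>. ?U y - \<phi> y \<le> ?U x - \<phi> x"
      show "E_op s \<delta> (upper_ext \<Omega> g ?U) \<phi> (?U x) x \<le> 0" if "x \<in> \<Omega>"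
        using main[OF a] that closure_subset[of \<Omega>] frontier_notin by blast
      show "min (E_op s \<delta> (upper_ext \<Omega> g ?U) \<phi> (?U x) x) (?U x - g x) \<le> 0" if "x \<in> frontier \<Omega>"
        using main[OF a frontier_in_closure[OF that]] by (cases "g x < ?U x") (auto simp: min_le_iff_disj)
    qed
  qed
qed

lemma supersol_cond_iff:
  "supersol_cond s \<Omega> g (lsc_env u) \<longleftrightarrow>
     (\<forall>x\<in>closure \<Omega>. (x \<in> frontier \<Omega> \<longrightarrow> lsc_env u x < g x) \<longrightarrow> super_at s (lsc_env u) x)"
proof -
  let ?V = "lsc_env u"
  have E: "0 \<le> E_op s \<delta> (lower_ext \<Omega> g ?V) \<phi> c x \<longleftrightarrow>
      (\<forall>\<eta>>0. \<exists>z\<in>sphere 0 1. kern_integral s (second_diff \<delta> ?V \<phi> c x z) < \<eta>)" if "0 < \<delta>" "C2_fun \<phi>" for \<delta> \<phi> c x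
    unfolding lower_ext_lsc_env
    by (rule E_op_sign(2)[OF s that borel_measurable_lsc[OF envelope_facts(6)] envelope_facts(7)])
  show ?thesis
  proof
    assume *: "supersol_cond s \<Omega> g ?V"
    show "\<forall>x\<in>closure \<Omega>. (x \<in> frontier \<Omega> \<longrightarrow> ?V x < g x) \<longrightarrow> super_at s ?V x"
      unfolding super_at_def
    proof (intro ballI impI allI)
      fix x \<delta> \<phi> and \<eta> :: real
      assume x: "x \<in> closure \<Omega>" "x \<in> frontier \<Omega> \<longrightarrow> ?V x < g x" and \<delta>: "0 < \<delta>" and \<phi>: "C2_fun \<phi>"
        and t: "\<forall>y\<in>ball x \<delta>. ?V y - \<phi> y \<ge> ?V x - \<phi> x" and \<eta>: "0 < \<eta>"
      have "(x \<in> \<Omega> \<longrightarrow> 0 \<le> E_op s \<delta> (lower_ext \<Omega> g ?V) \<phi> (?V x) x) \<and>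
          (x \<in> frontier \<Omega> \<longrightarrow> 0 \<le> max (E_op s \<delta> (lower_ext \<Omega> g ?V) \<phi> (?V x) x) (?V x - g x))"
        using * \<delta> \<phi> t unfolding supersol_cond_def by blast
      then have "0 \<le> E_op s \<delta> (lower_ext \<Omega> g ?V) \<phi> (?V x) x"
        using x closure_cases[of x] by (cases "x \<in> \<Omega>") (auto simp: le_max_iff_disj)
      then show "\<exists>z\<in>sphere 0 1. kern_integral s (second_diff \<delta> ?V \<phi> (?V x) x z) < \<eta>" using E[OF \<delta> \<phi>] \<eta> by blast
    qed
  next
    assume *: "\<forall>x\<in>closure \<Omega>. (x \<in> frontier \<Omega> \<longrightarrow> ?V x < g x) \<longrightarrow> super_at s ?V x"
    have main: "0 \<le> E_op s \<delta> (lower_ext \<Omega> g ?V) \<phi> (?V x) x"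
      if "0 < \<delta>" "C2_fun \<phi>" "\<forall>y\<in>ball x \<delta>. ?V y - \<phi> y \<ge> ?V x - \<phi> x" "x \<in> closure \<Omega>"
        "x \<in> frontier \<Omega> \<longrightarrow> ?V x < g x" for \<delta> \<phi> x
      unfolding E[OF that(1,2)] using *[rule_format, OF that(4), unfolded super_at_def] that by blast
    show "supersol_cond s \<Omega> g ?V"
      unfolding supersol_cond_def
    proof (intro conjI allI impI)
      show "g x \<le> ?V x" if "x \<notin> closure \<Omega>" for x using envelope_facts(9)[OF that] by simp
      fix \<delta> \<phi> x
      assume a: "0 < \<delta>" "C2_fun \<phi>" "\<forall>y\<in>ball x \<delta>. ?V y - \<phi> y \<ge> ?V x - \<phi> x"
      show "0 \<le> E_op s \<delta> (lower_ext \<Omega> g ?V) \<phi> (?V x) x" if "x \<in> \<Omega>"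
        using main[OF a] that closure_subset[of \<Omega>] frontier_notin by blast
      show "0 \<le> max (E_op s \<delta> (lower_ext \<Omega> g ?V) \<phi> (?V x) x) (?V x - g x)" if "x \<in> frontier \<Omega>"
        using main[OF a frontier_in_closure[OF that]] by (cases "?V x < g x") (auto simp: le_max_iff_disj)
    qed
  qed
qed

end

section \<open>Uniqueness, continuity and existence\<close>

lemma viscosity_solution_facts:
  assumes "viscosity_solution s \<Omega> g u"
  shows "\<exists>D. \<forall>x. \<bar>u x\<bar> \<le> D" "\<And>x. x \<notin> closure \<Omega> \<Longrightarrow> u x = g x"
    "\<And>x. x \<notin> \<Omega> \<Longrightarrow> usc_env u x = g x" "\<And>x. x \<notin> \<Omega> \<Longrightarrow> lsc_env u x = g x"
    "\<And>x. x \<in> \<Omega> \<Longrightarrow> sub_at s (usc_env u) x" "\<And>x. x \<in> \<Omega> \<Longrightarrow> super_at s (lsc_env u) x"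
proof -
  have sub: "subsol_cond s \<Omega> g (usc_env u)" and sup: "supersol_cond s \<Omega> g (lsc_env u)"
    using assms unfolding viscosity_solution_def viscosity_subsolution_def viscosity_supersolution_def by auto
  have "bounded (range u)"
    using assms unfolding viscosity_solution_def viscosity_subsolution_def by blast
  then obtain D where D: "\<forall>x. \<bar>u x\<bar> \<le> D" unfolding bounded_iff by auto
  then have D': "\<forall>x. \<bar>- u x\<bar> \<le> D" by simp
  show "\<exists>D. \<forall>x. \<bar>u x\<bar> \<le> D" using D by blast
  \<comment> \<open>Outside the closure both envelopes and u are squeezed onto g; the envelope
    lemmas become applicable only after this.\<close>
  show off: "u x = g x" if "x \<notin> closure \<Omega>" for x
  proof -
    have "usc_env u x \<le> g x" "g x \<le> lsc_env u x"
      using sub sup that unfolding subsol_cond_def supersol_cond_def by blast+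
    moreover have "u x \<le> usc_env u x" by (rule usc_env_ge[OF D])
    moreover have "lsc_env u x \<le> u x" unfolding lsc_env_eq using usc_env_ge[OF D', of x] by simp
    ultimately show ?thesis by linarith
  qed
  note f = envelope_facts[OF D off]
  have subs: "sub_at s (usc_env u) x" if "x \<in> closure \<Omega>" "x \<in> frontier \<Omega> \<Longrightarrow> g x < usc_env u x" for x
    using subsol_cond_iff[OF D off] sub that by blast
  have sups: "super_at s (lsc_env u) x" if "x \<in> closure \<Omega>" "x \<in> frontier \<Omega> \<Longrightarrow> lsc_env u x < g x" for x
    using supersol_cond_iff[OF D off] sup that by blast
  have "usc_env u x \<le> g x" if "x \<in> frontier \<Omega>" for x
    by (rule subsolution_boundary[OF f(1,2) eq_refl[OF f(4)] that subs])
  then show "usc_env u x = g x" if "x \<notin> \<Omega>" for x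
    using f(4,5)[of x] closure_cases[of x] that by (cases "x \<in> closure \<Omega>") (auto intro: antisym)
  have "g x \<le> lsc_env u x" if "x \<in> frontier \<Omega>" for x
    by (rule supersolution_boundary[OF f(6,7) eq_refl[OF f(9)[symmetric]] that sups])
  then show "lsc_env u x = g x" if "x \<notin> \<Omega>" for x
    using f(9,10)[of x] closure_cases[of x] that by (cases "x \<in> closure \<Omega>") (auto intro: antisym)
  show "sub_at s (usc_env u) x" "super_at s (lsc_env u) x" if "x \<in> \<Omega>" for x
    using that subs sups frontier_notin closure_subset[of \<Omega>] by blast+
qed

text \<open>Both envelopes equal g off the domain, so comparison applies. Taken with u = v it yields
  continuity, taken in both orders uniqueness.\<close>

lemma envelope_le:
  assumes "viscosity_solution s \<Omega> g u" "viscosity_solution s \<Omega> g v"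
  shows "usc_env u x \<le> lsc_env v x"
proof -
  note u = viscosity_solution_facts[OF assms(1)] and v = viscosity_solution_facts[OF assms(2)]
  obtain D1 D2 where D12: "\<forall>x. \<bar>u x\<bar> \<le> D1" "\<forall>x. \<bar>v x\<bar> \<le> D2" using u(1) v(1) by blast
  define D where "D = max D1 D2"
  have u': "\<forall>x. \<bar>u x\<bar> \<le> D" and v': "\<forall>x. \<bar>v x\<bar> \<le> D" using D12 by (auto simp: D_def le_max_iff_disj)
  note fu = envelope_facts[OF u' u(2)] and fv = envelope_facts[OF v' v(2)]
  have "usc_env u y \<le> lsc_env v y" if "y \<notin> \<Omega>" for y using u(3)[OF that] v(4)[OF that] by simp
  then show ?thesis
    using comparison[OF s open_\<Omega> bounded_\<Omega> fu(1,2) fv(6,7) _ u(5) v(6)] by blast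
qed

lemma viscosity_solution_regular:
  assumes sol: "viscosity_solution s \<Omega> g u"
  shows "continuous_on (closure \<Omega>) u" and "x \<in> frontier \<Omega> \<Longrightarrow> u x = g x"
proof -
  note u = viscosity_solution_facts[OF sol]
  obtain D where D: "\<forall>x. \<bar>u x\<bar> \<le> D" using u(1) by blast
  note f = envelope_facts[OF D u(2)]
  have eq: "usc_env u x = u x" "lsc_env u x = u x" for x
    using envelope_le[OF sol sol, of x] f(3)[of x] f(8)[of x] by auto
  have usc: "usc u" "usc (\<lambda>x. - u x)" using f(1,6) unfolding eq by (simp_all add: eq[abs_def])
  have "isCont u x" for x
    unfolding isCont_def tendsto_at_iff_tendsto_nhds
  proof (rule order_tendstoI)
    fix a
    { assume "a < u x"
      then show "\<forall>\<^sub>F y in nhds x. a < u y" using uscD[OF usc(2), of "u x - a" x] by simp }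
    { assume "u x < a"
      then show "\<forall>\<^sub>F y in nhds x. u y < a" using uscD[OF usc(1), of "a - u x" x] by simp }
  qed
  then show "continuous_on (closure \<Omega>) u" by (simp add: continuous_at_imp_continuous_on)
  show "u x = g x" if "x \<in> frontier \<Omega>"
    using u(3)[OF frontier_notin[OF that]] eq(1) by simp
qed

lemma viscosity_solution_unique:
  assumes "viscosity_solution s \<Omega> g u" "viscosity_solution s \<Omega> g v"
  shows "u = v"
proof
  fix x
  note u = viscosity_solution_facts[OF assms(1)] and v = viscosity_solution_facts[OF assms(2)]
  obtain D1 D2 where D12: "\<forall>x. \<bar>u x\<bar> \<le> D1" "\<forall>x. \<bar>v x\<bar> \<le> D2" using u(1) v(1) by blast
  note fu = envelope_facts[OF D12(1) u(2)] and fv = envelope_facts[OF D12(2) v(2)]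
  show "u x = v x"
    using envelope_le[OF assms, of x] envelope_le[OF assms(2,1), of x] fu(3,8)[of x] fv(3,8)[of x] by linarith
qed

text \<open>Attainment of the datum puts the upper envelope of the supremum back into the class,
  hence below the supremum. The supremum is thus itself the largest member, which is what the bump
  argument perturbs.\<close>

lemma viscosity_solution_perron: "viscosity_solution s \<Omega> g perron"
proof -
  have off: "perron x = g x" if "x \<notin> closure \<Omega>" for x
    using perron_off that closure_subset by blast
  note f = envelope_facts[OF abs_perron_le off]
  have "usc_env perron x \<le> g x" if "x \<in> frontier \<Omega>" for x
    by (rule subsolution_boundary[OF f(1,2) eq_refl[OF f(4)] that sub_at_usc_env_perron])
  then have "usc_env perron x = g x" if "x \<notin> \<Omega>" for x
    using f(4,5)[of x] closure_cases[of x] that by (cases "x \<in> closure \<Omega>") (auto intro: antisym)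
  moreover have "sub_at s (usc_env perron) x" if "x \<in> \<Omega>" for x
    using that closure_subset[of \<Omega>] frontier_notin by (intro sub_at_usc_env_perron) auto
  ultimately have U: "usc_env perron \<in> perron_class"
    unfolding perron_class_def using f(1,2) by blast
  have "usc_env perron x = perron x" for x
    using perron_upper[OF U, of x] f(3)[of x] by simp
  then have "usc_env perron = perron" by (simp add: fun_eq_iff)
  then have P: "perron \<in> perron_class" using U by simp
  have "bounded (range perron)" unfolding bounded_iff using abs_perron_le by auto
  moreover have "subsol_cond s \<Omega> g (usc_env perron)"
    using subsol_cond_iff[OF abs_perron_le off] sub_at_usc_env_perron by blast
  moreover have "supersol_cond s \<Omega> g (lsc_env perron)"
    using supersol_cond_iff[OF abs_perron_le off] super_at_lsc_env[of perron, OF P] perron_upper by blast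
  ultimately show ?thesis
    unfolding viscosity_solution_def viscosity_subsolution_def viscosity_supersolution_def by blast
qed

end

theorem theorem2p3:
  fixes s :: real and \<Omega> :: "'a::euclidean_space set" and g :: "'a \<Rightarrow> real"
  assumes "0 < s" and "s < 1"
    and "bounded \<Omega>" and "C2_domain \<Omega>" and "strictly_convex_set \<Omega>"
    and "continuous_on (- \<Omega>) g" and "bounded (g ` (- \<Omega>))"
  shows "(\<exists>!u. viscosity_solution s \<Omega> g u) \<and>
         (\<forall>u. viscosity_solution s \<Omega> g u \<longrightarrow>
              continuous_on (closure \<Omega>) u \<and> (\<forall>x\<in>frontier \<Omega>. u x = g x))"
proof -
  obtain B where B: "\<And>x. x \<notin> \<Omega> \<Longrightarrow> \<bar>g x\<bar> \<le> B"
    using assms(7) unfolding bounded_iff by auto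
  have "open \<Omega>" using assms(4) unfolding C2_domain_def by blast
  interpret strictly_convex_dirichlet s \<Omega> g "\<bar>B\<bar>"
    by standard (use assms B \<open>open \<Omega>\<close> in \<open>force+\<close>)
  show ?thesis
    using viscosity_solution_perron viscosity_solution_unique viscosity_solution_regular by blast
qed

end
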